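(* Let $(E,\|\cdot\|)$ be a Banach space with dual unit ball $\mathcal{B}^*$, and let $X_1,\dots,X_n$ be i.i.d. random vectors valued in $E$ with expectation $\mu$ and empirical mean $\overline{X}_n=\frac1n\sum_{i=1}^nX_i$. Let $\xi=(\xi_1,\dots,\xi_n)$ be an exchangeable random vector, independent of $(X_1,\dots,X_n)$, with $\sum_{i=1}^n\xi_i=0$ a.s., and with $0<\kappa=\mathbb{E}[|\xi_1|]<\infty$; let $b=\|\xi_1\|_\infty$ be the essential supremum of $|\xi_1|$. Let $$\hat R_n=\mathbb{E}\left[\frac1n\left\|\sum_{i=1}^n\xi_iX_i\right\|\ \Big|\ X_1,\dots,X_n\right],\qquad \sigma_{\mathcal{B}}=\sup_{l\in\mathcal{B}^*}\sqrt{\mathrm{Var}(l(X_1))}.$$ Assume that $\|X_1-\mu\|\le M$ almost surely for some constant $M$. Let $x>0$. (i) With probability at least $1-2e^{-x}$, for all $\theta>0$, $$\|\overline{X}_n-\mu\|\le(1+\theta)^2\frac{2}{\kappa}\hat R_n+\sigma_{\mathcal{B}}\sqrt{\frac{2x}{n}}+\left(\frac7\theta+19+18\theta+6\theta^2\right)\frac{xM}{n}.$$ (ii) With probability at least $1-2e^{-x}$, for all $\theta\in(0,1]$, $$\|\overline{X}_n-\mu\|\ge(1-\theta)^2\frac{\hat R_n}{2b}-\sigma_{\mathcal{B}}\sqrt{\frac{2x}{n}}-\left(\frac{3\kappa}{2b}+1\right)\frac{xM}{\theta n}-\left(2-2\frac{\kappa}{b}+\theta^2\frac{\kappa}{2b}\right)\frac{xM}{n}.$$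 (iii) If $X_1$ is symmetric around its mean (i.e. $X_1-\mu$ and $\mu-X_1$ have the same law), then the leading constants $2/\kappa$ in (i) and $1/(2b)$ in (ii), i.e. the constants multiplying $(1+\theta)^2\hat R_n$ and $(1-\theta)^2\hat R_n$ respectively, can be replaced by $1/\kappa$ and $1/b$, the other terms being as in (i) and (ii).
   Context: $\mathcal{B}^*$ is the set of linear functionals $l:E\to\mathbb{R}$ with $|l(x)|\le\|x\|$ for all $x\in E$. Exchangeable: the law of $\xi$ is invariant under permutations of its coordinates. If $b=+\infty$, one uses $1/b=0$. Standing measurability assumption: the class of functions on $E$ given by $\mathcal{B}^*$ is separable for the topology of pointwise convergence (so that all suprema are measurable). *)

theory Defs
  imports
    "HOL-Probability.Probability"
    "HOL-Combinatorics.Permutations"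
begin

definition dual_ball :: "('a::real_normed_vector \<Rightarrow> real) set" where
  "dual_ball = {l. linear l \<and> (\<forall>x. \<bar>l x\<bar> \<le> norm x)}"

text \<open>Separability of the dual ball as a class of functions, for the topology of pointwise
  convergence. The Banach space itself need not be separable.\<close>

definition dual_ball_separable :: "'a::real_normed_vector itself \<Rightarrow> bool" where
  "dual_ball_separable (_ :: 'a itself) \<longleftrightarrow>
     separable_space (subtopology (product_topology (\<lambda>_. euclideanreal) UNIV)
       (dual_ball :: ('a \<Rightarrow> real) set))"

text \<open>The library's Bochner integral is only available in second countable Banach spaces, so
  the expectation of a vector is defined through the continuous linear functionals. It agrees
  with the Bochner expectation whenever the latter exists.\<close>

definition has_expectation ::
  "'w measure \<Rightarrow> ('w \<Rightarrow> 'a::real_normed_vector) \<Rightarrow> 'a \<Rightarrow> bool" where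
  "has_expectation P Y \<mu> \<longleftrightarrow>
     (\<forall>l :: 'a \<Rightarrow> real. bounded_linear l \<longrightarrow>
        integrable P (\<lambda>\<omega>. l (Y \<omega>)) \<and> (\<integral>\<omega>. l (Y \<omega>) \<partial>P) = l \<mu>)"

definition exchangeable :: "'w measure \<Rightarrow> nat \<Rightarrow> (nat \<Rightarrow> 'w \<Rightarrow> real) \<Rightarrow> bool" where
  "exchangeable P n \<xi> \<longleftrightarrow>
     (\<forall>\<pi>. \<pi> permutes {1..n} \<longrightarrow>
        distr P (Pi\<^sub>M {1..n} (\<lambda>_. borel)) (\<lambda>\<omega>. \<lambda>i\<in>{1..n}. \<xi> (\<pi> i) \<omega>) =
        distr P (Pi\<^sub>M {1..n} (\<lambda>_. borel)) (\<lambda>\<omega>. \<lambda>i\<in>{1..n}. \<xi> i \<omega>))"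

definition sample_mean :: "nat \<Rightarrow> (nat \<Rightarrow> 'w \<Rightarrow> 'a::real_normed_vector) \<Rightarrow> 'w \<Rightarrow> 'a" where
  "sample_mean n X \<omega> = (1 / real n) *\<^sub>R (\<Sum>i=1..n. X i \<omega>)"

text \<open>The sub-\<open>\<sigma>\<close>-algebra generated by \<open>X 1, \<dots>, X n\<close>. Independence of
  the two tuples \<open>\<xi>\<close> and \<open>X\<close> is stated through these \<open>\<sigma>\<close>-algebras because
  the library's \<^const>\<open>prob_space.indep_var\<close> forces both variables to have the same value type.\<close>

definition sample_algebra ::
  "'w measure \<Rightarrow> nat \<Rightarrow> (nat \<Rightarrow> 'w \<Rightarrow> 'a::topological_space) \<Rightarrow> 'w measure" where
  "sample_algebra P n X =
     vimage_algebra (space P) (\<lambda>\<omega>. \<lambda>i\<in>{1..n}. X i \<omega>) (Pi\<^sub>M {1..n} (\<lambda>_. borel))"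

definition weighted_complexity ::
  "'w measure \<Rightarrow> nat \<Rightarrow> (nat \<Rightarrow> 'w \<Rightarrow> real) \<Rightarrow> (nat \<Rightarrow> 'w \<Rightarrow> 'a::real_normed_vector) \<Rightarrow> 'w \<Rightarrow> real"
where
  "weighted_complexity P n \<xi> X =
     real_cond_exp P (sample_algebra P n X)
       (\<lambda>\<omega>. 1 / real n * norm (\<Sum>i=1..n. \<xi> i \<omega> *\<^sub>R X i \<omega>))"

definition weak_sd :: "'w measure \<Rightarrow> ('w \<Rightarrow> 'a::real_normed_vector) \<Rightarrow> real" where
  "weak_sd P Y = (SUP l\<in>dual_ball. sqrt (prob_space.variance P (\<lambda>\<omega>. l (Y \<omega>))))"

end

theory Submission
  imports Defs
begin

text \<open>Write \<open>Z\<close> for the norm of the sum of the centred sample and \<open>H\<close> for the conditional mean of the norm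
  of the \<open>\<xi>\<close>-weighted sum, both after rescaling by \<open>M\<close>. Entropy tensorisation bounds the entropy of
  \<open>exp (t Z)\<close> and \<open>exp (t H)\<close> by leave-one-out increments, and Herbst's argument turns this into tail bounds.

  For \<open>Z\<close> the increment dominates \<open>l (h z)\<close>, where \<open>l\<close> norms the sum of the other terms; this gives the
  variance factor \<open>n \<sigma>\<^sup>2 + 2 E Z\<close> in both tails. For \<open>H\<close>, averaging over the swaps of \<open>\<xi> i\<close> with the other
  weights and using that the weights sum to \<open>0\<close> produces leave-one-out versions \<open>fT i \<le> H\<close> whose deficits sum
  to at most \<open>2 H\<close>, so \<open>H\<close> is self-bounding. This suffices for the lower tail. The constants of (iii) need half
  of the resulting upper tail factor, which comes from centring at the larger of \<open>fT i\<close> and the value of \<open>H\<close>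
  with the \<open>i\<close>-th vector removed: the latter has increments of size \<open>\<kappa>\<close> and nonnegative tilted mean.

  Conditionally on \<open>\<xi>\<close>, Jensen's inequality compares the means of \<open>Z\<close> and \<open>H\<close> up to the factors \<open>\<kappa> / 2\<close> and \<open>2 b\<close>,
  or \<open>\<kappa>\<close> and \<open>b\<close> for a symmetric law. As \<open>E\<close> need not be second countable, measurability rests on a
  countable norming subset of the dual ball.\<close>

subsection \<open>Norming functionals\<close>

text \<open>Both exceptional events are free of \<theta>. The parameter enters afterwards, through 2
  sqrt(a b) \<le> \<theta> a + b / \<theta>, so one exceptional set serves all \<theta> at once. The
  scale at which \<open>H\<close> fluctuates fixes the constants. The crude increment bound for
  \<open>f - fT i\<close> is 3 \<kappa>; divided by the factor \<kappa> / 2 that compares the means,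
  it becomes the 6 behind 6 (1 + \<theta>)^3 / \<theta> in (i), and a symmetric law leaves room to
  spare. The lower bound has no such room: its remainder stays at 3 \<kappa> / (2 b) when the
  leading constant improves from 1 / (2 b) to 1 / b. A deviation scale of 3 \<kappa> would therefore
  serve (ii) but not (iii), and the upper tail of \<open>H\<close> is brought down to the scale 3
  \<kappa> / 2. A functional norming the sum of the other terms does not see the vector being
  resampled, hence is centred under resampling. Variance factors, Jensen's inequality for norms and
  the contraction principle all come from this, without integrating a vector.\<close>

definition sublinear :: "('a::real_vector \<Rightarrow> real) \<Rightarrow> bool" where
  "sublinear q \<longleftrightarrow> (\<forall>x y. q (x + y) \<le> q x + q y) \<and> (\<forall>c x. 0 < c \<longrightarrow> q (c *\<^sub>R x) = c * q x)"

lemma sublinear_zero: "sublinear q \<Longrightarrow> q 0 = 0"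
proof -
  assume q: "sublinear q"
  have "q (2 *\<^sub>R 0) = 2 * q 0" using q unfolding sublinear_def by (metis zero_less_numeral)
  then show ?thesis by simp
qed

lemma sublinear_neg: "sublinear q \<Longrightarrow> - q (- x) \<le> q x"
proof -
  assume q: "sublinear q"
  have "q (x + - x) \<le> q x + q (- x)" using q unfolding sublinear_def by blast
  then show ?thesis using sublinear_zero[OF q] by simp
qed

text \<open>Infimal convolution along the ray of \<open>y\<close>: the choice t = 0 gives
  \<open>r x \<le> q x\<close>, the choice t = 1 gives \<open>r x \<le> q (x + y) - q y\<close>. At
  a minimal sublinear functional the second bound is superadditivity; for the norm it pins down the
  value in direction \<open>y\<close>.\<close>

lemma sublinear_descent:
  fixes q :: "'a::real_vector \<Rightarrow> real"
  assumes q: "sublinear q"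
  obtains r where "sublinear r" "\<And>x. r x \<le> q x" "\<And>x. r x \<le> q (x + y) - q y"
proof -
  define A where "A x = (\<lambda>t. q (x + t *\<^sub>R y) - t * q y) ` {0..}" for x
  define r where "r x = Inf (A x)" for x
  have hom: "q (c *\<^sub>R x) = c * q x" if "0 \<le> c" for c x
    using q sublinear_zero[OF q] that unfolding sublinear_def by (cases "c = 0") auto
  have sub: "q (a + b) \<le> q a + q b" for a b using q unfolding sublinear_def by blast
  \<comment> \<open>The infimum is finite: t q(y) = q(t y) is at most q(x + t y) + q(-x).\<close>
  have lb: "- q (- x) \<le> q (x + t *\<^sub>R y) - t * q y" if "0 \<le> t" for x t
    using sub[of "x + t *\<^sub>R y" "- x"] hom[OF that, of y] by simp
  have bdd: "bdd_below (A x)" for x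
    unfolding A_def by (rule bdd_belowI[of _ "- q (- x)"]) (auto intro: lb)
  have ne: "A x \<noteq> {}" for x unfolding A_def by auto
  have low: "r x \<le> q (x + t *\<^sub>R y) - t * q y" if "0 \<le> t" for x t
    unfolding r_def by (rule cInf_lower[OF _ bdd]) (unfold A_def, rule image_eqI, rule refl, use that in simp)
  have approx: "\<exists>t\<ge>0. q (x + t *\<^sub>R y) - t * q y < r x + e" if "0 < e" for x e
    using cInf_lessD[OF ne, of x "r x + e"] that unfolding r_def A_def by auto
  have "sublinear r" unfolding sublinear_def
  proof (intro conjI allI impI)
    fix a b
    show "r (a + b) \<le> r a + r b"
    proof (rule field_le_epsilon)
      fix e :: real assume "0 < e"
      then obtain s t where s: "0 \<le> s" "q (a + s *\<^sub>R y) - s * q y < r a + e/2"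
        and t: "0 \<le> t" "q (b + t *\<^sub>R y) - t * q y < r b + e/2"
        using approx[of "e/2"] by (meson half_gt_zero)
      have "r (a + b) \<le> q ((a + b) + (s + t) *\<^sub>R y) - (s + t) * q y"
        using s t by (intro low) auto
      also have "(a + b) + (s + t) *\<^sub>R y = (a + s *\<^sub>R y) + (b + t *\<^sub>R y)"
        by (simp add: algebra_simps)
      also have "q \<dots> \<le> q (a + s *\<^sub>R y) + q (b + t *\<^sub>R y)" by (rule sub)
      finally show "r (a + b) \<le> r a + r b + e" using s t by (simp add: algebra_simps)
    qed
  next
    have le: "r (c *\<^sub>R x) \<le> c * r x" if c: "0 < c" for c :: real and x
    proof (rule field_le_epsilon)
      fix e :: real assume "0 < e"
      then obtain t where t: "0 \<le> t" "q (x + t *\<^sub>R y) - t * q y < r x + e/c"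
        using approx[of "e/c" x] c by auto
      have "r (c *\<^sub>R x) \<le> q (c *\<^sub>R x + (c * t) *\<^sub>R y) - (c * t) * q y"
        using t c by (intro low) auto
      also have "c *\<^sub>R x + (c * t) *\<^sub>R y = c *\<^sub>R (x + t *\<^sub>R y)" by (simp add: algebra_simps)
      also have "q \<dots> - (c * t) * q y = c * (q (x + t *\<^sub>R y) - t * q y)"
        using hom[of c "x + t *\<^sub>R y"] c by (simp add: algebra_simps)
      also have "\<dots> \<le> c * (r x + e/c)" using t c by simp
      also have "\<dots> = c * r x + e" using c by (simp add: algebra_simps)
      finally show "r (c *\<^sub>R x) \<le> c * r x + e" .
    qed
    fix c :: real and x assume c: "0 < c"
    \<comment> \<open>Applied to the inverse factor, the inequality just proved yields its
      converse.\<close>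
    have "r (inverse c *\<^sub>R (c *\<^sub>R x)) \<le> inverse c * r (c *\<^sub>R x)" by (rule le) (use c in auto)
    then have "c * r x \<le> r (c *\<^sub>R x)" using c by (simp add: field_simps)
    with le[OF c, of x] show "r (c *\<^sub>R x) = c * r x" by simp
  qed
  moreover have "r x \<le> q x" for x using low[of 0 x] by simp
  moreover have "r x \<le> q (x + y) - q y" for x using low[of 1 x] by simp
  ultimately show thesis using that by blast
qed

text \<open>Zorn's lemma gives a minimal sublinear functional below \<open>p\<close>, and minimality forces
  additivity: this replaces the extension argument of Hahn--Banach.\<close>

lemma linear_below_sublinear:
  fixes p :: "'a::real_vector \<Rightarrow> real"
  assumes p: "sublinear p"
  obtains l where "linear l" "\<And>x. l x \<le> p x"
proof -
  define S where "S = {q. sublinear q \<and> q \<le> p}"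
  have "\<exists>l\<in>S. \<forall>q\<in>S. q \<le> l \<longrightarrow> q = l"
  proof -
    \<comment> \<open>The order is reversed: a maximal element for Zorn's lemma is then a minimal
      functional, and chains are bounded by their pointwise infimum.\<close>
    define r where "r = {(a, b). a \<in> S \<and> b \<in> S \<and> b \<le> a}"
    have Fr: "Field r = S" unfolding r_def Field_def by auto
    have po: "Partial_order r"
      unfolding partial_order_on_def preorder_on_def refl_on_def trans_def antisym_def Fr
      unfolding r_def by auto
    have "\<exists>m\<in>Field r. \<forall>a\<in>Field r. (m, a) \<in> r \<longrightarrow> a = m"
    proof (rule Zorns_po_lemma[OF po], goal_cases)
      case (1 C)
      show ?case
      proof (cases "C = {}")
        case True then show ?thesis using p by (auto simp: Fr S_def intro!: exI[of _ p])
      next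
        case False
        have CS: "c \<in> S" if "c \<in> C" for c
          using 1 that unfolding Chains_def r_def by auto
        have ch: "c \<le> d \<or> d \<le> c" if "c \<in> C" "d \<in> C" for c d
          using 1 that unfolding Chains_def r_def by auto
        define u where "u x = (INF c\<in>C. c x)" for x
        \<comment> \<open>Being below \<open>p\<close> bounds a sublinear functional from below as
          well, by -p(-x), so the infimum over the chain is finite.\<close>
        have bdd: "bdd_below ((\<lambda>c. c x) ` C)" for x
        proof (rule bdd_belowI2[of _ "- p (- x)"])
          fix c assume "c \<in> C"
          then have c: "sublinear c" "c \<le> p" using CS S_def by auto
          have "- p (- x) \<le> - c (- x)" using c(2) by (simp add: le_fun_def)
          also have "\<dots> \<le> c x" by (rule sublinear_neg[OF c(1)])
          finally show "- p (- x) \<le> c x" .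
        qed
        have low: "u x \<le> c x" if "c \<in> C" for c x
          unfolding u_def by (rule cINF_lower[OF bdd that])
        have approx: "\<exists>c\<in>C. c x < u x + e" if "0 < e" for x and e :: real
          using cINF_less_iff[OF False bdd, of x "u x + e"] that unfolding u_def by auto
        have sl: "sublinear u" unfolding sublinear_def
        proof (intro conjI allI impI)
          fix a b
          show "u (a + b) \<le> u a + u b"
          proof (rule field_le_epsilon)
            fix e :: real assume "0 < e"
            then obtain c d where c: "c \<in> C" "c a < u a + e/2" and d: "d \<in> C" "d b < u b + e/2"
              using approx[of "e/2"] by (meson half_gt_zero)
            \<comment> \<open>One member of the chain has to serve both arguments; the smaller of
              the two near-minimisers does.\<close>
            obtain f where f: "f \<in> C" "f \<le> c" "f \<le> d" using ch[OF c(1) d(1)] c d by auto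
            have "u (a + b) \<le> f (a + b)" by (rule low[OF f(1)])
            also have "\<dots> \<le> f a + f b" using CS[OF f(1)] unfolding S_def sublinear_def by auto
            also have "\<dots> \<le> c a + d b" using f by (auto simp: le_fun_def intro!: add_mono)
            finally show "u (a + b) \<le> u a + u b + e" using c d by simp
          qed
        next
          have le: "u (c *\<^sub>R x) \<le> c * u x" if c: "0 < c" for c :: real and x
          proof (rule field_le_epsilon)
            fix e :: real assume "0 < e"
            then obtain f where f: "f \<in> C" "f x < u x + e/c" using approx[of "e/c" x] c by auto
            have "u (c *\<^sub>R x) \<le> f (c *\<^sub>R x)" by (rule low[OF f(1)])
            also have "\<dots> = c * f x" using CS[OF f(1)] c unfolding S_def sublinear_def by auto
            also have "\<dots> \<le> c * (u x + e/c)" using f c by simp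
            also have "\<dots> = c * u x + e" using c by (simp add: algebra_simps)
            finally show "u (c *\<^sub>R x) \<le> c * u x + e" .
          qed
          fix c :: real and x assume c: "0 < c"
          have "u (inverse c *\<^sub>R (c *\<^sub>R x)) \<le> inverse c * u (c *\<^sub>R x)" by (rule le) (use c in auto)
          then have "c * u x \<le> u (c *\<^sub>R x)" using c by (simp add: field_simps)
          with le[OF c, of x] show "u (c *\<^sub>R x) = c * u x" by simp
        qed
        obtain c where c: "c \<in> C" using False by auto
        have "u x \<le> p x" for x
          using low[OF c, of x] CS[OF c] unfolding S_def le_fun_def by (auto intro: order_trans)
        then have "u \<le> p" by (simp add: le_fun_def)
        then have "u \<in> S" using sl S_def by auto
        then show ?thesis using CS low unfolding Fr
          by (intro bexI[of _ u]) (auto simp: r_def le_fun_def)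
      qed
    qed
    then show ?thesis unfolding Fr by (auto simp: r_def)
  qed
  then obtain l where l: "l \<in> S" and min: "\<forall>q\<in>S. q \<le> l \<longrightarrow> q = l" by blast
  have sl: "sublinear l" and lp: "l \<le> p" using l S_def by auto
  have mini: "q = l" if "sublinear q" "q \<le> l" for q
  proof -
    have "q \<in> S" using that order_trans[OF that(2) lp] unfolding S_def by simp
    then show ?thesis using min that(2) by blast
  qed
  have add: "l (x + y) = l x + l y" for x y
  proof -
    obtain r where r: "sublinear r" "\<And>x. r x \<le> l x" "\<And>x. r x \<le> l (x + y) - l y"
      using sublinear_descent[OF sl, of y] by blast
    have "r = l" using r by (intro mini) (auto simp: le_fun_def)
    then have "l x \<le> l (x + y) - l y" using r(3) by auto
    moreover have "l (x + y) \<le> l x + l y" using sl unfolding sublinear_def by blast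
    ultimately show ?thesis by simp
  qed
  have neg: "l (- x) = - l x" for x using add[of x "- x"] sublinear_zero[OF sl] by simp
  have "l (c *\<^sub>R x) = c * l x" for c x
  proof (cases "0 < c")
    case True then show ?thesis using sl unfolding sublinear_def by blast
  next
    case False
    show ?thesis
    proof (cases "c = 0")
      case True then show ?thesis using sublinear_zero[OF sl] by simp
    next
      case n: False
      have "0 < - c" using False n by simp
      then have "l ((- c) *\<^sub>R x) = (- c) * l x" using sl unfolding sublinear_def by blast
      then show ?thesis using neg[of "c *\<^sub>R x"] by simp
    qed
  qed
  then have "linear l" using add by (intro linearI) auto
  then show thesis using that lp by (auto simp: le_fun_def)
qed

text \<open>The norm is lowered along \<open>v\<close> before a linear minorant is taken: r(-v)
  \<le> norm 0 - norm v, so l(v) = -l(-v) is at least norm v.\<close>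

lemma norming_functional:
  fixes v :: "'a::real_normed_vector"
  obtains l where "l \<in> dual_ball" "l v = norm v"
proof -
  have "sublinear (norm :: 'a \<Rightarrow> real)" unfolding sublinear_def by (auto intro: norm_triangle_ineq)
  then obtain r where r: "sublinear r" "\<And>x. r x \<le> norm x" "\<And>x. r x \<le> norm (x + v) - norm v"
    using sublinear_descent[of norm v] by blast
  obtain l where l: "linear l" "\<And>x. l x \<le> r x" using linear_below_sublinear[OF r(1)] by blast
  have neg: "l (- x) = - l x" for x using linear_neg[OF l(1)] by simp
  have "l x \<le> norm x" for x using l(2) r(2) order_trans by blast
  then have "\<bar>l x\<bar> \<le> norm x" for x
    using neg[of x] \<open>\<And>x. l x \<le> norm x\<close>[of "- x"] by (intro abs_leI) auto
  then have "l \<in> dual_ball" using l(1) unfolding dual_ball_def by auto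
  moreover have "l v = norm v"
  proof (rule antisym)
    show "norm v \<le> l v" using l(2)[of "- v"] r(3)[of "- v"] neg[of v] by simp
  qed (rule \<open>\<And>x. l x \<le> norm x\<close>)
  ultimately show thesis using that by blast
qed

lemma dual_ball_linear: "l \<in> dual_ball \<Longrightarrow> linear l"
  and dual_ball_abs: "l \<in> dual_ball \<Longrightarrow> \<bar>l x\<bar> \<le> norm x"
  and dual_ball_le: "l \<in> dual_ball \<Longrightarrow> l x \<le> norm x"
  unfolding dual_ball_def by (simp_all add: abs_le_iff)

lemma dual_ball_bounded_linear: "l \<in> dual_ball \<Longrightarrow> bounded_linear l"
proof -
  assume l: "l \<in> dual_ball"
  show "bounded_linear l"
    using dual_ball_abs[OF l]
    by (intro bounded_linear.intro dual_ball_linear[OF l] bounded_linear_axioms.intro exI[of _ 1]) auto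
qed

text \<open>Evaluation at \<open>v\<close> is continuous for pointwise convergence, so a countable
  dense part of the dual ball comes arbitrarily close to a norming functional of \<open>v\<close>.
  Norms thereby become countable suprema of scalar functions.\<close>

lemma countable_norming_set:
  assumes "dual_ball_separable TYPE('a::real_normed_vector)"
  obtains D :: "('a::real_normed_vector \<Rightarrow> real) set"
  where "countable D" "D \<subseteq> dual_ball" "D \<noteq> {}" "\<And>v. (SUP l\<in>D. l v) = norm v"
proof -
  let ?T = "subtopology (product_topology (\<lambda>_. euclideanreal) UNIV) (dual_ball :: ('a \<Rightarrow> real) set)"
  have ts: "topspace ?T = dual_ball" by simp
  obtain D where D: "countable D" "D \<subseteq> dual_ball" "?T closure_of D = dual_ball"
    using assms unfolding dual_ball_separable_def separable_space_def ts by blast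
  have ex: "\<exists>d\<in>D. norm v - e < d v" if e: "0 < e" for v :: 'a and e :: real
  proof -
    obtain l where l: "l \<in> dual_ball" "l v = norm v" by (rule norming_functional)
    let ?U = "{k \<in> topspace ?T. k v \<in> {norm v - e<..}}"
    have "continuous_map ?T euclideanreal (\<lambda>k. k v)"
      by (intro continuous_map_from_subtopology continuous_map_product_projection) simp
    then have "openin ?T ?U" by (rule openin_continuous_map_preimage) simp
    moreover have "l \<in> ?U" using l e ts by simp
    moreover have "l \<in> ?T closure_of D" using D l by simp
    moreover have "\<exists>y. y \<in> D \<and> y \<in> U" if "openin ?T U" "l \<in> U" "l \<in> ?T closure_of D" for U
      using that by (simp add: in_closure_of)
    ultimately have "\<exists>y. y \<in> D \<and> y \<in> ?U" by blast
    then show ?thesis by auto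
  qed
  have ne: "D \<noteq> {}" using ex[of 1] by auto
  have "(SUP l\<in>D. l v) = norm v" for v
  proof (rule cSup_eq_non_empty)
    show "norm v \<le> y" if "\<And>x. x \<in> (\<lambda>l. l v) ` D \<Longrightarrow> x \<le> y" for y
    proof (rule field_le_epsilon)
      fix e :: real assume "0 < e"
      then obtain d where "d \<in> D" "norm v - e < d v" using ex by blast
      moreover have "d v \<le> y" using \<open>d \<in> D\<close> by (intro that imageI)
      ultimately show "norm v \<le> y + e" by simp
    qed
    show "x \<le> norm v" if "x \<in> (\<lambda>l. l v) ` D" for x
      using that dual_ball_le D(2) by blast
  qed (use ne in simp)
  then show thesis by (intro that[OF D(1,2) ne])
qed

text \<open>Borel measurability of vector-valued maps need not survive addition when the space is
  not second countable. Measurability against the dual ball does, and by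
  \<open>countable_norming_set\<close> it still makes norms measurable.\<close>

definition weakly_measurable :: "'b measure \<Rightarrow> ('b \<Rightarrow> 'a::real_normed_vector) \<Rightarrow> bool" where
  "weakly_measurable K g \<longleftrightarrow> (\<forall>l\<in>dual_ball. (\<lambda>x. l (g x)) \<in> borel_measurable K)"

lemma weakly_measurable_norm:
  assumes sep: "dual_ball_separable TYPE('a::real_normed_vector)"
    and g: "weakly_measurable K (g :: 'b \<Rightarrow> 'a)"
  shows "(\<lambda>x. norm (g x)) \<in> borel_measurable K"
proof -
  obtain D :: "('a \<Rightarrow> real) set" where D: "countable D" "D \<subseteq> dual_ball" "D \<noteq> {}"
      "\<And>v. (SUP l\<in>D. l v) = norm v"
    by (rule countable_norming_set[OF sep]) blast
  have "(\<lambda>x. SUP l\<in>D. l (g x)) \<in> borel_measurable K"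
  proof (rule borel_measurable_cSUP[OF D(1)])
    show "\<And>l. l \<in> D \<Longrightarrow> (\<lambda>x. l (g x)) \<in> borel_measurable K"
      using g D(2) unfolding weakly_measurable_def by auto
    show "bdd_above ((\<lambda>l. l (g x)) ` D)" if "x \<in> space K" for x
      by (rule bdd_aboveI2[of _ _ "norm (g x)"]) (use D(2) dual_ball_le in blast)
  qed
  then show ?thesis by (simp add: D(4))
qed

lemma weakly_measurable_sum:
  assumes "\<And>i. i \<in> I \<Longrightarrow> weakly_measurable K (g i)"
  shows "weakly_measurable K (\<lambda>x. \<Sum>i\<in>I. g i x)"
  using assms unfolding weakly_measurable_def by (auto simp: linear_sum dual_ball_linear intro!: borel_measurable_sum)

lemma weakly_measurable_scaleR:
  assumes "a \<in> borel_measurable K" "weakly_measurable K g"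
  shows "weakly_measurable K (\<lambda>x. a x *\<^sub>R g x)"
  using assms unfolding weakly_measurable_def by (auto simp: linear_cmul dual_ball_linear)

lemma weakly_measurable_add:
  assumes "weakly_measurable K g" "weakly_measurable K g'"
  shows "weakly_measurable K (\<lambda>x. g x + g' x)"
  using assms unfolding weakly_measurable_def by (auto simp: linear_add dual_ball_linear intro!: borel_measurable_add)

lemma weakly_measurable_const: "weakly_measurable K (\<lambda>x. v)"
  unfolding weakly_measurable_def by auto

lemma weakly_measurable_compose:
  assumes "weakly_measurable K g" "f \<in> measurable K' K"
  shows "weakly_measurable K' (\<lambda>x. g (f x))"
  using assms unfolding weakly_measurable_def by (auto intro: measurable_compose)

subsection \<open>Tensorisation of entropy\<close>

lemma (in prob_space) bounded_integrable:
  fixes f :: "'a \<Rightarrow> real"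
  assumes "f \<in> borel_measurable M" "\<And>x. x \<in> space M \<Longrightarrow> \<bar>f x\<bar> \<le> B"
  shows "integrable M f"
  by (rule integrable_const_bound[where B=B]) (use assms in \<open>auto intro!: AE_I2\<close>)

text \<open>a ln(a/b) - a + b is the Bregman divergence of u ln u. The entropy of a function is its
  least mean divergence from a constant, which is how entropies are bounded below.\<close>

lemma relative_entropy_nonneg:
  fixes a b :: real
  assumes "0 < a" "0 < b"
  shows "0 \<le> a * ln (a / b) - a + b"
proof -
  have "ln (b / a) \<le> b / a - 1" using assms by (intro ln_le_minus_one) simp
  then have "a * ln (b / a) \<le> b - a" using assms by (simp add: field_simps)
  moreover have "ln (b / a) = - ln (a / b)" using assms by (simp add: ln_div)
  ultimately show ?thesis by simp
qed

text \<open>The bound \<open>ln t \<ge> 1 - 1/t\<close> at \<open>t = (a/c) / (a'/c')\<close> linearises the jointly convex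
  function \<open>a ln (a/c)\<close> around \<open>(a', c')\<close>.\<close>

lemma relative_entropy_tangent:
  fixes a c a' c' :: real
  assumes "0 < a" "0 < c" "0 < a'" "0 < c'"
  shows "a * ln (a' / c') + a - c * (a' / c') \<le> a * ln (a / c)"
proof -
  define r where "r = a' / c'"
  have r: "0 < r" unfolding r_def using assms by simp
  have "0 \<le> a * ln (a / (c * r)) - a + c * r"
    by (rule relative_entropy_nonneg) (use assms r in auto)
  also have "ln (a / (c * r)) = ln (a / c) - ln r"
    using assms r by (simp add: ln_div ln_mult)
  finally show ?thesis unfolding r_def[symmetric] by (simp add: algebra_simps)
qed

lemma ln_bounded:
  fixes a x :: real
  assumes "0 < a" "a \<le> x" "x \<le> b"
  shows "\<bar>ln x\<bar> \<le> \<bar>ln a\<bar> + \<bar>ln b\<bar>"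
proof -
  have "ln a \<le> ln x" "ln x \<le> ln b" using assms by auto
  then show ?thesis by linarith
qed

lemma (in prob_space) integral_bounds:
  fixes f :: "'a \<Rightarrow> real"
  assumes "f \<in> borel_measurable M" "\<And>x. x \<in> space M \<Longrightarrow> a \<le> f x" "\<And>x. x \<in> space M \<Longrightarrow> f x \<le> b"
  shows "a \<le> (\<integral>x. f x \<partial>M)" "(\<integral>x. f x \<partial>M) \<le> b"
proof -
  have i: "integrable M f"
    by (rule bounded_integrable[where B="\<bar>a\<bar> + \<bar>b\<bar>"]) (use assms in \<open>force+\<close>)
  show "a \<le> (\<integral>x. f x \<partial>M)" by (rule integral_ge_const[OF i]) (use assms in auto)
  show "(\<integral>x. f x \<partial>M) \<le> b" by (rule integral_le_const[OF i]) (use assms in auto)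
qed

lemma relative_entropy_bounded:
  fixes a b u v :: real
  assumes "0 < a" "a \<le> u" "u \<le> b" "a \<le> v" "v \<le> b"
  shows "\<bar>u * ln (u / v) - u + v\<bar> \<le> b * (2 * \<bar>ln a\<bar> + 2 * \<bar>ln b\<bar>) + 2 * b"
proof -
  have "\<bar>ln (u / v)\<bar> \<le> 2 * \<bar>ln a\<bar> + 2 * \<bar>ln b\<bar>"
    using ln_bounded[of a u b] ln_bounded[of a v b] assms by (simp add: ln_div)
  then have "\<bar>u * ln (u / v)\<bar> \<le> b * (2 * \<bar>ln a\<bar> + 2 * \<bar>ln b\<bar>)"
    unfolding abs_mult using assms by (intro mult_mono) auto
  then show ?thesis using assms by linarith
qed

lemma u_ln_u_bounded:
  fixes a b u :: real
  assumes "0 < a" "a \<le> u" "u \<le> b"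
  shows "\<bar>u * ln u\<bar> \<le> b * (\<bar>ln a\<bar> + \<bar>ln b\<bar>)"
  unfolding abs_mult using assms ln_bounded[of a u b] by (intro mult_mono) auto

text \<open>Jensen's inequality for the jointly convex divergence: the tangent inequality at the
  means (A, C) is integrated, and its linear terms integrate to A ln(A/C) exactly.\<close>

lemma (in prob_space) relative_entropy_integral:
  fixes f g :: "'a \<Rightarrow> real"
  assumes meas: "f \<in> borel_measurable M" "g \<in> borel_measurable M"
    and a: "0 < a"
    and f: "\<And>x. x \<in> space M \<Longrightarrow> a \<le> f x \<and> f x \<le> b"
    and g: "\<And>x. x \<in> space M \<Longrightarrow> a \<le> g x \<and> g x \<le> b"
  defines "A \<equiv> \<integral>x. f x \<partial>M" and "C \<equiv> \<integral>x. g x \<partial>M"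
  shows "A * ln (A / C) - A + C \<le> (\<integral>x. f x * ln (f x / g x) - f x + g x \<partial>M)"
proof -
  note [measurable] = meas
  have pos: "0 < A" "0 < C"
    using integral_bounds(1)[of f a b] integral_bounds(1)[of g a b] meas f g a
    unfolding A_def C_def by auto
  have if_: "integrable M f" "integrable M g"
    by (rule bounded_integrable[where B=b], use meas f g a in force, use f g a in force)+
  have i: "integrable M (\<lambda>x. f x * ln (f x / g x) - f x + g x)"
    by (rule bounded_integrable[where B="b * (2 * \<bar>ln a\<bar> + 2 * \<bar>ln b\<bar>) + 2 * b"])
       (use f g a in \<open>auto intro!: relative_entropy_bounded\<close>)
  have "A * ln (A / C) - A + C = (\<integral>x. (f x * ln (A / C) + f x - g x * (A / C)) - f x + g x \<partial>M)"
    using if_ pos by (simp add: A_def[symmetric] C_def[symmetric])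
  also have "\<dots> \<le> (\<integral>x. f x * ln (f x / g x) - f x + g x \<partial>M)"
  proof (rule integral_mono[OF _ i])
    show "integrable M (\<lambda>x. (f x * ln (A / C) + f x - g x * (A / C)) - f x + g x)"
      using if_ by auto
    fix x assume x: "x \<in> space M"
    have "f x * ln (A / C) + f x - g x * (A / C) \<le> f x * ln (f x / g x)"
      by (rule relative_entropy_tangent) (use f[OF x] g[OF x] a pos in auto)
    then show "f x * ln (A / C) + f x - g x * (A / C) - f x + g x
        \<le> f x * ln (f x / g x) - f x + g x" by simp
  qed
  finally show ?thesis .
qed

text \<open>Induction on the coordinates. Integrating out coordinate j splits the entropy into the
  mean conditional entropy in j and the entropy of the averaged function. The former is at most the
  divergence from \<open>c j\<close>, which is constant in that coordinate; the latter is left to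
  the induction hypothesis. The uniform bounds a and b keep every logarithm bounded and every
  integral finite.\<close>

lemma entropy_tensorization:
  fixes N :: "'b measure" and F :: "('i \<Rightarrow> 'b) \<Rightarrow> real" and c :: "'i \<Rightarrow> ('i \<Rightarrow> 'b) \<Rightarrow> real"
  assumes N: "prob_space N" and I: "finite I"
    and F: "F \<in> borel_measurable (Pi\<^sub>M I (\<lambda>_. N))"
    and c: "\<And>i. i \<in> I \<Longrightarrow> c i \<in> borel_measurable (Pi\<^sub>M I (\<lambda>_. N))"
    and a: "0 < a"
    and Fb: "\<And>y. y \<in> space (Pi\<^sub>M I (\<lambda>_. N)) \<Longrightarrow> a \<le> F y \<and> F y \<le> b"
    and cb: "\<And>i y. i \<in> I \<Longrightarrow> y \<in> space (Pi\<^sub>M I (\<lambda>_. N)) \<Longrightarrow> a \<le> c i y \<and> c i y \<le> b"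
    and indep: "\<And>i y z. i \<in> I \<Longrightarrow> y \<in> space (Pi\<^sub>M I (\<lambda>_. N)) \<Longrightarrow> z \<in> space N \<Longrightarrow> c i (y(i := z)) = c i y"
  shows "(\<integral>y. F y * ln (F y) \<partial>Pi\<^sub>M I (\<lambda>_. N)) - (\<integral>y. F y \<partial>Pi\<^sub>M I (\<lambda>_. N)) * ln (\<integral>y. F y \<partial>Pi\<^sub>M I (\<lambda>_. N))
    \<le> (\<Sum>i\<in>I. \<integral>y. F y * ln (F y / c i y) - F y + c i y \<partial>Pi\<^sub>M I (\<lambda>_. N))"
  using I F c Fb cb indep
proof (induction I arbitrary: F c rule: finite_induct)
  case empty
  interpret E: prob_space "Pi\<^sub>M {} (\<lambda>_::'i. N)" using N by (intro prob_space_PiM) simp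
  \<comment> \<open>A product over no coordinates is a point mass, so both sides vanish.\<close>
  have "(\<integral>y. G y \<partial>Pi\<^sub>M {} (\<lambda>_. N)) = G (\<lambda>_. undefined)" for G :: "('i \<Rightarrow> 'b) \<Rightarrow> real"
    by (simp add: PiM_empty lebesgue_integral_count_space_finite)
  then show ?case by simp
next
  case (insert j J F c)
  interpret N: prob_space N by fact
  interpret P: product_sigma_finite "\<lambda>_::'i. N" by standard
  define QJ where "QJ = Pi\<^sub>M J (\<lambda>_. N)"
  define Q where "Q = Pi\<^sub>M (insert j J) (\<lambda>_. N)"
  interpret QJ: prob_space QJ unfolding QJ_def using N by (intro prob_space_PiM) simp
  interpret Q: prob_space Q unfolding Q_def using N by (intro prob_space_PiM) simp
  note F = insert.prems(1)[folded Q_def] and c = insert.prems(2)[folded Q_def]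
    and Fb = insert.prems(3)[folded Q_def] and cb = insert.prems(4)[folded Q_def]
    and indep = insert.prems(5)[folded Q_def]
  have upd: "(\<lambda>(y, z). y(j := z)) \<in> measurable (QJ \<Otimes>\<^sub>M N) Q"
    unfolding QJ_def Q_def by (rule measurable_add_dim)
  have upd_sp: "y(j := z) \<in> space Q" if "y \<in> space QJ" "z \<in> space N" for y z
    using measurable_space[OF upd, of "(y, z)"] that by (simp add: space_pair_measure)
  have upd2: "(\<lambda>z. y(j := z)) \<in> measurable N Q" if "y \<in> space QJ" for y
    using measurable_compose[OF measurable_Pair1'[OF that] upd] by simp
  have ins: "(\<integral>y. G y \<partial>Q) = (\<integral>y. (\<integral>z. G (y(j := z)) \<partial>N) \<partial>QJ)" if "integrable Q G" for G :: "_ \<Rightarrow> real"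
    using P.product_integral_insert[OF insert.hyps that[unfolded Q_def]] unfolding Q_def QJ_def .
  have avg: "(\<lambda>y. \<integral>z. G (y(j := z)) \<partial>N) \<in> borel_measurable QJ"
    if "G \<in> borel_measurable Q" for G :: "_ \<Rightarrow> real"
    using measurable_compose[OF upd that]
    by (intro N.borel_measurable_lebesgue_integral) (simp add: case_prod_unfold)
  define F' where "F' y = (\<integral>z. F (y(j := z)) \<partial>N)" for y
  define c' where "c' i y = (\<integral>z. c i (y(j := z)) \<partial>N)" for i y
  define K where "K = b * (2 * \<bar>ln a\<bar> + 2 * \<bar>ln b\<bar>) + 2 * b"
  have [measurable]: "F \<in> borel_measurable Q" "\<And>i. i \<in> insert j J \<Longrightarrow> c i \<in> borel_measurable Q"
    using F c by auto
  have sl: "(\<lambda>z. G (y(j := z))) \<in> borel_measurable N" if "G \<in> borel_measurable Q" "y \<in> space QJ"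
    for G :: "_ \<Rightarrow> real" and y
    by (rule measurable_compose[OF upd2[OF that(2)] that(1)])
  have F': "F' \<in> borel_measurable QJ" unfolding F'_def by (rule avg) fact
  have c': "c' i \<in> borel_measurable QJ" if "i \<in> J" for i
    unfolding c'_def by (rule avg) (use c that in auto)
  have F'b: "a \<le> F' y \<and> F' y \<le> b" if "y \<in> space QJ" for y
    unfolding F'_def using N.integral_bounds[of "\<lambda>z. F (y(j := z))" a b] sl[OF F that] Fb upd_sp[OF that]
    by auto
  have c'b: "a \<le> c' i y \<and> c' i y \<le> b" if "y \<in> space QJ" "i \<in> J" for y i
    unfolding c'_def using N.integral_bounds[of "\<lambda>z. c i (y(j := z))" a b] sl[OF c that(1)]
      cb[of i] upd_sp[OF that(1)] that by auto
  define R where "R i y = F y * ln (F y / c i y) - F y + c i y" for i y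
  have R_meas: "R i \<in> borel_measurable Q" if "i \<in> insert j J" for i
    using c[OF that] unfolding R_def by measurable
  have R_int: "integrable Q (R i)" if "i \<in> insert j J" for i
    by (rule Q.bounded_integrable[OF R_meas[OF that], where B=K])
       (use Fb cb[OF that] a in \<open>auto simp: R_def K_def intro!: relative_entropy_bounded\<close>)
  have R_sum: "(\<integral>y. R i y \<partial>Q) = (\<integral>y. (\<integral>z. R i (y(j := z)) \<partial>N) \<partial>QJ)" if "i \<in> insert j J" for i
    by (rule ins[OF R_int[OF that]])
  have R_sl_int: "integrable QJ (\<lambda>y. \<integral>z. R i (y(j := z)) \<partial>N)" if i: "i \<in> insert j J" for i
  proof (rule QJ.bounded_integrable[OF avg[OF R_meas[OF i]], where B=K])
    fix y assume y: "y \<in> space QJ"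
    have "\<bar>R i (y(j := z))\<bar> \<le> K" if "z \<in> space N" for z
      unfolding R_def K_def using Fb[OF upd_sp[OF y that]] cb[OF i upd_sp[OF y that]] a
      by (intro relative_entropy_bounded) blast+
    then have "- K \<le> R i (y(j := z)) \<and> R i (y(j := z)) \<le> K" if "z \<in> space N" for z
      using that by (simp add: abs_le_iff minus_le_iff)
    then show "\<bar>\<integral>z. R i (y(j := z)) \<partial>N\<bar> \<le> K"
      using N.integral_bounds[of "\<lambda>z. R i (y(j := z))" "-K" K] sl[OF R_meas[OF i] y]
      by (auto intro!: abs_leI)
  qed
  have FlnF: "integrable Q (\<lambda>y. F y * ln (F y))"
    by (rule Q.bounded_integrable[where B="b * (\<bar>ln a\<bar> + \<bar>ln b\<bar>)"])
       (use Fb a in \<open>auto intro!: u_ln_u_bounded\<close>)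
  have F'lnF': "integrable QJ (\<lambda>y. F' y * ln (F' y))"
    by (rule QJ.bounded_integrable[where B="b * (\<bar>ln a\<bar> + \<bar>ln b\<bar>)"])
       (use F' F'b a in \<open>auto intro!: u_ln_u_bounded borel_measurable_times\<close>)
  have IF: "(\<integral>y. F y \<partial>Q) = (\<integral>y. F' y \<partial>QJ)"
    unfolding F'_def by (rule ins, rule Q.bounded_integrable[where B=b]) (use F Fb a in force)+
  \<comment> \<open>For fixed y the comparison function is a constant k, and the gap in this
    inequality is exactly the divergence of \<open>F' y\<close> from k.\<close>
  have step: "(\<integral>z. F (y(j := z)) * ln (F (y(j := z))) \<partial>N) \<le> F' y * ln (F' y) + (\<integral>z. R j (y(j := z)) \<partial>N)"
    if y: "y \<in> space QJ" for y
  proof -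
    obtain z0 where z0: "z0 \<in> space N" using N.not_empty by blast
    define k where "k = c j (y(j := z0))"
    have k: "a \<le> k" "k \<le> b" unfolding k_def using cb[of j] upd_sp[OF y z0] by auto
    have ck: "c j (y(j := z)) = k" if "z \<in> space N" for z
      unfolding k_def using indep[OF insertI1 upd_sp[OF y z0] that] by (simp only: fun_upd_upd)
    have [measurable]: "(\<lambda>z. F (y(j := z))) \<in> borel_measurable N" by (rule sl[OF F y])
    have Fz: "a \<le> F (y(j := z))" "F (y(j := z)) \<le> b" "0 < F (y(j := z))" if "z \<in> space N" for z
      using Fb[OF upd_sp[OF y that]] less_le_trans[OF a] by blast+
    have i1: "integrable N (\<lambda>z. F (y(j := z)) * ln (F (y(j := z))))"
      by (rule N.bounded_integrable, measurable) (rule u_ln_u_bounded[OF a Fz(1,2)])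
    have i2: "integrable N (\<lambda>z. F (y(j := z)))"
      by (rule N.bounded_integrable[where B=b], measurable)
         (subst abs_of_pos[OF Fz(3)], assumption, rule Fz(2))
    have "(\<integral>z. R j (y(j := z)) \<partial>N)
        = (\<integral>z. F (y(j := z)) * ln (F (y(j := z))) - F (y(j := z)) * ln k - F (y(j := z)) + k \<partial>N)"
    proof (rule Bochner_Integration.integral_cong[OF refl])
      fix z assume z: "z \<in> space N"
      have "0 < F (y(j := z))" by (rule Fz(3)[OF z])
      then show "R j (y(j := z))
          = F (y(j := z)) * ln (F (y(j := z))) - F (y(j := z)) * ln k - F (y(j := z)) + k"
        unfolding R_def ck[OF z] using k a by (simp add: ln_div algebra_simps)
    qed
    also have "\<dots> = (\<integral>z. F (y(j := z)) * ln (F (y(j := z))) \<partial>N) - F' y * ln k - F' y + k"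
      using i1 i2 unfolding F'_def by (simp add: N.prob_space)
    finally have e: "(\<integral>z. R j (y(j := z)) \<partial>N)
        = (\<integral>z. F (y(j := z)) * ln (F (y(j := z))) \<partial>N) - F' y * ln k - F' y + k" .
    have "0 \<le> F' y * ln (F' y / k) - F' y + k"
      using F'b[OF y] k a by (intro relative_entropy_nonneg) auto
    also have "\<dots> = F' y * ln (F' y) - F' y * ln k - F' y + k"
      using F'b[OF y] k a by (simp add: ln_div algebra_simps)
    finally show ?thesis using e by linarith
  qed
  have "(\<integral>y. F y * ln (F y) \<partial>Q) = (\<integral>y. (\<integral>z. F (y(j := z)) * ln (F (y(j := z))) \<partial>N) \<partial>QJ)"
    by (rule ins[OF FlnF])
  also have "\<dots> \<le> (\<integral>y. F' y * ln (F' y) + (\<integral>z. R j (y(j := z)) \<partial>N) \<partial>QJ)"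
  proof (rule integral_mono_AE)
    show "integrable QJ (\<lambda>y. F' y * ln (F' y) + (\<integral>z. R j (y(j := z)) \<partial>N))"
      using F'lnF' R_sl_int[of j] by auto
    show "integrable QJ (\<lambda>y. \<integral>z. F (y(j := z)) * ln (F (y(j := z))) \<partial>N)"
    proof (rule QJ.bounded_integrable[where B="b * (\<bar>ln a\<bar> + \<bar>ln b\<bar>)"])
      show "(\<lambda>y. \<integral>z. F (y(j := z)) * ln (F (y(j := z))) \<partial>N) \<in> borel_measurable QJ"
        by (rule avg) measurable
      fix y assume y: "y \<in> space QJ"
      have "\<bar>F (y(j := z)) * ln (F (y(j := z)))\<bar> \<le> b * (\<bar>ln a\<bar> + \<bar>ln b\<bar>)" if "z \<in> space N" for z
        using Fb[OF upd_sp[OF y that]] a by (intro u_ln_u_bounded) blast+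
      then show "\<bar>\<integral>z. F (y(j := z)) * ln (F (y(j := z))) \<partial>N\<bar> \<le> b * (\<bar>ln a\<bar> + \<bar>ln b\<bar>)"
        using N.integral_bounds[of "\<lambda>z. F (y(j := z)) * ln (F (y(j := z)))"
            "- (b * (\<bar>ln a\<bar> + \<bar>ln b\<bar>))" "b * (\<bar>ln a\<bar> + \<bar>ln b\<bar>)"]
          sl[of "\<lambda>y. F y * ln (F y)" y] y
        by (auto intro!: abs_leI simp: abs_le_iff minus_le_iff)
    qed
  qed (use step in auto)
  also have "\<dots> = (\<integral>y. F' y * ln (F' y) \<partial>QJ) + (\<integral>y. R j y \<partial>Q)"
    using F'lnF' R_sl_int[of j] R_sum[of j] by simp
  \<comment> \<open>Induction hypothesis with averaged comparison functions; each still ignores its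
    own coordinate because updates at i and j commute.\<close>
  also have "(\<integral>y. F' y * ln (F' y) \<partial>QJ) \<le> (\<integral>y. F' y \<partial>QJ) * ln (\<integral>y. F' y \<partial>QJ)
      + (\<Sum>i\<in>J. \<integral>y. F' y * ln (F' y / c' i y) - F' y + c' i y \<partial>QJ)"
  proof -
    have "c' i (y(i := z)) = c' i y" if "i \<in> J" "y \<in> space QJ" "z \<in> space N" for i y z
    proof -
      have "i \<noteq> j" using that insert.hyps by auto
      then have tw: "y(i := z, j := x) = y(j := x, i := z)" for x by (simp add: fun_upd_twist)
      show ?thesis unfolding c'_def tw
        by (rule Bochner_Integration.integral_cong[OF refl], rule indep[OF insertI2[OF that(1)] upd_sp[OF that(2)] that(3)])
    qed
    then have "(\<integral>y. F' y * ln (F' y) \<partial>QJ) - (\<integral>y. F' y \<partial>QJ) * ln (\<integral>y. F' y \<partial>QJ)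
      \<le> (\<Sum>i\<in>J. \<integral>y. F' y * ln (F' y / c' i y) - F' y + c' i y \<partial>QJ)"
      by (intro insert.IH[folded QJ_def]) (use F' c' F'b c'b in blast)+
    then show ?thesis by linarith
  qed
  \<comment> \<open>Averaging over coordinate j does not increase the divergences, by joint
    convexity.\<close>
  also have "(\<Sum>i\<in>J. \<integral>y. F' y * ln (F' y / c' i y) - F' y + c' i y \<partial>QJ) \<le> (\<Sum>i\<in>J. \<integral>y. R i y \<partial>Q)"
  proof (rule sum_mono)
    fix i assume i: "i \<in> J"
    have "(\<integral>y. F' y * ln (F' y / c' i y) - F' y + c' i y \<partial>QJ) \<le> (\<integral>y. (\<integral>z. R i (y(j := z)) \<partial>N) \<partial>QJ)"
    proof (rule integral_mono)
      show "integrable QJ (\<lambda>y. F' y * ln (F' y / c' i y) - F' y + c' i y)"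
        by (rule QJ.bounded_integrable[where B=K])
           (use F' c'[OF i] F'b c'b a i in
            \<open>auto simp: K_def intro!: relative_entropy_bounded borel_measurable_add borel_measurable_diff
                borel_measurable_times borel_measurable_ln borel_measurable_divide\<close>)
      show "integrable QJ (\<lambda>y. \<integral>z. R i (y(j := z)) \<partial>N)" using R_sl_int i by auto
      fix y assume y: "y \<in> space QJ"
      show "F' y * ln (F' y / c' i y) - F' y + c' i y \<le> (\<integral>z. R i (y(j := z)) \<partial>N)"
        unfolding F'_def c'_def R_def
        by (rule N.relative_entropy_integral[OF sl[OF F y] sl[OF c[OF insertI2[OF i]] y] a
              Fb[OF upd_sp[OF y]] cb[OF insertI2[OF i] upd_sp[OF y]]])
    qed
    then show "(\<integral>y. F' y * ln (F' y / c' i y) - F' y + c' i y \<partial>QJ) \<le> (\<integral>y. R i y \<partial>Q)"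
      using R_sum i by simp
  qed
  finally show ?case
    unfolding Q_def[symmetric] IF R_def using insert.hyps by simp
qed

subsection \<open>From entropy bounds to tail bounds\<close>

text \<open>The error term for differentiating the moment generating function under the
  integral.\<close>

lemma exp_quadratic_remainder:
  fixes t :: real
  shows "\<bar>exp t - 1 - t\<bar> \<le> t\<^sup>2 * exp \<bar>t\<bar>"
proof -
  have lo: "0 \<le> exp t - 1 - t" using exp_ge_add_one_self[of t] by linarith
  have "1 - t \<le> exp (- t)" using exp_ge_add_one_self[of "- t"] by simp
  then have "(1 - t) * exp t \<le> exp (- t) * exp t" by (intro mult_right_mono) auto
  then have h: "exp t - 1 \<le> t * exp t" by (simp add: exp_minus algebra_simps)
  have "exp t - 1 - t \<le> t * (exp t - 1)" using h by (simp add: algebra_simps)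
  also have "\<dots> \<le> t\<^sup>2 * exp \<bar>t\<bar>"
  proof (cases "0 \<le> t")
    case True
    then have "t * (exp t - 1) \<le> t * (t * exp t)" using h by (intro mult_left_mono) auto
    then show ?thesis using True by (simp add: power2_eq_square)
  next
    case False
    have "t \<le> exp t - 1" using exp_ge_add_one_self[of t] by linarith
    then have "t * (exp t - 1) \<le> t * t" using False by (intro mult_left_mono_neg) auto
    also have "\<dots> \<le> t * t * exp \<bar>t\<bar>" by (simp add: mult_le_cancel_left1)
    finally show ?thesis by (simp add: power2_eq_square)
  qed
  finally show ?thesis using lo by simp
qed

locale bounded_variable = prob_space M for M :: "'b measure" +
  fixes H :: "'b \<Rightarrow> real" and B :: real
  assumes H_measurable [measurable]: "H \<in> borel_measurable M"
    and H_bound: "\<And>y. y \<in> space M \<Longrightarrow> 0 \<le> H y \<and> H y \<le> B"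
begin

definition mgf :: "real \<Rightarrow> real" where "mgf t = (\<integral>y. exp (t * H y) \<partial>M)"
definition mgf' :: "real \<Rightarrow> real" where "mgf' t = (\<integral>y. H y * exp (t * H y) \<partial>M)"

lemma tH_bound: "y \<in> space M \<Longrightarrow> \<bar>t * H y\<bar> \<le> \<bar>t\<bar> * B"
  using H_bound[of y] by (auto simp: abs_mult intro!: mult_left_mono)

lemma exp_tH_bound:
  "y \<in> space M \<Longrightarrow> exp (- (\<bar>t\<bar> * B)) \<le> exp (t * H y) \<and> exp (t * H y) \<le> exp (\<bar>t\<bar> * B)"
  using tH_bound[of y t] by (auto simp: abs_le_iff)

lemma B_nonneg: "0 \<le> B"
  using H_bound not_empty by (metis all_not_in_conv order_trans)

lemma H_integrable: "integrable M H"
  by (rule integrable_const_bound[where B=B]) (use H_bound in \<open>auto intro!: AE_I2\<close>)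

lemma mgf_integrable: "integrable M (\<lambda>y. exp (t * H y))"
  by (rule integrable_const_bound[where B="exp (\<bar>t\<bar> * B)"])
     (use exp_tH_bound in \<open>auto intro!: AE_I2\<close>)

lemma mgf'_integrable: "integrable M (\<lambda>y. H y * exp (t * H y))"
proof (rule integrable_const_bound[where B="B * exp (\<bar>t\<bar> * B)"])
  show "AE y in M. norm (H y * exp (t * H y)) \<le> B * exp (\<bar>t\<bar> * B)"
  proof (rule AE_I2)
    fix y assume y: "y \<in> space M"
    show "norm (H y * exp (t * H y)) \<le> B * exp (\<bar>t\<bar> * B)"
      unfolding norm_mult using H_bound[OF y] exp_tH_bound[OF y, of t] by (intro mult_mono) auto
  qed
qed auto

lemma mgf_pos: "0 < mgf t"
proof -
  have "exp (- (\<bar>t\<bar> * B)) \<le> mgf t" unfolding mgf_def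
    by (rule integral_ge_const[OF mgf_integrable]) (use exp_tH_bound in \<open>auto intro!: AE_I2\<close>)
  then show ?thesis using exp_gt_zero less_le_trans by blast
qed

lemma mgf_0: "mgf 0 = 1" unfolding mgf_def by (simp add: prob_space)

lemma mgf'_0: "mgf' 0 = (\<integral>y. H y \<partial>M)" unfolding mgf'_def by simp

lemma mgf'_nonneg: "0 \<le> mgf' t"
  unfolding mgf'_def by (rule integral_nonneg_AE) (use H_bound in \<open>auto intro!: AE_I2\<close>)

text \<open>For increments |h| \<le> 1 the first-order expansion of the integrand has error at most
  C h^2, uniformly over the space because \<open>H\<close> is bounded. No limit has to be exchanged
  with an integral.\<close>

lemma mgf_deriv: "(mgf has_real_derivative mgf' t) (at t)"
proof -
  define C where "C = exp (\<bar>t\<bar> * B) * (B\<^sup>2 * exp B)"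
  have key: "\<bar>mgf (t + h) - mgf t - h * mgf' t\<bar> \<le> C * h\<^sup>2" if h: "\<bar>h\<bar> \<le> 1" for h
  proof -
    have eq: "mgf (t + h) - mgf t - h * mgf' t
        = (\<integral>y. exp ((t + h) * H y) - exp (t * H y) - h * (H y * exp (t * H y)) \<partial>M)"
      unfolding mgf_def mgf'_def using mgf_integrable mgf'_integrable by simp
    have "\<bar>mgf (t + h) - mgf t - h * mgf' t\<bar> \<le> (\<integral>y. \<bar>exp ((t + h) * H y) - exp (t * H y) - h * (H y * exp (t * H y))\<bar> \<partial>M)"
      unfolding eq by (rule integral_abs_bound)
    also have "\<dots> \<le> C * h\<^sup>2"
    proof (rule integral_le_const)
      show "integrable M (\<lambda>y. \<bar>exp ((t + h) * H y) - exp (t * H y) - h * (H y * exp (t * H y))\<bar>)"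
        using mgf_integrable mgf'_integrable by simp
      show "AE y in M. \<bar>exp ((t + h) * H y) - exp (t * H y) - h * (H y * exp (t * H y))\<bar> \<le> C * h\<^sup>2"
      proof (rule AE_I2)
        fix y assume y: "y \<in> space M"
        have eq: "exp ((t + h) * H y) - exp (t * H y) - h * (H y * exp (t * H y))
            = exp (t * H y) * (exp (h * H y) - 1 - h * H y)"
          by (simp add: algebra_simps exp_add)
        have "\<bar>exp ((t + h) * H y) - exp (t * H y) - h * (H y * exp (t * H y))\<bar>
            \<le> exp (\<bar>t\<bar> * B) * ((h * H y)\<^sup>2 * exp \<bar>h * H y\<bar>)"
          unfolding eq abs_mult[of "exp (t * H y)"] using exp_tH_bound[OF y, of t] exp_quadratic_remainder[of "h * H y"]
          by (intro mult_mono) auto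
        also have "\<dots> \<le> exp (\<bar>t\<bar> * B) * ((h\<^sup>2 * B\<^sup>2) * exp B)"
        proof (intro mult_left_mono mult_mono)
          show "(h * H y)\<^sup>2 \<le> h\<^sup>2 * B\<^sup>2"
            unfolding power_mult_distrib using H_bound[OF y] by (intro mult_left_mono power_mono) auto
          have "\<bar>h * H y\<bar> \<le> \<bar>h\<bar> * B" by (rule tH_bound[OF y])
          also have "\<dots> \<le> 1 * B" using h B_nonneg by (intro mult_right_mono)
          finally show "exp \<bar>h * H y\<bar> \<le> exp B" by simp
        qed auto
        finally show "\<bar>exp ((t + h) * H y) - exp (t * H y) - h * (H y * exp (t * H y))\<bar> \<le> C * h\<^sup>2"
          unfolding C_def by (simp add: algebra_simps)
      qed
    qed
    finally show ?thesis .
  qed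
  show ?thesis unfolding DERIV_def
  proof (rule LIM_zero_cancel, rule Lim_null_comparison)
    show "\<forall>\<^sub>F h in at 0. norm ((mgf (t + h) - mgf t) / h - mgf' t) \<le> C * \<bar>h\<bar>"
      unfolding eventually_at
    proof (intro exI[of _ 1] conjI ballI impI)
      fix h :: real assume "h \<noteq> 0 \<and> dist h 0 < 1"
      then have h: "h \<noteq> 0" "\<bar>h\<bar> \<le> 1" by auto
      have "(mgf (t + h) - mgf t) / h - mgf' t = (mgf (t + h) - mgf t - h * mgf' t) / h"
        using h by (simp add: field_simps)
      then have "norm ((mgf (t + h) - mgf t) / h - mgf' t) = \<bar>mgf (t + h) - mgf t - h * mgf' t\<bar> / \<bar>h\<bar>"
        by simp
      also have "\<dots> \<le> C * h\<^sup>2 / \<bar>h\<bar>" using key[OF h(2)] by (intro divide_right_mono) auto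
      also have "\<dots> = C * \<bar>h\<bar>" using h by (simp add: power2_eq_square field_simps flip: abs_mult)
      finally show "norm ((mgf (t + h) - mgf t) / h - mgf' t) \<le> C * \<bar>h\<bar>" .
    qed simp
    show "((\<lambda>h. C * \<bar>h\<bar>) \<longlongrightarrow> 0) (at 0)" by (auto intro!: tendsto_eq_intros)
  qed
qed

lemma ln_mgf_deriv: "((\<lambda>t. ln (mgf t)) has_real_derivative mgf' t / mgf t) (at t)"
  using mgf_deriv mgf_pos by (auto intro!: derivative_eq_intros)

lemma ln_mgf_neg_deriv:
  "((\<lambda>t. - ln (mgf (- t))) has_real_derivative mgf' (- t) / mgf (- t)) (at t)"
proof -
  have "((\<lambda>t. ln (mgf (- t))) has_real_derivative mgf' (- t) / mgf (- t) * - 1) (at t)"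
    by (rule DERIV_chain2[where f="\<lambda>t. ln (mgf t)" and g=uminus, OF ln_mgf_deriv])
       (auto intro!: derivative_eq_intros)
  then show ?thesis using DERIV_minus by force
qed

text \<open>Written as F ln F with F = exp(t H), which matches the left side of
  \<open>entropy_tensorization\<close>; the differential form used for integration in t is
  \<open>entropy_exp_eq\<close>.\<close>

definition entropy_exp :: "real \<Rightarrow> real" where
  "entropy_exp t = (\<integral>y. exp (t * H y) * ln (exp (t * H y)) \<partial>M) - mgf t * ln (mgf t)"

lemma entropy_exp_eq: "entropy_exp t = t * mgf' t - mgf t * ln (mgf t)"
proof -
  have "(\<integral>y. exp (t * H y) * ln (exp (t * H y)) \<partial>M) = (\<integral>y. t * (H y * exp (t * H y)) \<partial>M)"
    by (simp add: ac_simps)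
  then show ?thesis unfolding entropy_exp_def mgf'_def by simp
qed

text \<open>The derivative at 0 of the logarithm of the moment generating function is the mean. This
  is the initial value for the monotone functions below, which live on t > 0.\<close>

lemma ln_mgf_ratio_right: "((\<lambda>t. ln (mgf t) / t) \<longlongrightarrow> (\<integral>y. H y \<partial>M)) (at_right 0)"
proof -
  have "((\<lambda>t. ln (mgf t)) has_real_derivative (\<integral>y. H y \<partial>M)) (at 0)"
    using ln_mgf_deriv[of 0] by (simp add: mgf_0 mgf'_0)
  then have "((\<lambda>t. ln (mgf t) / t) \<longlongrightarrow> (\<integral>y. H y \<partial>M)) (at 0)"
    unfolding DERIV_def by (simp add: mgf_0)
  then show ?thesis by (rule tendsto_mono[rotated]) (simp add: at_within_le_at)
qed

lemma ln_mgf_ratio_left: "((\<lambda>t. - ln (mgf (- t)) / t) \<longlongrightarrow> (\<integral>y. H y \<partial>M)) (at_right 0)"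
proof -
  have "((\<lambda>t. - ln (mgf (- t))) has_real_derivative (\<integral>y. H y \<partial>M)) (at 0)"
    using ln_mgf_neg_deriv[of 0] by (simp add: mgf_0 mgf'_0)
  then have "((\<lambda>t. - ln (mgf (- t)) / t) \<longlongrightarrow> (\<integral>y. H y \<partial>M)) (at 0)"
    unfolding DERIV_def by (simp add: mgf_0)
  then show ?thesis by (rule tendsto_mono[rotated]) (simp add: at_within_le_at)
qed

text \<open>Herbst's argument: the entropy bound says that \<open>ln (mgf t) (1 - t) / t - t S / 2\<close>
  is nonincreasing, and its limit at \<open>0\<close> is the mean.\<close>

lemma herbst_upper:
  assumes ent: "\<And>t. 0 < t \<Longrightarrow> t < 1 \<Longrightarrow> entropy_exp t \<le> t\<^sup>2 * S / 2 * mgf t + t\<^sup>2 * mgf' t"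
    and t: "0 < t" "t < 1"
  shows "ln (mgf t) \<le> (t * (\<integral>y. H y \<partial>M) + t\<^sup>2 * S / 2) / (1 - t)"
proof -
  define g where "g s = ln (mgf s) * ((1 - s) / s) - s * S / 2" for s
  have d: "(g has_real_derivative
      mgf' s / mgf s * ((1 - s) / s) - ln (mgf s) / s\<^sup>2 - S / 2) (at s)" if s: "0 < s" for s
  proof -
    have 1: "((\<lambda>s. (1 - s) / s) has_real_derivative - 1 / s\<^sup>2) (at s)"
      using s by (auto intro!: derivative_eq_intros simp: field_simps power2_eq_square)
    have 2: "((\<lambda>s. s * S / 2) has_real_derivative S / 2) (at s)"
      by (auto intro!: derivative_eq_intros)
    show ?thesis unfolding g_def
      by (intro DERIV_diff[OF _ 2] DERIV_cong[OF DERIV_mult[OF ln_mgf_deriv 1]]) simp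
  qed
  have neg: "mgf' s / mgf s * ((1 - s) / s) - ln (mgf s) / s\<^sup>2 - S / 2 \<le> 0" if s: "0 < s" "s < 1" for s
  proof -
    have "s * mgf' s - mgf s * ln (mgf s) \<le> s\<^sup>2 * S / 2 * mgf s + s\<^sup>2 * mgf' s"
      using ent[OF s] unfolding entropy_exp_eq .
    \<comment> \<open>With L = ln mgf the hypothesis reads (s - s^2) L' - L \<le> s^2 S / 2;
      division by s^2 turns it into g' \<le> 0.\<close>
    then have "(s * mgf' s - mgf s * ln (mgf s)) / mgf s \<le> (s\<^sup>2 * S / 2 * mgf s + s\<^sup>2 * mgf' s) / mgf s"
      using mgf_pos[of s] by (intro divide_right_mono) auto
    then have "s * (mgf' s / mgf s) - ln (mgf s) \<le> s\<^sup>2 * S / 2 + s\<^sup>2 * (mgf' s / mgf s)"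
      using mgf_pos[of s] by (simp add: diff_divide_distrib add_divide_distrib)
    moreover have "r * (s * (1 - s)) = s * r - s\<^sup>2 * r" for r :: real
      by (simp add: algebra_simps power2_eq_square)
    note this[of "mgf' s / mgf s"]
    moreover have "s\<^sup>2 * S / 2 = S / 2 * s\<^sup>2" by simp
    ultimately have "(mgf' s / mgf s) * (s * (1 - s)) - ln (mgf s) - S / 2 * s\<^sup>2 \<le> 0"
      by linarith
    then have "((mgf' s / mgf s) * (s * (1 - s)) - ln (mgf s) - S / 2 * s\<^sup>2) / s\<^sup>2 \<le> 0"
      using s by (simp add: divide_nonpos_pos)
    also have "(r * (s * (1 - s)) - L - S / 2 * s\<^sup>2) / s\<^sup>2 = r * ((1 - s) / s) - L / s\<^sup>2 - S / 2"
      for r L :: real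
      using s by (simp add: field_simps power2_eq_square)
    note this[of "mgf' s / mgf s" "ln (mgf s)"]
    finally show ?thesis .
  qed
  have mono: "g t \<le> g s" if s: "0 < s" "s < t" for s
  proof (rule DERIV_nonpos_imp_nonincreasing[of s t g])
    show "s \<le> t" using s by simp
    fix r assume "s \<le> r" "r \<le> t"
    then have "0 < r" "r < 1" using s t by auto
    then show "\<exists>y. (g has_real_derivative y) (at r) \<and> y \<le> 0" using d neg by blast
  qed
  have "((\<lambda>s. (ln (mgf s) / s) * (1 - s) - s * S / 2) \<longlongrightarrow> (\<integral>y. H y \<partial>M) * (1 - 0) - 0 * S / 2) (at_right 0)"
    by (intro tendsto_intros ln_mgf_ratio_right) auto
  then have "(g \<longlongrightarrow> (\<integral>y. H y \<partial>M)) (at_right 0)" unfolding g_def by simp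
  moreover have "\<forall>\<^sub>F s in at_right 0. g t \<le> g s"
    using eventually_at_right_less[of "0::real"] eventually_at_right_real[OF t(1)]
    by eventually_elim (auto intro: mono)
  ultimately have "g t \<le> (\<integral>y. H y \<partial>M)" by (rule tendsto_lowerbound) simp
  then have "ln (mgf t) * ((1 - t) / t) \<le> (\<integral>y. H y \<partial>M) + t * S / 2" unfolding g_def by simp
  then have "ln (mgf t) * ((1 - t) / t) * (t / (1 - t)) \<le> ((\<integral>y. H y \<partial>M) + t * S / 2) * (t / (1 - t))"
    using t by (intro mult_right_mono) auto
  also have "ln (mgf t) * ((1 - t) / t) * (t / (1 - t)) = ln (mgf t)" using t by simp
  also have "((\<integral>y. H y \<partial>M) + t * S / 2) * (t / (1 - t)) = (t * (\<integral>y. H y \<partial>M) + t\<^sup>2 * S / 2) / (1 - t)"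
    by (simp add: algebra_simps power2_eq_square add_divide_distrib)
  finally show ?thesis .
qed

text \<open>Herbst's argument on the negative side. With K(s) = -ln mgf(-s) the hypothesis becomes s
  K' \<ge> (1 - s) K minus a variance term. The integrating factor exp(s) / s makes K exp(s) / s + S
  s / (2 (1 - 2 s)) nondecreasing, and its limit at 0 is the mean.\<close>

lemma herbst_lower:
  assumes ent: "\<And>t. 0 < t \<Longrightarrow> t < 1/2 \<Longrightarrow> entropy_exp (- t)
      \<le> exp t * (t\<^sup>2 / 2 * (1 + 2 * t) / (1 - t)) * S * mgf (- t) + t\<^sup>2 / (1 - t) * mgf' (- t)"
    and S: "0 \<le> S" and t: "0 < t" "t < 1/2"
  shows "ln (mgf (- t)) \<le> - (t * exp (- t) * (\<integral>y. H y \<partial>M)) + t\<^sup>2 * S / (2 * (1 - 2 * t))"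
proof -
  define K where "K s = - ln (mgf (- s))" for s
  define K' where "K' s = mgf' (- s) / mgf (- s)" for s
  have dK: "(K has_real_derivative K' s) (at s)" for s
    unfolding K_def K'_def by (rule ln_mgf_neg_deriv)
  define g where "g s = K s * (exp s / s) + S * s / (2 * (1 - 2 * s))" for s
  have d: "(g has_real_derivative
      K' s * (exp s / s) + K s * (exp s * (s - 1) / s\<^sup>2) + S / (2 * (1 - 2 * s)\<^sup>2)) (at s)"
    if s: "0 < s" "s < 1/2" for s
  proof -
    have 1: "((\<lambda>s. exp s / s) has_real_derivative exp s * (s - 1) / s\<^sup>2) (at s)"
      using s by (auto intro!: derivative_eq_intros simp: field_simps power2_eq_square)
    have "1 - 2 * s \<noteq> 0" using s by simp
    then have "((\<lambda>s. S * s / (2 * (1 - 2 * s))) has_real_derivative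
        (S * (2 * (1 - 2 * s)) - (S * s) * (2 * (- 2))) / ((2 * (1 - 2 * s)) * (2 * (1 - 2 * s)))) (at s)"
      by (auto intro!: derivative_eq_intros)
    moreover have "(S * (2 * (1 - 2 * s)) - (S * s) * (2 * (- 2))) / ((2 * (1 - 2 * s)) * (2 * (1 - 2 * s)))
        = S / (2 * (1 - 2 * s)\<^sup>2)"
      using \<open>1 - 2 * s \<noteq> 0\<close> by (simp add: divide_simps power2_eq_square) (simp add: algebra_simps)
    ultimately have 2: "((\<lambda>s. S * s / (2 * (1 - 2 * s))) has_real_derivative S / (2 * (1 - 2 * s)\<^sup>2)) (at s)"
      by simp
    show ?thesis unfolding g_def by (intro DERIV_add[OF _ 2] DERIV_cong[OF DERIV_mult[OF dK 1]]) simp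
  qed
  have pos: "0 \<le> K' s * (exp s / s) + K s * (exp s * (s - 1) / s\<^sup>2) + S / (2 * (1 - 2 * s)\<^sup>2)"
    if s: "0 < s" "s < 1/2" for s
  proof -
    define \<alpha> where "\<alpha> = exp s * (s\<^sup>2 / 2 * (1 + 2 * s) / (1 - s))"
    have "(- s) * mgf' (- s) - mgf (- s) * ln (mgf (- s)) \<le> \<alpha> * S * mgf (- s) + s\<^sup>2 / (1 - s) * mgf' (- s)"
      using ent[OF s] unfolding entropy_exp_eq \<alpha>_def .
    then have "((- s) * mgf' (- s) - mgf (- s) * ln (mgf (- s))) / mgf (- s)
        \<le> (\<alpha> * S * mgf (- s) + s\<^sup>2 / (1 - s) * mgf' (- s)) / mgf (- s)"
      using mgf_pos[of "- s"] by (intro divide_right_mono) auto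
    then have "- s * K' s + K s \<le> \<alpha> * S + s\<^sup>2 / (1 - s) * K' s"
      using mgf_pos[of "- s"] unfolding K_def K'_def by (simp add: diff_divide_distrib add_divide_distrib)
    then have "K s - \<alpha> * S \<le> (s + s\<^sup>2 / (1 - s)) * K' s" by (simp add: algebra_simps)
    also have "s + s\<^sup>2 / (1 - s) = s / (1 - s)" using s by (simp add: field_simps power2_eq_square)
    finally have "(1 - s) * (K s - \<alpha> * S) \<le> (1 - s) * (s / (1 - s) * K' s)"
      using s by (intro mult_left_mono) auto
    also have "(1 - s) * (s / (1 - s) * K' s) = s * K' s" using s by simp
    finally have 1: "(1 - s) * K s - (1 - s) * \<alpha> * S \<le> s * K' s" by (simp add: algebra_simps)
    have "(1 - 2 * s) * exp (2 * s) \<le> exp (- 2 * s) * exp (2 * s)"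
      using exp_ge_add_one_self[of "- 2 * s"] by (intro mult_right_mono) auto
    then have e: "(1 - 2 * s) * exp (2 * s) \<le> 1" by (simp add: exp_minus)
    \<comment> \<open>Combines 1 - 4 s^2 \<le> 1 with (1 - 2 s) exp(2 s) \<le> 1. The resulting
      bound 1 / (1 - 2 s)^2 is the derivative of s / (1 - 2 s), which explains the correction term
      in \<open>g\<close>.\<close>
    have "((1 + 2 * s) * (1 - 2 * s)) * ((1 - 2 * s) * exp (2 * s)) \<le> 1 * 1"
      using s e by (intro mult_mono) (auto simp: algebra_simps)
    then have "exp (2 * s) * (1 + 2 * s) * (1 - 2 * s)\<^sup>2 \<le> 1"
      by (simp add: power2_eq_square ac_simps)
    then have e2: "exp (2 * s) * (1 + 2 * s) \<le> 1 / (1 - 2 * s)\<^sup>2" using s by (simp add: field_simps)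
    have "exp s * ((1 - s) * \<alpha>) / s\<^sup>2 = exp (2 * s) * (1 + 2 * s) / 2"
    proof -
      have "(1 - s) * \<alpha> = exp s * (s\<^sup>2 / 2 * (1 + 2 * s))" 
      proof -
        have "d * (e * (a / d)) = e * a" if "d \<noteq> 0" for d e a :: real using that by simp
        moreover have "1 - s \<noteq> 0" using s by simp
        ultimately show ?thesis unfolding \<alpha>_def by blast
      qed
      then show ?thesis unfolding \<open>(1 - s) * \<alpha> = _\<close> using s by (simp add: exp_double power2_eq_square)
    qed
    then have "exp s * ((1 - s) * \<alpha> * S) / s\<^sup>2 = exp (2 * s) * (1 + 2 * s) / 2 * S"
      by (metis (no_types, opaque_lifting) mult.assoc times_divide_eq_left)
    also have "\<dots> \<le> 1 / (1 - 2 * s)\<^sup>2 / 2 * S" using e2 S by (intro mult_right_mono divide_right_mono) auto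
    finally have 2: "exp s * ((1 - s) * \<alpha> * S) / s\<^sup>2 \<le> S / (2 * (1 - 2 * s)\<^sup>2)" by simp
    have "exp s / s\<^sup>2 * ((1 - s) * K s - (1 - s) * \<alpha> * S) \<le> exp s / s\<^sup>2 * (s * K' s)"
      using 1 by (intro mult_left_mono) auto
    also have "exp s / s\<^sup>2 * (s * K' s) = K' s * (exp s / s)" using s by (simp add: power2_eq_square)
    finally have "0 \<le> K' s * (exp s / s) + K s * (exp s * (s - 1) / s\<^sup>2) + exp s * ((1 - s) * \<alpha> * S) / s\<^sup>2"
      by (simp add: diff_divide_distrib add_divide_distrib algebra_simps)
    then show ?thesis using 2 by linarith
  qed
  have mono: "g s \<le> g t" if s: "0 < s" "s < t" for s
  proof (rule DERIV_nonneg_imp_nondecreasing[of s t g])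
    show "s \<le> t" using s by simp
    fix r assume "s \<le> r" "r \<le> t"
    then have "0 < r" "r < 1/2" using s t by auto
    then show "\<exists>y. (g has_real_derivative y) (at r) \<and> 0 \<le> y" using d pos by blast
  qed
  have "((\<lambda>s. (- ln (mgf (- s)) / s) * exp s + S * s / (2 * (1 - 2 * s)))
      \<longlongrightarrow> (\<integral>y. H y \<partial>M) * exp 0 + S * 0 / (2 * (1 - 2 * 0))) (at_right 0)"
    by (intro tendsto_intros ln_mgf_ratio_left) auto
  then have "(g \<longlongrightarrow> (\<integral>y. H y \<partial>M)) (at_right 0)" unfolding g_def K_def by simp
  moreover have "\<forall>\<^sub>F s in at_right 0. g s \<le> g t"
    using eventually_at_right_less[of "0::real"] eventually_at_right_real[OF t(1)]
    by eventually_elim (auto intro: mono)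
  ultimately have "(\<integral>y. H y \<partial>M) \<le> g t" by (rule tendsto_upperbound) simp
  then have "t * exp (- t) * (\<integral>y. H y \<partial>M) \<le> t * exp (- t) * g t"
    using t by (intro mult_left_mono) auto
  also have "\<dots> = K t + exp (- t) * (t\<^sup>2 * S / (2 * (1 - 2 * t)))"
    unfolding g_def using t by (simp add: exp_minus field_simps power2_eq_square)
  also have "\<dots> \<le> K t + 1 * (t\<^sup>2 * S / (2 * (1 - 2 * t)))"
    using t S by (intro add_left_mono mult_right_mono) auto
  finally show ?thesis unfolding K_def by simp
qed

lemma chernoff_upper:
  assumes "0 < t"
  shows "prob {y \<in> space M. s < H y} \<le> exp (ln (mgf t) - t * s)"
proof -
  have "prob {y \<in> space M. s < H y} = (\<integral>y. indicator {y \<in> space M. s < H y} y \<partial>M)"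
    by simp
  also have "\<dots> \<le> (\<integral>y. exp (- (t * s)) * exp (t * H y) \<partial>M)"
  proof (rule integral_mono)
    show "integrable M (indicator {y \<in> space M. s < H y} :: 'b \<Rightarrow> real)"
      by (intro integrable_real_indicator) (auto simp: emeasure_eq_measure)
    fix y
    show "indicator {y \<in> space M. s < H y} y \<le> exp (- (t * s)) * exp (t * H y)"
      using assms by (auto simp: indicator_def exp_add[symmetric])
  qed (use mgf_integrable in auto)
  also have "\<dots> = exp (- (t * s)) * mgf t" unfolding mgf_def by simp
  also have "\<dots> = exp (ln (mgf t) - t * s)" using mgf_pos[of t] by (simp add: exp_diff exp_minus field_simps)
  finally show ?thesis .
qed

lemma chernoff_lower:
  assumes "0 < t"
  shows "prob {y \<in> space M. H y < s} \<le> exp (ln (mgf (- t)) + t * s)"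
proof -
  have "prob {y \<in> space M. H y < s} = (\<integral>y. indicator {y \<in> space M. H y < s} y \<partial>M)"
    by simp
  also have "\<dots> \<le> (\<integral>y. exp (t * s) * exp (- t * H y) \<partial>M)"
  proof (rule integral_mono)
    show "integrable M (indicator {y \<in> space M. H y < s} :: 'b \<Rightarrow> real)"
      by (intro integrable_real_indicator) (auto simp: emeasure_eq_measure)
    fix y
    show "indicator {y \<in> space M. H y < s} y \<le> exp (t * s) * exp (- t * H y)"
      using assms by (auto simp: indicator_def exp_add[symmetric])
  qed (use mgf_integrable[of "- t"] in auto)
  also have "\<dots> = exp (t * s) * mgf (- t)" unfolding mgf_def by simp
  also have "\<dots> = exp (ln (mgf (- t)) + t * s)" using mgf_pos[of "- t"] by (simp add: exp_add)
  finally show ?thesis .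
qed

end

text \<open>The minimum over \<open>t\<close> of \<open>v t\<^sup>2 / (2 (1 - c t)) - t s\<close> at \<open>s = sqrt (2 v x) + c x\<close>
  is \<open>- x\<close>, attained at \<open>t = sqrt (2 x) / (sqrt v + c sqrt (2 x))\<close>.\<close>

lemma sub_gamma_optimum:
  fixes v x c :: real
  assumes v: "0 < v" and x: "0 < x" and c: "0 < c"
  defines "t \<equiv> sqrt (2 * x) / (sqrt v + c * sqrt (2 * x))"
  shows "0 < t" "c * t < 1"
    "v * t\<^sup>2 / (2 * (1 - c * t)) - t * (sqrt (2 * v * x) + c * x) = - x"
proof -
  define p where "p = sqrt v"
  define q where "q = sqrt (2 * x)"
  have p: "0 < p" "v = p\<^sup>2" unfolding p_def using v by auto
  have q: "0 < q" "x = q\<^sup>2 / 2" unfolding q_def using x by auto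
  have t: "t = q / (p + c * q)" unfolding t_def p_def q_def ..
  have d: "0 < p + c * q" using p q c by (simp add: add_pos_pos)
  show "0 < t" unfolding t using q d by simp
  have ct: "1 - c * t = p / (p + c * q)" unfolding t using d by (simp add: field_simps)
  then show "c * t < 1" using p d by (metis diff_gt_0_iff_gt divide_pos_pos)
  have sq: "sqrt (2 * v * x) = p * q"
    unfolding p(2) q(2) using p q by (simp add: real_sqrt_mult)
  have 1: "v * t\<^sup>2 / (2 * (1 - c * t)) = p * q\<^sup>2 / (2 * (p + c * q))"
    unfolding ct unfolding t p(2) using p d by (simp add: power2_eq_square divide_simps)
  have 2: "t * (sqrt (2 * v * x) + c * x) = q\<^sup>2 * (2 * p + c * q) / (2 * (p + c * q))"
    unfolding sq unfolding t q(2) using d by (simp add: power2_eq_square divide_simps) (simp add: algebra_simps)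
  have 3: "p * q\<^sup>2 / (2 * (p + c * q)) - q\<^sup>2 * (2 * p + c * q) / (2 * (p + c * q)) = - (q\<^sup>2 / 2)"
    using d by (simp add: divide_simps) (simp add: algebra_simps power2_eq_square)
  show "v * t\<^sup>2 / (2 * (1 - c * t)) - t * (sqrt (2 * v * x) + c * x) = - x"
    unfolding 1 2 3 using q(2) by simp
qed

context bounded_variable
begin

text \<open>Since t m / (1 - t) = t m + t^2 m / (1 - t), Herbst's bound has sub-gamma form with
  variance factor S + 2 m and scale 1; \<open>sub_gamma_optimum\<close> then selects t.\<close>

lemma upper_tail:
  assumes ent: "\<And>t. 0 < t \<Longrightarrow> t < 1 \<Longrightarrow> entropy_exp t \<le> t\<^sup>2 * S / 2 * mgf t + t\<^sup>2 * mgf' t"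
    and S: "0 \<le> S" and x: "0 < x"
  defines "m \<equiv> \<integral>y. H y \<partial>M"
  shows "prob {y \<in> space M. m + sqrt (2 * (S + 2 * m) * x) + x < H y} \<le> exp (- x)"
proof (cases "S + 2 * m = 0")
  \<comment> \<open>The optimal t requires a positive variance factor. If it is zero, then
    \<open>H\<close> vanishes almost everywhere.\<close>
  case True
  have "0 \<le> m" unfolding m_def by (rule integral_nonneg_AE) (use H_bound in \<open>auto intro!: AE_I2\<close>)
  then have "m = 0" using True S by simp
  then have "AE y in M. H y = 0"
    using integral_nonneg_eq_0_iff_AE[OF H_integrable] H_bound unfolding m_def by (auto intro!: AE_I2)
  then have "AE y in M. \<not> (m + sqrt (2 * (S + 2 * m) * x) + x < H y)"
    by eventually_elim (use True \<open>m = 0\<close> x in auto)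
  then have "prob {y \<in> space M. m + sqrt (2 * (S + 2 * m) * x) + x < H y} = 0"
    by (subst prob_eq_0) auto
  then show ?thesis by simp
next
  case False
  have "0 \<le> m" unfolding m_def by (rule integral_nonneg_AE) (use H_bound in \<open>auto intro!: AE_I2\<close>)
  then have v: "0 < S + 2 * m" using False S by simp
  define t where "t = sqrt (2 * x) / (sqrt (S + 2 * m) + 1 * sqrt (2 * x))"
  note opt = sub_gamma_optimum[OF v x zero_less_one, folded t_def]
  have "prob {y \<in> space M. m + sqrt (2 * (S + 2 * m) * x) + x < H y}
      \<le> exp (ln (mgf t) - t * (m + sqrt (2 * (S + 2 * m) * x) + x))"
    by (rule chernoff_upper[OF opt(1)])
  also have "\<dots> \<le> exp (- x)"
  proof -
    have "ln (mgf t) \<le> (t * m + t\<^sup>2 * S / 2) / (1 - t)"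
      using herbst_upper[OF ent, of t] opt(1,2) unfolding m_def by simp
    also have "\<dots> = t * m + (S + 2 * m) * t\<^sup>2 / (2 * (1 - 1 * t))"
      using opt(2) by (simp add: divide_simps power2_eq_square) (simp add: algebra_simps)
    finally have "ln (mgf t) - t * (m + sqrt (2 * (S + 2 * m) * x) + x)
        \<le> (S + 2 * m) * t\<^sup>2 / (2 * (1 - 1 * t)) - t * (sqrt (2 * (S + 2 * m) * x) + 1 * x)"
      by (simp add: algebra_simps)
    then show ?thesis using opt(3) by simp
  qed
  finally show ?thesis .
qed

text \<open>From exp(-t) \<ge> 1 - t, the mean term -t exp(-t) m is at most -t m + t^2 m. The
  surplus t^2 m is absorbed into the variance factor as 2 m, and the scale is 2 because of the
  denominator 1 - 2 t in \<open>herbst_lower\<close>.\<close>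

lemma lower_tail:
  assumes ent: "\<And>t. 0 < t \<Longrightarrow> t < 1/2 \<Longrightarrow> entropy_exp (- t)
      \<le> exp t * (t\<^sup>2 / 2 * (1 + 2 * t) / (1 - t)) * S * mgf (- t) + t\<^sup>2 / (1 - t) * mgf' (- t)"
    and S: "0 \<le> S" and x: "0 < x"
  defines "m \<equiv> \<integral>y. H y \<partial>M"
  shows "prob {y \<in> space M. H y < m - sqrt (2 * (S + 2 * m) * x) - 2 * x} \<le> exp (- x)"
proof (cases "S + 2 * m = 0")
  case True
  have "0 \<le> m" unfolding m_def by (rule integral_nonneg_AE) (use H_bound in \<open>auto intro!: AE_I2\<close>)
  then have "m = 0" using True S by simp
  then have "{y \<in> space M. H y < m - sqrt (2 * (S + 2 * m) * x) - 2 * x} = {}"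
    using True x H_bound by force
  then show ?thesis by (simp only: measure_empty exp_ge_zero)
next
  case False
  have m: "0 \<le> m" unfolding m_def by (rule integral_nonneg_AE) (use H_bound in \<open>auto intro!: AE_I2\<close>)
  then have v: "0 < S + 2 * m" using False S by simp
  define t where "t = sqrt (2 * x) / (sqrt (S + 2 * m) + 2 * sqrt (2 * x))"
  have "(0::real) < 2" by simp
  note opt = sub_gamma_optimum[OF v x this, folded t_def]
  have t2: "t < 1/2" using opt(2) by simp
  have "prob {y \<in> space M. H y < m - sqrt (2 * (S + 2 * m) * x) - 2 * x}
      \<le> exp (ln (mgf (- t)) + t * (m - sqrt (2 * (S + 2 * m) * x) - 2 * x))"
    by (rule chernoff_lower[OF opt(1)])
  also have "\<dots> \<le> exp (- x)"
  proof -
    have "ln (mgf (- t)) \<le> - (t * exp (- t) * m) + t\<^sup>2 * S / (2 * (1 - 2 * t))"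
      using herbst_lower[OF ent S opt(1) t2] unfolding m_def by simp
    also have "- (t * exp (- t) * m) \<le> - (t * (1 - t) * m)"
      using exp_ge_add_one_self[of "- t"] opt(1) m by (simp add: mult_left_mono mult_right_mono)
    also have "- (t * (1 - t) * m) \<le> - (t * m) + t\<^sup>2 * (2 * m) / (2 * (1 - 2 * t))"
    proof -
      have "(t\<^sup>2 * m) * (1 - 2 * t) \<le> t\<^sup>2 * m" using opt(1) m by (intro mult_right_le_one_le) (use t2 in auto)
      then have "t\<^sup>2 * m \<le> t\<^sup>2 * m / (1 - 2 * t)" using t2 by (simp add: pos_le_divide_eq)
      also have "t\<^sup>2 * m / (1 - 2 * t) = t\<^sup>2 * (2 * m) / (2 * (1 - 2 * t))"
        using mult_divide_mult_cancel_left[of 2 "t\<^sup>2 * m" "1 - 2 * t"] by (simp add: ac_simps)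
      finally have "t\<^sup>2 * m \<le> t\<^sup>2 * (2 * m) / (2 * (1 - 2 * t))" .
      moreover have "- (t * (1 - t) * m) = - (t * m) + t\<^sup>2 * m"
        by (simp add: algebra_simps power2_eq_square)
      ultimately show ?thesis by linarith
    qed
    finally have "ln (mgf (- t)) + t * (m - sqrt (2 * (S + 2 * m) * x) - 2 * x)
        \<le> (S + 2 * m) * t\<^sup>2 / (2 * (1 - 2 * t)) - t * (sqrt (2 * (S + 2 * m) * x) + 2 * x)"
      by (simp add: algebra_simps add_divide_distrib)
    then show ?thesis using opt(3) by simp
  qed
  finally show ?thesis .
qed

text \<open>With S = 0 the exponent is at most -t m + t^2 m, free of denominators, so t = sqrt(x /
  m) gives a Gaussian deviation without linear term. The restriction t < 1/2 says exactly that the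
  threshold is positive; otherwise the event is empty as \<open>H\<close> is nonnegative.\<close>

lemma lower_tail_no_variance:
  assumes ent: "\<And>t. 0 < t \<Longrightarrow> t < 1/2 \<Longrightarrow> entropy_exp (- t) \<le> t\<^sup>2 / (1 - t) * mgf' (- t)"
    and x: "0 < x"
  defines "m \<equiv> \<integral>y. H y \<partial>M"
  shows "prob {y \<in> space M. H y < m - 2 * sqrt (m * x)} \<le> exp (- x)"
proof (cases "m \<le> 2 * sqrt (m * x)")
  case True
  then have "{y \<in> space M. H y < m - 2 * sqrt (m * x)} = {}" using H_bound by force
  then show ?thesis by (simp only: measure_empty exp_ge_zero)
next
  case False
  have "0 \<le> m" unfolding m_def by (rule integral_nonneg_AE) (use H_bound in \<open>auto intro!: AE_I2\<close>)
  with False have m: "0 < m" by (cases "m = 0") auto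
  define t where "t = sqrt (x / m)"
  have t: "0 < t" "t\<^sup>2 * m = x" unfolding t_def using m x by auto
  have tm: "sqrt (m * x) = t * m"
  proof -
    have "m * x = (t * m)\<^sup>2" using t(2) by (simp add: power2_eq_square ac_simps)
    then show ?thesis using t m by simp
  qed
  have t2: "t < 1/2" using False m unfolding tm by simp
  have ent': "entropy_exp (- s) \<le> exp s * (s\<^sup>2 / 2 * (1 + 2 * s) / (1 - s)) * 0 * mgf (- s)
      + s\<^sup>2 / (1 - s) * mgf' (- s)" if "0 < s" "s < 1/2" for s
    using ent[OF that] by simp
  have "prob {y \<in> space M. H y < m - 2 * sqrt (m * x)}
      \<le> exp (ln (mgf (- t)) + t * (m - 2 * sqrt (m * x)))"
    by (rule chernoff_lower[OF t(1)])
  also have "\<dots> \<le> exp (- x)"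
  proof -
    have "ln (mgf (- t)) \<le> - (t * exp (- t) * m)"
      using herbst_lower[OF ent' _ t(1) t2] unfolding m_def by simp
    also have "\<dots> \<le> - (t * (1 - t) * m)"
      using exp_ge_add_one_self[of "- t"] t(1) m by (simp add: mult_left_mono mult_right_mono)
    finally have "ln (mgf (- t)) + t * (m - 2 * sqrt (m * x)) \<le> t\<^sup>2 * m - 2 * (t\<^sup>2 * m)"
      unfolding tm by (simp add: algebra_simps power2_eq_square)
    then show ?thesis using t(2) by simp
  qed
  finally show ?thesis .
qed

end

subsection \<open>Leave-one-out bounds on product spaces\<close>

locale iid_product = N: prob_space N for N :: "'b measure" +
  fixes I :: "'i set"
  assumes finite_I: "finite I"
begin

definition Q :: "('i \<Rightarrow> 'b) measure" where "Q = Pi\<^sub>M I (\<lambda>_. N)"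

sublocale Q: prob_space Q
  unfolding Q_def by (rule prob_space_PiM) (rule N.prob_space_axioms)

lemma coord_measurable: "i \<in> I \<Longrightarrow> (\<lambda>y. y i) \<in> measurable Q N"
  unfolding Q_def by (rule measurable_component_singleton)

lemma upd_measurable: "i \<in> I \<Longrightarrow> (\<lambda>(y, z). y(i := z)) \<in> measurable (Q \<Otimes>\<^sub>M N) Q"
  using measurable_add_dim[of i I "\<lambda>_. N"] by (simp add: insert_absorb Q_def)

lemma upd_space: "i \<in> I \<Longrightarrow> y \<in> space Q \<Longrightarrow> z \<in> space N \<Longrightarrow> y(i := z) \<in> space Q"
  using measurable_space[OF upd_measurable, of i "(y, z)"] by (simp add: space_pair_measure)

lemma upd_measurable1:
  assumes "i \<in> I" "y \<in> space Q"
  shows "(\<lambda>z. y(i := z)) \<in> measurable N Q"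
  using measurable_compose[OF measurable_Pair1'[OF assms(2)] upd_measurable[OF assms(1)]] by simp

lemma resample_measurable:
  fixes G :: "('i \<Rightarrow> 'b) \<Rightarrow> real"
  assumes "i \<in> I" "G \<in> borel_measurable Q"
  shows "(\<lambda>y. \<integral>z. G (y(i := z)) \<partial>N) \<in> borel_measurable Q"
  using measurable_compose[OF upd_measurable[OF assms(1)] assms(2)]
  by (intro N.borel_measurable_lebesgue_integral) (simp add: case_prod_unfold)

lemma resample_integral:
  fixes G :: "('i \<Rightarrow> 'b) \<Rightarrow> real"
  assumes i: "i \<in> I" and G: "G \<in> borel_measurable Q" and B: "\<And>y. y \<in> space Q \<Longrightarrow> \<bar>G y\<bar> \<le> B"
  shows "(\<integral>y. G y \<partial>Q) = (\<integral>y. (\<integral>z. G (y(i := z)) \<partial>N) \<partial>Q)"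
proof -
  interpret S: product_sigma_finite "\<lambda>_::'i. N" by standard
  define J where "J = I - {i}"
  have J: "finite J" "i \<notin> J" "insert i J = I" unfolding J_def using finite_I i by auto
  have ins: "(\<integral>y. G' y \<partial>Q) = (\<integral>y. (\<integral>z. G' (y(i := z)) \<partial>N) \<partial>Pi\<^sub>M J (\<lambda>_. N))"
    if "integrable Q G'" for G' :: "_ \<Rightarrow> real"
    using S.product_integral_insert[OF J(1,2), of G'] that unfolding J(3) Q_def by simp
  have "\<bar>\<integral>z. G (y(i := z)) \<partial>N\<bar> \<le> B" if y: "y \<in> space Q" for y
  proof -
    have "(\<lambda>z. G (y(i := z))) \<in> borel_measurable N" by (rule measurable_compose[OF upd_measurable1[OF i y] G])
    moreover have "- B \<le> G (y(i := z))" "G (y(i := z)) \<le> B" if "z \<in> space N" for z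
      using B[OF upd_space[OF i y that]] by (auto simp only: abs_le_iff minus_le_iff)
    ultimately show ?thesis using N.integral_bounds[of "\<lambda>z. G (y(i := z))" "- B" B] by (intro abs_leI) auto
  qed
  then have "integrable Q (\<lambda>y. \<integral>z. G (y(i := z)) \<partial>N)"
    by (intro Q.bounded_integrable[OF resample_measurable[OF i G]])
  then have "(\<integral>y. (\<integral>z. G (y(i := z)) \<partial>N) \<partial>Q) = (\<integral>y. (\<integral>z'. (\<integral>z. G (y(i := z', i := z)) \<partial>N) \<partial>N) \<partial>Pi\<^sub>M J (\<lambda>_. N))"
    by (rule ins)
  also have "\<dots> = (\<integral>y. (\<integral>z. G (y(i := z)) \<partial>N) \<partial>Pi\<^sub>M J (\<lambda>_. N))"
    by (simp only: fun_upd_upd lebesgue_integral_const N.prob_space) simp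
  also have "\<dots> = (\<integral>y. G y \<partial>Q)" by (rule ins[symmetric], rule Q.bounded_integrable[OF G B])
  finally show ?thesis by simp
qed

text \<open>Reduces an inequality between means on the product space to one in a single variable,
  all other coordinates being frozen.\<close>

lemma resample_nonpos:
  fixes G :: "('i \<Rightarrow> 'b) \<Rightarrow> real"
  assumes i: "i \<in> I" and G: "G \<in> borel_measurable Q" "\<And>y. y \<in> space Q \<Longrightarrow> \<bar>G y\<bar> \<le> B"
    and nonpos: "\<And>y. y \<in> space Q \<Longrightarrow> (\<integral>z. G (y(i := z)) \<partial>N) \<le> 0"
  shows "(\<integral>y. G y \<partial>Q) \<le> 0"
proof -
  have "0 \<le> (\<integral>y. - (\<integral>z. G (y(i := z)) \<partial>N) \<partial>Q)"
    by (rule integral_nonneg_AE) (use nonpos in \<open>auto intro!: AE_I2\<close>)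
  then show ?thesis using resample_integral[OF i G] by simp
qed

text \<open>Tensorisation with comparison functions exp(t Hi). Factoring exp(t H) out of each
  divergence leaves u - 1 + exp(-u) at u = t (H - Hi).\<close>

lemma entropy_leave_one_out:
  assumes H: "bounded_variable Q H B"
    and Hi: "\<And>i. i \<in> I \<Longrightarrow> Hi i \<in> borel_measurable Q"
      "\<And>i y. i \<in> I \<Longrightarrow> y \<in> space Q \<Longrightarrow> 0 \<le> Hi i y \<and> Hi i y \<le> B"
    and indep: "\<And>i y z. i \<in> I \<Longrightarrow> y \<in> space Q \<Longrightarrow> z \<in> space N \<Longrightarrow> Hi i (y(i := z)) = Hi i y"
  shows "bounded_variable.entropy_exp Q H t
    \<le> (\<Sum>i\<in>I. \<integral>y. exp (t * H y) * (t * (H y - Hi i y) - 1 + exp (- (t * (H y - Hi i y)))) \<partial>Q)"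
proof -
  interpret H: bounded_variable Q H B by fact
  have bnd: "exp (- (\<bar>t\<bar> * B)) \<le> exp (t * r) \<and> exp (t * r) \<le> exp (\<bar>t\<bar> * B)" if "0 \<le> r" "r \<le> B" for r
  proof -
    have "\<bar>t * r\<bar> \<le> \<bar>t\<bar> * B" using that by (auto simp: abs_mult intro!: mult_left_mono)
    then show ?thesis by (auto simp: abs_le_iff)
  qed
  have "H.entropy_exp t \<le> (\<Sum>i\<in>I. \<integral>y. exp (t * H y) * ln (exp (t * H y) / exp (t * Hi i y))
      - exp (t * H y) + exp (t * Hi i y) \<partial>Q)"
    unfolding H.entropy_exp_def H.mgf_def
    by (rule entropy_tensorization[where a="exp (- (\<bar>t\<bar> * B))" and b="exp (\<bar>t\<bar> * B)",
          OF N.prob_space_axioms finite_I, folded Q_def])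
       (use Hi H.H_bound bnd indep in \<open>auto simp del: exp_le_cancel_iff\<close>)
  also have "\<dots> = (\<Sum>i\<in>I. \<integral>y. exp (t * H y) * (t * (H y - Hi i y) - 1 + exp (- (t * (H y - Hi i y)))) \<partial>Q)"
  proof (intro sum.cong Bochner_Integration.integral_cong refl)
    fix i y
    have "exp (t * Hi i y) = exp (t * H y) * exp (- (t * (H y - Hi i y)))"
      by (simp add: exp_add[symmetric] algebra_simps)
    then show "exp (t * H y) * ln (exp (t * H y) / exp (t * Hi i y)) - exp (t * H y) + exp (t * Hi i y)
        = exp (t * H y) * (t * (H y - Hi i y) - 1 + exp (- (t * (H y - Hi i y))))"
      by (simp add: ln_div algebra_simps)
  qed
  finally show ?thesis .
qed

end

subsection \<open>Scalar inequalities\<close>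

text \<open>Compared with its value 1 at the origin, this monotone function yields second-order
  bounds for exp(s) (1 - s) on either side of 0.\<close>

lemma exp_one_minus_antimono:
  fixes s r :: real
  assumes "s \<le> r"
  shows "exp r * (1 - r) + r\<^sup>2 / 2 \<le> exp s * (1 - s) + s\<^sup>2 / 2"
proof (rule DERIV_nonpos_imp_nonincreasing[OF assms])
  fix x :: real
  have "((\<lambda>x. exp x * (1 - x) + x\<^sup>2 / 2) has_real_derivative x * (1 - exp x)) (at x)"
    by (auto intro!: derivative_eq_intros simp: algebra_simps)
  moreover have "x * (1 - exp x) \<le> 0"
    by (cases "0 \<le> x") (auto simp: mult_nonneg_nonpos mult_nonpos_nonneg)
  ultimately show "\<exists>y. ((\<lambda>x. exp x * (1 - x) + x\<^sup>2 / 2) has_real_derivative y) (at x) \<and> y \<le> 0" by blast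
qed

lemma exp_quadratic_lower: "0 \<le> (s::real) \<Longrightarrow> 1 + s + s\<^sup>2 / 2 \<le> exp s"
  using exp_lower_Taylor_quadratic[of s] by simp

lemma exp_minus_quadratic_upper:
  fixes s :: real
  assumes "0 \<le> s"
  shows "exp (- s) \<le> 1 - s + s\<^sup>2 / 2"
proof -
  have "1 - 0 + 0\<^sup>2 / 2 - exp (- 0) \<le> 1 - s + s\<^sup>2 / 2 - exp (- s)"
  proof (rule DERIV_nonneg_imp_nondecreasing[OF assms])
    fix x :: real
    have "((\<lambda>x. 1 - x + x\<^sup>2 / 2 - exp (- x)) has_real_derivative (x - 1 + exp (- x))) (at x)"
      by (auto intro!: derivative_eq_intros)
    moreover have "0 \<le> x - 1 + exp (- x)" using exp_ge_add_one_self[of "- x"] by simp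
    ultimately show "\<exists>y. ((\<lambda>x. 1 - x + x\<^sup>2 / 2 - exp (- x)) has_real_derivative y) (at x) \<and> 0 \<le> y"
      by blast
  qed
  then show ?thesis by simp
qed

text \<open>In the next two lemmas the left side is nonincreasing in \<open>w \<le> 1\<close>, so \<open>w\<close> may be
  replaced by its lower bound \<open>u\<close>, which will be centred.\<close>

lemma bennett_upper:
  fixes t u w :: real
  assumes t: "0 < t" "t < 1" and uw: "u \<le> w" "w \<le> 1" and u: "u \<le> 1"
  shows "1 - exp (t * w) + (t - t\<^sup>2) * w * exp (t * w) \<le> - t\<^sup>2 * u + t\<^sup>2 / 2 * u\<^sup>2"
proof -
  define G where "G x = 1 - exp (t * x) + (t - t\<^sup>2) * x * exp (t * x)" for x
  have "G w \<le> G u"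
  proof (rule DERIV_nonpos_imp_nonincreasing[OF uw(1)])
    fix x assume "u \<le> x" "x \<le> w"
    then have x: "x \<le> 1" using uw by simp
    have "(G has_real_derivative exp (t * x) * (t\<^sup>2 * ((1 - t) * x - 1))) (at x)"
      unfolding G_def by (auto intro!: derivative_eq_intros simp: algebra_simps power2_eq_square)
    moreover have "(1 - t) * x - 1 \<le> 0"
      using mult_left_mono[OF x, of "1 - t"] t unfolding mult_1_right by linarith
    then have "exp (t * x) * (t\<^sup>2 * ((1 - t) * x - 1)) \<le> 0" by (intro mult_nonneg_nonpos) auto
    ultimately show "\<exists>y. (G has_real_derivative y) (at x) \<and> y \<le> 0" by blast
  qed
  also have "G u \<le> - t\<^sup>2 * u + t\<^sup>2 / 2 * u\<^sup>2"
  proof -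
    define s where "s = t * u"
    have st: "s \<le> t" unfolding s_def using u t by simp
    \<comment> \<open>For s \<ge> 0, replacing 1 - t by the larger 1 - s reduces the claim to exp(s)
      (1 - s + s^2) \<ge> 1 + s^2 / 2, which the quadratic lower bound for exp gives. For s < 0,
      replacing 1 - t by 1 is enough.\<close>
    have key: "(1 - exp s + s) + (1 - t) * (s * (exp s - 1)) \<le> s\<^sup>2 / 2"
    proof (cases "0 \<le> s")
      case True
      have "(1 - t) * (s * (exp s - 1)) \<le> (1 - s) * (s * (exp s - 1))"
        using st True by (intro mult_right_mono) auto
      moreover have "(1 + s + s\<^sup>2 / 2) * (1 - s + s\<^sup>2) \<le> exp s * (1 - s + s\<^sup>2)"
        using exp_quadratic_lower[OF True] st t by (intro mult_right_mono) auto
      moreover have "(1 + s + s\<^sup>2 / 2) * (1 - s + s\<^sup>2) = 1 + s\<^sup>2 / 2 + s ^ 3 / 2 + s ^ 4 / 2"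
        by (simp add: algebra_simps power2_eq_square power3_eq_cube power4_eq_xxxx
            add_divide_distrib diff_divide_distrib)
      moreover have "0 \<le> s ^ 3" "0 \<le> s ^ 4" using True by auto
      moreover have "(1 - s) * (s * (exp s - 1)) = s * exp s - s - s\<^sup>2 * exp s + s\<^sup>2"
        by (simp add: algebra_simps power2_eq_square)
      moreover have "exp s * (1 - s + s\<^sup>2) = exp s - s * exp s + s\<^sup>2 * exp s"
        by (simp add: algebra_simps)
      ultimately show ?thesis by linarith
    next
      case False
      then have "0 \<le> s * (exp s - 1)" by (intro mult_nonpos_nonpos) auto
      then have "(1 - t) * (s * (exp s - 1)) \<le> 1 * (s * (exp s - 1))" using t by (intro mult_right_mono) auto
      moreover have "1 \<le> exp s * (1 - s) + s\<^sup>2 / 2" using exp_one_minus_antimono[of s 0] False by simp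
      ultimately show ?thesis by (simp add: algebra_simps)
    qed
    have "G u = (1 - exp s + s) + (1 - t) * (s * (exp s - 1)) - t * s"
      unfolding G_def s_def by (simp add: algebra_simps power2_eq_square)
    then show ?thesis using key unfolding s_def by (simp add: algebra_simps power2_eq_square)
  qed
  finally show ?thesis unfolding G_def .
qed

lemma bennett_lower:
  fixes t u w :: real
  assumes t: "0 < t" "t < 1/2" and uw: "u \<le> w" "w \<le> 1" and u: "\<bar>u\<bar> \<le> 1"
  shows "1 - exp (- (t * w)) - t / (1 - t) * w * exp (- (t * w))
    \<le> - t\<^sup>2 / (1 - t) * u + t\<^sup>2 / 2 * (1 + 2 * t) / (1 - t) * u\<^sup>2"
proof -
  define G where "G x = (1 - t) * (1 - exp (- (t * x))) - t * x * exp (- (t * x))" for x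
  have "G w \<le> G u"
  proof (rule DERIV_nonpos_imp_nonincreasing[OF uw(1)])
    fix x assume "u \<le> x" "x \<le> w"
    then have x: "x \<le> 1" using uw by simp
    have "(G has_real_derivative exp (- (t * x)) * (t\<^sup>2 * (x - 1))) (at x)"
      unfolding G_def by (auto intro!: derivative_eq_intros simp: algebra_simps power2_eq_square)
    moreover have "exp (- (t * x)) * (t\<^sup>2 * (x - 1)) \<le> 0" using x by (intro mult_nonneg_nonpos) auto
    ultimately show "\<exists>y. (G has_real_derivative y) (at x) \<and> y \<le> 0" by blast
  qed
  also have "G u \<le> - t\<^sup>2 * u + t\<^sup>2 / 2 * (1 + 2 * t) * u\<^sup>2"
  proof -
    define s where "s = t * u"
    define p where "p = exp (- s) - 1 + s"
    have "\<bar>s\<bar> \<le> t * 1" unfolding s_def abs_mult using u t by (intro mult_mono) auto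
    then have st: "- t \<le> s" "s \<le> t" by (auto simp: abs_le_iff)
    have key: "1 - exp (- s) * (1 + s) + t * p \<le> s\<^sup>2 / 2 + t * s\<^sup>2"
    proof (cases "0 \<le> s")
      case True
      have a: "1 \<le> exp (- s) * (1 + s) + s\<^sup>2 / 2" using exp_one_minus_antimono[of "- s" 0] True by simp
      have "p \<le> s\<^sup>2 / 2" unfolding p_def using exp_minus_quadratic_upper[OF True] by simp
      then have "t * p \<le> t * (s\<^sup>2 / 2)" using t by (intro mult_left_mono) auto
      also have "\<dots> \<le> t * s\<^sup>2" using t by (intro mult_left_mono) auto
      finally show ?thesis using a by linarith
    next
      case False
      define r where "r = - s"
      have r: "0 \<le> r" "r \<le> t" unfolding r_def using False st by auto
      have p: "p = exp r - 1 - r" unfolding p_def r_def by simp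
      have "r\<^sup>2 / 2 \<le> p" unfolding p using exp_quadratic_lower[OF r(1)] by simp
      \<comment> \<open>The coefficient 1 - r - t is nonnegative because r \<le> t < 1/2; this is
        where the range of t is used.\<close>
      then have "(1 - r - t) * (r\<^sup>2 / 2) \<le> (1 - r - t) * p" using r t by (intro mult_left_mono) auto
      then have "r\<^sup>2 / 2 - r * (r\<^sup>2 / 2) - t * (r\<^sup>2 / 2) \<le> p - r * p - t * p"
        by (simp add: algebra_simps add_divide_distrib diff_divide_distrib)
      moreover have "r * (r\<^sup>2 / 2) \<le> t * (r\<^sup>2 / 2)" using r by (intro mult_right_mono) auto
      moreover have "1 - exp (- s) * (1 + s) = r * p + r\<^sup>2 - p"
        unfolding p r_def by (simp add: algebra_simps power2_eq_square)
      moreover have "s\<^sup>2 = r\<^sup>2" "t * s\<^sup>2 = t * r\<^sup>2" unfolding r_def by simp_all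
      moreover have "t * (r\<^sup>2 / 2) = t * r\<^sup>2 / 2" by simp
      ultimately show ?thesis by linarith
    qed
    have "G u = 1 - exp (- s) * (1 + s) + t * p - t * s"
      unfolding G_def s_def p_def by (simp add: algebra_simps)
    then show ?thesis using key unfolding s_def by (simp add: algebra_simps power2_eq_square)
  qed
  finally have "G w / (1 - t) \<le> (- t\<^sup>2 * u + t\<^sup>2 / 2 * (1 + 2 * t) * u\<^sup>2) / (1 - t)"
    using t by (intro divide_right_mono) auto
  moreover have "G w / (1 - t) = 1 - exp (- (t * w)) - t / (1 - t) * w * exp (- (t * w))"
    unfolding G_def using t by (simp add: diff_divide_distrib)
  ultimately show ?thesis by (simp add: add_divide_distrib diff_divide_distrib)
qed

subsection \<open>Concentration of the norm of a sum\<close>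

text \<open>The bound on \<open>h\<close> holds everywhere, so all integrands on the product space
  are bounded; an almost sure bound reduces to this by truncation. Keeping \<open>h\<close> apart
  from the law N lets centring and rescaling leave the product space unchanged.\<close>

locale iid_vectors = iid_product N I for N :: "'b measure" and I :: "'i set" +
  fixes h :: "'b \<Rightarrow> 'a::real_normed_vector"
  assumes sep: "dual_ball_separable TYPE('a)"
    and h_measurable: "weakly_measurable N h"
    and h_bound: "\<And>z. norm (h z) \<le> 1"
    and h_centred: "\<And>l. l \<in> dual_ball \<Longrightarrow> (\<integral>z. l (h z) \<partial>N) = 0"
begin

lemma h_coord_measurable: "i \<in> I \<Longrightarrow> weakly_measurable Q (\<lambda>y. h (y i))"
  by (rule weakly_measurable_compose[OF h_measurable coord_measurable])

definition Z :: "('i \<Rightarrow> 'b) \<Rightarrow> real" where "Z y = norm (\<Sum>i\<in>I. h (y i))"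
definition Zi :: "'i \<Rightarrow> ('i \<Rightarrow> 'b) \<Rightarrow> real" where "Zi i y = norm (\<Sum>j\<in>I - {i}. h (y j))"

lemma Z_measurable: "Z \<in> borel_measurable Q"
  unfolding Z_def by (intro weakly_measurable_norm[OF sep] weakly_measurable_sum h_coord_measurable)

lemma Zi_measurable: "Zi i \<in> borel_measurable Q"
  unfolding Zi_def by (intro weakly_measurable_norm[OF sep] weakly_measurable_sum h_coord_measurable) auto

lemma norm_sum_h: "norm (\<Sum>j\<in>J. h (y j)) \<le> real (card J)"
  using sum_norm_bound[of J "\<lambda>j. h (y j)" 1] h_bound by simp

lemma Z_bound: "0 \<le> Z y \<and> Z y \<le> real (card I)"
  unfolding Z_def using norm_sum_h by simp

lemma Zi_bound: "0 \<le> Zi i y \<and> Zi i y \<le> real (card I)"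
proof -
  have "real (card (I - {i})) \<le> real (card I)" by (simp add: card_Diff1_le)
  then show ?thesis unfolding Zi_def using norm_sum_h[of y "I - {i}"] by (auto intro: order_trans)
qed

sublocale Z: bounded_variable Q Z "real (card I)"
  by standard (use Z_measurable Z_bound in auto)

lemma Zi_upd: "Zi i (y(i := z)) = Zi i y"
  unfolding Zi_def by (intro arg_cong[where f=norm] sum.cong) auto

lemma Z_upd: "i \<in> I \<Longrightarrow> Z (y(i := z)) = norm ((\<Sum>j\<in>I - {i}. h (y j)) + h z)"
proof -
  assume "i \<in> I"
  then have "(\<Sum>j\<in>I. h ((y(i := z)) j)) = h z + (\<Sum>j\<in>I - {i}. h ((y(i := z)) j))"
    by (subst sum.remove[OF finite_I]) auto
  also have "(\<Sum>j\<in>I - {i}. h ((y(i := z)) j)) = (\<Sum>j\<in>I - {i}. h (y j))" by (intro sum.cong) auto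
  finally show ?thesis unfolding Z_def by (simp add: add.commute)
qed

text \<open>Each vector occurs in n - 1 of the n leave-one-out sums, so these add up to n - 1 copies
  of the full sum, and the triangle inequality gives (n - 1) Z \<le> sum of the
  \<open>Zi\<close>.\<close>

lemma sum_Z_diff: "(\<Sum>i\<in>I. Z y - Zi i y) \<le> Z y"
proof (cases "I = {}")
  case True then show ?thesis using Z_bound[of y] by simp
next
  case False
  define n where "n = card I"
  have n: "1 \<le> n" unfolding n_def using False finite_I by (simp add: Suc_leI card_gt_0_iff)
  have "(\<Sum>i\<in>I. \<Sum>j\<in>I - {i}. h (y j)) = (\<Sum>i\<in>I. (\<Sum>j\<in>I. h (y j)) - h (y i))"
    by (intro sum.cong refl) (simp add: sum_diff1[OF finite_I])
  also have "\<dots> = (real n - 1) *\<^sub>R (\<Sum>j\<in>I. h (y j))"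
    by (simp add: sum_subtractf n_def algebra_simps sum_constant_scaleR)
  finally have "(real n - 1) * Z y = norm (\<Sum>i\<in>I. \<Sum>j\<in>I - {i}. h (y j))"
    unfolding Z_def using n by simp
  also have "\<dots> \<le> (\<Sum>i\<in>I. Zi i y)" unfolding Zi_def by (rule norm_sum)
  finally show ?thesis by (simp add: sum_subtractf n_def algebra_simps)
qed

definition W :: "'a \<Rightarrow> 'b \<Rightarrow> real" where "W v z = norm (v + h z) - norm v"

lemma W_measurable: "W v \<in> borel_measurable N"
  unfolding W_def
  by (intro borel_measurable_diff weakly_measurable_norm[OF sep] weakly_measurable_add
      weakly_measurable_const h_measurable)

lemma W_bound: "\<bar>W v z\<bar> \<le> 1"
proof -
  have "\<bar>norm (v + h z) - norm v\<bar> \<le> norm (v + h z - v)" by (rule norm_triangle_ineq3)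
  then show ?thesis unfolding W_def using h_bound[of z] by simp
qed

text \<open>The functional is selected from \<open>v\<close> alone and does not move with
  \<open>z\<close>; its value at \<open>h z\<close> is therefore centred, with second moment
  controlled by the weak variance.\<close>

lemma W_lower:
  obtains l where "l \<in> dual_ball" "\<And>z. l (h z) \<le> W v z"
proof -
  obtain l where l: "l \<in> dual_ball" "l v = norm v" by (rule norming_functional)
  have "l (h z) \<le> W v z" for z
    using dual_ball_le[OF l(1), of "v + h z"] l(2) linear_add[OF dual_ball_linear[OF l(1)], of v "h z"]
    unfolding W_def by simp
  then show thesis using that l by blast
qed

lemma lh_facts:
  assumes "l \<in> dual_ball"
  shows "(\<lambda>z. l (h z)) \<in> borel_measurable N" "\<bar>l (h z)\<bar> \<le> 1" "integrable N (\<lambda>z. l (h z))"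
    "integrable N (\<lambda>z. (l (h z))\<^sup>2)"
proof -
  show m: "(\<lambda>z. l (h z)) \<in> borel_measurable N" using h_measurable assms unfolding weakly_measurable_def by auto
  show b: "\<bar>l (h z)\<bar> \<le> 1" for z using dual_ball_abs[OF assms, of "h z"] h_bound[of z] by linarith
  show "integrable N (\<lambda>z. l (h z))" by (rule N.bounded_integrable[OF m b])
  have "(l (h z))\<^sup>2 \<le> 1" for z using b[of z] by (simp add: abs_square_le_1)
  then show "integrable N (\<lambda>z. (l (h z))\<^sup>2)" using m by (intro N.bounded_integrable[where B=1]) auto
qed

lemma W_exp_integrable: "integrable N (\<lambda>z. exp (t * W v z))"
  and W_W_exp_integrable: "integrable N (\<lambda>z. W v z * exp (t * W v z))"
  and W_integrable: "integrable N (W v)"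
proof -
  note [measurable] = W_measurable[of v]
  have e: "exp (t * W v z) \<le> exp \<bar>t\<bar>" for z
  proof -
    have "\<bar>t * W v z\<bar> \<le> \<bar>t\<bar> * 1" unfolding abs_mult using W_bound[of v z] by (intro mult_mono) auto
    then show ?thesis by (simp add: abs_le_iff)
  qed
  show "integrable N (\<lambda>z. exp (t * W v z))"
    by (rule N.bounded_integrable[where B="exp \<bar>t\<bar>"]) (use e in auto)
  show "integrable N (\<lambda>z. W v z * exp (t * W v z))"
  proof (rule N.bounded_integrable[where B="1 * exp \<bar>t\<bar>"])
    show "\<bar>W v z * exp (t * W v z)\<bar> \<le> 1 * exp \<bar>t\<bar>" for z
      unfolding abs_mult using W_bound[of v z] e[of z] by (intro mult_mono) auto
  qed auto
  show "integrable N (W v)" by (rule N.bounded_integrable[where B=1]) (use W_bound in auto)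
qed

text \<open>Jensen's inequality for the norm, obtained by integrating a scalar minorant instead of a
  vector.\<close>

lemma norm_le_resampled: "norm v \<le> (\<integral>z. norm (v + h z) \<partial>N)"
proof -
  obtain l where l: "l \<in> dual_ball" "\<And>z. l (h z) \<le> W v z" using W_lower by blast
  have "0 \<le> (\<integral>z. W v z \<partial>N)"
    using integral_mono[OF lh_facts(3)[OF l(1)] W_integrable[of v] l(2)] h_centred[OF l(1)] by simp
  also have "\<dots> = (\<integral>z. norm (v + h z) \<partial>N) - norm v"
  proof -
    have "integrable N (\<lambda>z. W v z + norm v)" using W_integrable[of v] by simp
    then have "integrable N (\<lambda>z. norm (v + h z))" unfolding W_def by simp
    then show ?thesis unfolding W_def by (simp add: N.prob_space)
  qed
  finally show ?thesis by simp
qed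

text \<open>Reduces the entropy bound to the inequality \<open>step\<close> for one increment. The
  terms b W exp(t W), collected over the coordinates, are controlled by \<open>sum_Z_diff\<close>
  and become b Z exp(t Z), whose mean is b times \<open>Z.mgf' t\<close>.\<close>

lemma entropy_Z:
  assumes step: "\<And>v. (\<integral>z. exp (t * W v z) * (t * W v z - 1 + exp (- (t * W v z))) \<partial>N)
      \<le> A * (\<integral>z. exp (t * W v z) \<partial>N) + b * (\<integral>z. W v z * exp (t * W v z) \<partial>N)"
    and b: "0 \<le> b"
  shows "Z.entropy_exp t \<le> real (card I) * A * Z.mgf t + b * Z.mgf' t"
proof -
  note [measurable] = Z_measurable Zi_measurable
  define D where "D i y = Z y - Zi i y" for i y
  define E where "E i y = exp (t * Z y) * (t * D i y - 1 + exp (- (t * D i y)))" for i y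
  have Db: "\<bar>D i y\<bar> \<le> real (card I)" for i y unfolding D_def using Z_bound[of y] Zi_bound[of i y] by linarith
  have eb: "exp (t * Z y) \<le> exp (\<bar>t\<bar> * real (card I))" if "y \<in> space Q" for y
    using Z.exp_tH_bound[OF that] by simp
  have bexp: "\<bar>exp (t * Z y) * r\<bar> \<le> exp (\<bar>t\<bar> * real (card I)) * R" if "y \<in> space Q" "\<bar>r\<bar> \<le> R" for r R y
    unfolding abs_mult using eb[OF that(1)] that(2) by (intro mult_mono) auto
  have tD: "\<bar>t * D i y\<bar> \<le> \<bar>t\<bar> * real (card I)" for i y
    unfolding abs_mult using Db[of i y] by (intro mult_left_mono) auto
  define R where "R = \<bar>t\<bar> * real (card I) + 1 + exp (\<bar>t\<bar> * real (card I))"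
  have psib: "\<bar>t * D i y - 1 + exp (- (t * D i y))\<bar> \<le> R" for i y
  proof -
    have "exp (- (t * D i y)) \<le> exp (\<bar>t\<bar> * real (card I))" using tD[of i y] by (simp add: abs_le_iff)
    moreover have "0 < exp (- (t * D i y))" by simp
    ultimately show ?thesis unfolding R_def using tD[of i y] by linarith
  qed
  have m [measurable]: "D i \<in> borel_measurable Q" "E i \<in> borel_measurable Q" for i
    unfolding D_def E_def by measurable
  have iE: "integrable Q (E i)" for i
    by (rule Q.bounded_integrable[OF m(2)], unfold E_def, rule bexp) (use psib in auto)
  have iD: "integrable Q (\<lambda>y. exp (t * Z y) * D i y)" for i
    by (rule Q.bounded_integrable, measurable, rule bexp) (use Db in auto)
  have ie: "integrable Q (\<lambda>y. exp (t * Z y))" by (rule Z.mgf_integrable)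
  have one: "(\<integral>y. E i y \<partial>Q) \<le> A * Z.mgf t + b * (\<integral>y. exp (t * Z y) * D i y \<partial>Q)" if i: "i \<in> I" for i
  proof -
    \<comment> \<open>Difference of the two sides of \<open>step\<close>, tilted by exp(t Z). With
      the other coordinates frozen, exp(t norm v) factors out of the resampled mean.\<close>
    define G where "G y = exp (t * Z y) * ((t * D i y - 1 + exp (- (t * D i y))) - A - b * D i y)" for y
    have "(\<integral>y. G y \<partial>Q) \<le> 0"
    proof (rule resample_nonpos[OF i])
      show "G \<in> borel_measurable Q" unfolding G_def by measurable
      show "\<bar>G y\<bar> \<le> exp (\<bar>t\<bar> * real (card I)) * (R + \<bar>A\<bar> + b * real (card I))" if "y \<in> space Q" for y
        unfolding G_def
      proof (rule bexp[OF that])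
        have "\<bar>b * D i y\<bar> \<le> b * real (card I)" unfolding abs_mult using b Db[of i y] by (intro mult_mono) auto
        then show "\<bar>t * D i y - 1 + exp (- (t * D i y)) - A - b * D i y\<bar> \<le> R + \<bar>A\<bar> + b * real (card I)"
          using psib[of i y] by linarith
      qed
      fix y assume y: "y \<in> space Q"
      define v where "v = (\<Sum>j\<in>I - {i}. h (y j))"
      have Dv: "D i (y(i := z)) = W v z" for z
        unfolding D_def Zi_upd Z_upd[OF i] unfolding W_def v_def Zi_def ..
      have Zv: "Z (y(i := z)) = norm v + W v z" for z unfolding Z_upd[OF i] W_def v_def by simp
      have i1: "integrable N (\<lambda>z. exp (t * W v z) * (t * W v z - 1 + exp (- (t * W v z))))"
      proof -
        have "exp (t * W v z) * (t * W v z - 1 + exp (- (t * W v z)))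
            = t * (W v z * exp (t * W v z)) - exp (t * W v z) + 1" for z
          by (simp add: algebra_simps exp_minus)
        then show ?thesis using W_exp_integrable[of t v] W_W_exp_integrable[of v t] by simp
      qed
      have "(\<integral>z. G (y(i := z)) \<partial>N) = (\<integral>z. exp (t * norm v) *
          (exp (t * W v z) * (t * W v z - 1 + exp (- (t * W v z))) - A * exp (t * W v z)
            - b * (W v z * exp (t * W v z))) \<partial>N)"
        unfolding G_def Dv Zv by (intro Bochner_Integration.integral_cong refl)
          (simp add: distrib_left exp_add algebra_simps)
      also have "\<dots> = exp (t * norm v) *
          ((\<integral>z. exp (t * W v z) * (t * W v z - 1 + exp (- (t * W v z))) \<partial>N) - A * (\<integral>z. exp (t * W v z) \<partial>N)
            - b * (\<integral>z. W v z * exp (t * W v z) \<partial>N))"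
        using i1 W_exp_integrable[of t v] W_W_exp_integrable[of v t] by simp
      also have "\<dots> \<le> 0" using step[of v] by (intro mult_nonneg_nonpos) auto
      finally show "(\<integral>z. G (y(i := z)) \<partial>N) \<le> 0" .
    qed
    moreover have "(\<integral>y. G y \<partial>Q) = (\<integral>y. E i y - A * exp (t * Z y) - b * (exp (t * Z y) * D i y) \<partial>Q)"
      unfolding G_def E_def by (intro Bochner_Integration.integral_cong refl) (simp add: algebra_simps)
    ultimately show ?thesis using iE[of i] ie iD[of i] unfolding Z.mgf_def by simp
  qed
  have "Z.entropy_exp t \<le> (\<Sum>i\<in>I. \<integral>y. E i y \<partial>Q)"
    unfolding E_def D_def
    by (rule entropy_leave_one_out[OF Z.bounded_variable_axioms]) (use Zi_measurable Zi_bound Zi_upd in auto)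
  also have "\<dots> \<le> (\<Sum>i\<in>I. A * Z.mgf t + b * (\<integral>y. exp (t * Z y) * D i y \<partial>Q))"
    by (intro sum_mono one)
  also have "\<dots> = real (card I) * A * Z.mgf t + b * (\<integral>y. (\<Sum>i\<in>I. exp (t * Z y) * D i y) \<partial>Q)"
    using iD by (simp add: sum.distrib sum_distrib_left)
  also have "(\<integral>y. (\<Sum>i\<in>I. exp (t * Z y) * D i y) \<partial>Q) \<le> Z.mgf' t"
    unfolding Z.mgf'_def
  proof (rule integral_mono)
    show "(\<Sum>i\<in>I. exp (t * Z y) * D i y) \<le> Z y * exp (t * Z y)" for y
      using sum_Z_diff[of y] unfolding D_def sum_distrib_left[symmetric]
      by (subst mult.commute) (intro mult_right_mono, auto)
  qed (use iD Z.mgf'_integrable in auto)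
  finally show ?thesis using b by (simp add: mult_left_mono)
qed

context
  fixes s2 :: real
  assumes variance: "\<And>l. l \<in> dual_ball \<Longrightarrow> (\<integral>z. (l (h z))\<^sup>2 \<partial>N) \<le> s2"
begin

lemma s2_nonneg: "0 \<le> s2"
proof -
  have "(\<lambda>_. 0) \<in> (dual_ball :: ('a \<Rightarrow> real) set)" unfolding dual_ball_def by (auto intro: linearI)
  from variance[OF this] show ?thesis by simp
qed

text \<open>In \<open>bennett_upper\<close> with u = l(h z) the linear term integrates to 0 and the
  square to at most s2. The constant variance term that remains is charged to the moment generating
  function, because the mean of exp(t W) is at least 1.\<close>

lemma entropy_Z_upper:
  assumes t: "0 < t" "t < 1"
  shows "Z.entropy_exp t \<le> t\<^sup>2 * (real (card I) * s2) / 2 * Z.mgf t + t\<^sup>2 * Z.mgf' t"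
proof -
  have "Z.entropy_exp t \<le> real (card I) * (t\<^sup>2 * s2 / 2) * Z.mgf t + t\<^sup>2 * Z.mgf' t"
  proof (rule entropy_Z)
    fix v
    obtain l where l: "l \<in> dual_ball" "\<And>z. l (h z) \<le> W v z" using W_lower by blast
    note lh = lh_facts[OF l(1)]
    have ge1: "1 \<le> (\<integral>z. exp (t * W v z) \<partial>N)"
    proof -
      have "1 = (\<integral>z. 1 + t * l (h z) \<partial>N)" using lh(3) h_centred[OF l(1)] by (simp add: N.prob_space)
      also have "\<dots> \<le> (\<integral>z. exp (t * W v z) \<partial>N)"
      proof (rule integral_mono)
        fix z
        have "1 + t * l (h z) \<le> 1 + t * W v z" using l(2)[of z] t by simp
        also have "\<dots> \<le> exp (t * W v z)" by simp
        finally show "1 + t * l (h z) \<le> exp (t * W v z)" .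
      qed (use lh(3) W_exp_integrable in auto)
      finally show ?thesis .
    qed
    have "(\<integral>z. exp (t * W v z) * (t * W v z - 1 + exp (- (t * W v z))) \<partial>N) - t\<^sup>2 * (\<integral>z. W v z * exp (t * W v z) \<partial>N)
        = (\<integral>z. 1 - exp (t * W v z) + t * (W v z * exp (t * W v z)) - t\<^sup>2 * (W v z * exp (t * W v z)) \<partial>N)"
    proof -
      have e: "exp (t * W v z) * (t * W v z - 1 + exp (- (t * W v z)))
          = 1 - exp (t * W v z) + t * (W v z * exp (t * W v z))" for z
        by (simp add: algebra_simps exp_minus)
      show ?thesis unfolding e using W_exp_integrable[of t v] W_W_exp_integrable[of v t] by simp
    qed
    also have "\<dots> \<le> (\<integral>z. - t\<^sup>2 * l (h z) + t\<^sup>2 / 2 * (l (h z))\<^sup>2 \<partial>N)"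
    proof (rule integral_mono)
      fix z
      have "W v z \<le> 1" "l (h z) \<le> 1" using W_bound[of v z] lh(2)[of z] by (auto simp: abs_le_iff)
      then show "1 - exp (t * W v z) + t * (W v z * exp (t * W v z)) - t\<^sup>2 * (W v z * exp (t * W v z))
          \<le> - t\<^sup>2 * l (h z) + t\<^sup>2 / 2 * (l (h z))\<^sup>2"
        using bennett_upper[OF t l(2)] by (simp add: algebra_simps)
    qed (use W_exp_integrable[of t v] W_W_exp_integrable[of v t] lh in auto)
    also have "\<dots> = t\<^sup>2 / 2 * (\<integral>z. (l (h z))\<^sup>2 \<partial>N)" using lh h_centred[OF l(1)] by simp
    also have "\<dots> \<le> t\<^sup>2 / 2 * s2" using variance[OF l(1)] by (intro mult_left_mono) auto
    also have "\<dots> \<le> t\<^sup>2 * s2 / 2 * (\<integral>z. exp (t * W v z) \<partial>N)"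
      using mult_left_mono[OF ge1, of "t\<^sup>2 * s2 / 2"] s2_nonneg by simp
    finally show "(\<integral>z. exp (t * W v z) * (t * W v z - 1 + exp (- (t * W v z))) \<partial>N)
        \<le> t\<^sup>2 * s2 / 2 * (\<integral>z. exp (t * W v z) \<partial>N) + t\<^sup>2 * (\<integral>z. W v z * exp (t * W v z) \<partial>N)"
      by linarith
  qed simp
  then show ?thesis by (simp add: ac_simps)
qed

lemma entropy_Z_lower:
  assumes t: "0 < t" "t < 1/2"
  shows "Z.entropy_exp (- t) \<le> exp t * (t\<^sup>2 / 2 * (1 + 2 * t) / (1 - t)) * (real (card I) * s2) * Z.mgf (- t)
    + t\<^sup>2 / (1 - t) * Z.mgf' (- t)"
proof -
  define \<alpha> where "\<alpha> = t\<^sup>2 / 2 * (1 + 2 * t) / (1 - t)"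
  define \<beta> where "\<beta> = t\<^sup>2 / (1 - t)"
  have \<alpha>: "0 \<le> \<alpha>" unfolding \<alpha>_def using t by simp
  have \<beta>: "t / (1 - t) = t + \<beta>" unfolding \<beta>_def using t by (simp add: field_simps power2_eq_square)
  have "Z.entropy_exp (- t) \<le> real (card I) * (exp t * \<alpha> * s2) * Z.mgf (- t) + \<beta> * Z.mgf' (- t)"
  proof (rule entropy_Z)
    fix v
    obtain l where l: "l \<in> dual_ball" "\<And>z. l (h z) \<le> W v z" using W_lower by blast
    note lh = lh_facts[OF l(1)]
    note ints = W_exp_integrable[of "- t" v] W_W_exp_integrable[of v "- t"]
    \<comment> \<open>For a negative tilt W \<le> 1 gives only the lower bound exp(-t) for the mean.
      The compensating factor exp(t) is the one appearing in the hypothesis of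
      \<open>herbst_lower\<close>.\<close>
    have ge1: "1 \<le> exp t * (\<integral>z. exp (- t * W v z) \<partial>N)"
    proof -
      have "exp (- t) \<le> (\<integral>z. exp (- t * W v z) \<partial>N)"
      proof (rule N.integral_ge_const[OF ints(1)], rule AE_I2)
        fix z
        have "t * W v z \<le> t * 1" using W_bound[of v z] t by (intro mult_left_mono) (auto simp: abs_le_iff)
        then show "exp (- t) \<le> exp (- t * W v z)" by simp
      qed
      then have "exp t * exp (- t) \<le> exp t * (\<integral>z. exp (- t * W v z) \<partial>N)" by (intro mult_left_mono) auto
      then show ?thesis by (simp add: exp_minus)
    qed
    have "(\<integral>z. exp (- t * W v z) * (- t * W v z - 1 + exp (- (- t * W v z))) \<partial>N) - \<beta> * (\<integral>z. W v z * exp (- t * W v z) \<partial>N)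
        = (\<integral>z. 1 - exp (- t * W v z) - t * (W v z * exp (- t * W v z)) - \<beta> * (W v z * exp (- t * W v z)) \<partial>N)"
    proof -
      have e: "exp (- t * W v z) * (- t * W v z - 1 + exp (- (- t * W v z)))
          = 1 - exp (- t * W v z) - t * (W v z * exp (- t * W v z))" for z
        by (simp add: algebra_simps exp_minus)
      show ?thesis unfolding e using ints by simp
    qed
    also have "\<dots> \<le> (\<integral>z. - \<beta> * l (h z) + \<alpha> * (l (h z))\<^sup>2 \<partial>N)"
    proof (rule integral_mono)
      fix z
      have "W v z \<le> 1" using W_bound[of v z] by (auto simp: abs_le_iff)
      note bennett_lower[OF t l(2) this lh(2), folded \<alpha>_def]
      moreover have "- t\<^sup>2 / (1 - t) * l (h z) = - \<beta> * l (h z)" unfolding \<beta>_def by simp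
      moreover have "t / (1 - t) * W v z * exp (- (t * W v z))
          = t * (W v z * exp (- t * W v z)) + \<beta> * (W v z * exp (- t * W v z))"
        unfolding \<beta> by (simp add: algebra_simps)
      ultimately show "1 - exp (- t * W v z) - t * (W v z * exp (- t * W v z)) - \<beta> * (W v z * exp (- t * W v z))
          \<le> - \<beta> * l (h z) + \<alpha> * (l (h z))\<^sup>2"
        by simp
    qed (use ints lh in auto)
    also have "\<dots> = \<alpha> * (\<integral>z. (l (h z))\<^sup>2 \<partial>N)" using lh h_centred[OF l(1)] by simp
    also have "\<dots> \<le> \<alpha> * s2" using variance[OF l(1)] \<alpha> by (intro mult_left_mono)
    also have "\<dots> \<le> exp t * \<alpha> * s2 * (\<integral>z. exp (- t * W v z) \<partial>N)"
      using mult_left_mono[OF ge1, of "\<alpha> * s2"] s2_nonneg \<alpha> by (simp add: ac_simps)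
    finally show "(\<integral>z. exp (- t * W v z) * (- t * W v z - 1 + exp (- (- t * W v z))) \<partial>N)
        \<le> exp t * \<alpha> * s2 * (\<integral>z. exp (- t * W v z) \<partial>N) + \<beta> * (\<integral>z. W v z * exp (- t * W v z) \<partial>N)"
      by linarith
  qed (use t in \<open>simp add: \<beta>_def\<close>)
  then show ?thesis unfolding \<alpha>_def[symmetric] \<beta>_def[symmetric] by (simp add: ac_simps)
qed

lemma Z_upper_tail:
  assumes x: "0 < x"
  defines "m \<equiv> \<integral>y. Z y \<partial>Q"
  shows "Q.prob {y \<in> space Q. m + sqrt (2 * (real (card I) * s2 + 2 * m) * x) + x < Z y} \<le> exp (- x)"
  unfolding m_def by (rule Z.upper_tail[OF entropy_Z_upper _ x]) (use s2_nonneg in auto)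

lemma Z_lower_tail:
  assumes x: "0 < x"
  defines "m \<equiv> \<integral>y. Z y \<partial>Q"
  shows "Q.prob {y \<in> space Q. Z y < m - sqrt (2 * (real (card I) * s2 + 2 * m) * x) - 2 * x} \<le> exp (- x)"
  unfolding m_def by (rule Z.lower_tail[OF entropy_Z_lower _ x]) (use s2_nonneg in auto)

end

end

subsection \<open>Concentration of the exchangeable multiplier average\<close>

lemma exp_minus_chord: "\<lbrakk>0 \<le> (a::real); a \<le> 1\<rbrakk> \<Longrightarrow> exp (t * a) - 1 - t * a \<le> (exp t - 1 - t) * a"
proof -
  assume a: "0 \<le> a" "a \<le> 1"
  have "exp (1 * ((1 - a) *\<^sub>R 0 + a *\<^sub>R t)) \<le> (1 - a) * exp (1 * 0) + a * exp (1 * t)"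
    by (rule convex_onD[OF convex_on_exp]) (use a in auto)
  then show ?thesis by (simp add: algebra_simps)
qed

text \<open>From e^2 \<le> 8 follows exp(2/3) \<le> 2, so exp lies below the chord 1 + 3 s / 2 on
  [0, 2/3], and integrating the chord gives 3/4. The pair (2/3, 3/4) is chosen for 3/4 * 2/3 * 2 = 1
  in \<open>entropy_H_upper\<close>.\<close>

lemma exp_two_thirds_quadratic:
  fixes x :: real
  assumes "\<bar>x\<bar> \<le> 2/3"
  shows "x - 1 + exp (- x) \<le> 3/4 * x\<^sup>2"
proof (cases "0 \<le> x")
  case True
  then have "exp (- x) \<le> 1 - x + x\<^sup>2 / 2" by (rule exp_minus_quadratic_upper)
  then show ?thesis using zero_le_power2[of x] by linarith
next
  case False
  define r where "r = - x"
  have r: "0 \<le> r" "r \<le> 2/3" unfolding r_def using False assms by auto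
  have e2: "exp (2/3) \<le> (2::real)"
  proof -
    have "exp (2/3) ^ 3 = exp (2::real)" by (simp add: exp_of_nat_mult[symmetric])
    also have "\<dots> = exp 1 ^ 2" by (simp add: exp_of_nat_mult[symmetric])
    also have "\<dots> \<le> (272/100)\<^sup>2" using e_less_272 by (intro power_mono) auto
    also have "\<dots> \<le> (2::real) ^ 3" by (simp add: power2_eq_square)
    finally show ?thesis using power_mono_iff[of "exp (2/3::real)" 2 3] by simp
  qed
  have e: "exp s \<le> 1 + 3/2 * s" if "0 \<le> s" "s \<le> 2/3" for s :: real
  proof -
    have "exp (2/3 * (3/2 * s)) - 1 - 2/3 * (3/2 * s) \<le> (exp (2/3) - 1 - 2/3) * (3/2 * s)"
      by (rule exp_minus_chord) (use that in auto)
    also have "\<dots> \<le> (2 - 1 - 2/3) * (3/2 * s)" using e2 that by (intro mult_right_mono) auto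
    finally show ?thesis by simp
  qed
  have "1 + 0 + 3/4 * 0\<^sup>2 - exp 0 \<le> 1 + r + 3/4 * r\<^sup>2 - exp r"
  proof (rule DERIV_nonneg_imp_nondecreasing[OF r(1)])
    fix x :: real assume "0 \<le> x" "x \<le> r"
    then have "0 \<le> 1 + 3/2 * x - exp x" using e[of x] r by simp
    moreover have "((\<lambda>x. 1 + x + 3/4 * x\<^sup>2 - exp x) has_real_derivative (1 + 3/2 * x - exp x)) (at x)"
      by (auto intro!: derivative_eq_intros)
    ultimately show "\<exists>y. ((\<lambda>x. 1 + x + 3/4 * x\<^sup>2 - exp x) has_real_derivative y) (at x) \<and> 0 \<le> y" by blast
  qed
  then show ?thesis unfolding r_def by simp
qed

text \<open>The 2 accounts for the deficits of \<open>fT\<close> summing to 2 \<open>f\<close>; the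
  right side is the coefficient that \<open>lower_tail_no_variance\<close> accepts.\<close>

lemma exp_remainder_half:
  fixes t :: real
  assumes "0 \<le> t" "t < 1"
  shows "2 * (exp t - 1 - t) \<le> t\<^sup>2 / (1 - t)"
proof -
  have "exp t * (1 - t) + t\<^sup>2 / 2 \<le> 1" using exp_one_minus_antimono[of 0 t] assms by simp
  then have "2 * (exp t - 1 - t) * (1 - t) \<le> t\<^sup>2" by (simp add: algebra_simps power2_eq_square)
  then show ?thesis using assms by (simp add: pos_le_divide_eq)
qed

lemma (in iid_vectors) norm_le_resampled_scaled: "norm v \<le> (\<integral>z. norm (v + c *\<^sub>R h z) \<partial>N)"
proof (cases "c = 0")
  case True then show ?thesis by (simp add: N.prob_space)
next
  case False
  have e: "norm (v + c *\<^sub>R h z) = \<bar>c\<bar> * norm ((1 / c) *\<^sub>R v + h z)" for z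
  proof -
    have "v + c *\<^sub>R h z = c *\<^sub>R ((1 / c) *\<^sub>R v + h z)" using False by (simp add: scaleR_add_right)
    then show ?thesis by simp
  qed
  have "norm v = \<bar>c\<bar> * norm ((1 / c) *\<^sub>R v)" using False by simp
  also have "\<dots> \<le> \<bar>c\<bar> * (\<integral>z. norm ((1 / c) *\<^sub>R v + h z) \<partial>N)"
    by (intro mult_left_mono norm_le_resampled) auto
  finally show ?thesis unfolding e by simp
qed

text \<open>Exchangeability enters through transpositions, as invariance of mean norms of weighted
  sums; \<kappa> is left free so that the multipliers can be rescaled.\<close>

locale multipliers = iid_vectors N I h + P: prob_space P
  for N :: "'b measure" and I :: "'i set" and h :: "'b \<Rightarrow> 'a::real_normed_vector" and P :: "'w measure" +
  fixes \<xi> :: "'i \<Rightarrow> 'w \<Rightarrow> real" and \<kappa> :: real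
  assumes \<xi>_integrable: "\<And>i. i \<in> I \<Longrightarrow> integrable P (\<xi> i)"
    and \<xi>_abs: "\<And>i. i \<in> I \<Longrightarrow> (\<integral>\<omega>. \<bar>\<xi> i \<omega>\<bar> \<partial>P) = \<kappa>"
    and \<xi>_sum: "AE \<omega> in P. (\<Sum>i\<in>I. \<xi> i \<omega>) = 0"
    and \<xi>_swap: "\<And>i k (v :: 'i \<Rightarrow> 'a). i \<in> I \<Longrightarrow> k \<in> I \<Longrightarrow>
      (\<integral>\<omega>. norm (\<Sum>j\<in>I. \<xi> (Transposition.transpose i k j) \<omega> *\<^sub>R v j) \<partial>P)
      = (\<integral>\<omega>. norm (\<Sum>j\<in>I. \<xi> j \<omega> *\<^sub>R v j) \<partial>P)"
    and I_nonempty: "I \<noteq> {}"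
begin

definition S :: "('i \<Rightarrow> 'a) \<Rightarrow> 'w \<Rightarrow> 'a" where "S v \<omega> = (\<Sum>j\<in>I. \<xi> j \<omega> *\<^sub>R v j)"

text \<open>Up to the factor \<open>n\<close>, \<open>T i v\<close> averages \<open>S v\<close> over the swaps of \<open>\<xi> i\<close> with every \<open>\<xi> k\<close>;
  it does not depend on \<open>v i\<close>, which makes it a leave-one-out version of \<open>S v\<close>.\<close>

definition T :: "'i \<Rightarrow> ('i \<Rightarrow> 'a) \<Rightarrow> 'w \<Rightarrow> 'a" where
  "T i v \<omega> = (\<Sum>j\<in>I - {i}. ((1 - 1 / real (card I)) * \<xi> j \<omega> + \<xi> i \<omega> / real (card I)) *\<^sub>R v j)"

definition f :: "('i \<Rightarrow> 'a) \<Rightarrow> real" where "f v = (\<integral>\<omega>. norm (S v \<omega>) \<partial>P)"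
definition fT :: "'i \<Rightarrow> ('i \<Rightarrow> 'a) \<Rightarrow> real" where "fT i v = (\<integral>\<omega>. norm (T i v \<omega>) \<partial>P)"

lemma n_pos: "0 < real (card I)"
  using finite_I I_nonempty by (simp add: card_gt_0_iff)

lemma \<kappa>_nonneg: "0 \<le> \<kappa>"
proof -
  obtain i where "i \<in> I" using I_nonempty by blast
  have "0 \<le> (\<integral>\<omega>. \<bar>\<xi> i \<omega>\<bar> \<partial>P)" by simp
  then show ?thesis unfolding \<xi>_abs[OF \<open>i \<in> I\<close>] .
qed

lemma combination_measurable:
  assumes "\<And>j. j \<in> J \<Longrightarrow> a j \<in> borel_measurable P"
  shows "(\<lambda>\<omega>. norm (\<Sum>j\<in>J. a j \<omega> *\<^sub>R (v j :: 'a))) \<in> borel_measurable P"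
  using assms by (intro weakly_measurable_norm[OF sep] weakly_measurable_sum weakly_measurable_scaleR
      weakly_measurable_const)

lemma combination_bound: "norm (\<Sum>j\<in>J. a j *\<^sub>R (v j :: 'a)) \<le> (\<Sum>j\<in>J. \<bar>a j\<bar> * norm (v j))"
  by (rule order_trans[OF norm_sum]) simp

lemma combination_integrable:
  assumes "finite J" "\<And>j. j \<in> J \<Longrightarrow> integrable P (a j)"
  shows "integrable P (\<lambda>\<omega>. norm (\<Sum>j\<in>J. a j \<omega> *\<^sub>R (v j :: 'a)))"
proof (rule Bochner_Integration.integrable_bound)
  show "integrable P (\<lambda>\<omega>. \<Sum>j\<in>J. \<bar>a j \<omega>\<bar> * norm (v j))"
    using assms by (intro Bochner_Integration.integrable_sum integrable_mult_left integrable_abs)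
  show "(\<lambda>\<omega>. norm (\<Sum>j\<in>J. a j \<omega> *\<^sub>R v j)) \<in> borel_measurable P"
    using assms by (intro combination_measurable) auto
  show "AE \<omega> in P. norm (norm (\<Sum>j\<in>J. a j \<omega> *\<^sub>R v j)) \<le> norm (\<Sum>j\<in>J. \<bar>a j \<omega>\<bar> * norm (v j))"
  proof (rule AE_I2)
    fix \<omega>
    have "norm (\<Sum>j\<in>J. a j \<omega> *\<^sub>R v j) \<le> (\<Sum>j\<in>J. \<bar>a j \<omega>\<bar> * norm (v j))" by (rule combination_bound)
    then show "norm (norm (\<Sum>j\<in>J. a j \<omega> *\<^sub>R v j)) \<le> norm (\<Sum>j\<in>J. \<bar>a j \<omega>\<bar> * norm (v j))" by simp
  qed
qed

lemma S_integrable: "integrable P (\<lambda>\<omega>. norm (S v \<omega>))"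
  unfolding S_def by (rule combination_integrable[OF finite_I \<xi>_integrable])

lemma T_integrable: "i \<in> I \<Longrightarrow> integrable P (\<lambda>\<omega>. norm (T i v \<omega>))"
  unfolding T_def
  by (rule combination_integrable) (use finite_I \<xi>_integrable in auto)

lemma n_T:
  assumes i: "i \<in> I"
  shows "real (card I) *\<^sub>R T i v \<omega>
    = (real (card I) - 1) *\<^sub>R S v \<omega> + \<xi> i \<omega> *\<^sub>R (\<Sum>j\<in>I. v j) - (real (card I) * \<xi> i \<omega>) *\<^sub>R v i"
proof -
  let ?n = "real (card I)"
  have "?n *\<^sub>R T i v \<omega> = (\<Sum>j\<in>I - {i}. ((?n - 1) * \<xi> j \<omega> + \<xi> i \<omega>) *\<^sub>R v j)"
    unfolding T_def scaleR_right.sum using n_pos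
    by (intro sum.cong refl) (simp add: distrib_left left_diff_distrib right_diff_distrib)
  also have "\<dots> = (\<Sum>j\<in>I. ((?n - 1) * \<xi> j \<omega> + \<xi> i \<omega>) *\<^sub>R v j) - ((?n - 1) * \<xi> i \<omega> + \<xi> i \<omega>) *\<^sub>R v i"
    using finite_I i by (simp add: sum_diff1)
  also have "(\<Sum>j\<in>I. ((?n - 1) * \<xi> j \<omega> + \<xi> i \<omega>) *\<^sub>R v j) = (?n - 1) *\<^sub>R S v \<omega> + \<xi> i \<omega> *\<^sub>R (\<Sum>j\<in>I. v j)"
    unfolding S_def by (simp add: scaleR_add_left sum.distrib scaleR_right.sum)
  finally show ?thesis by (simp add: algebra_simps)
qed

lemma swapped_sum:
  assumes "i \<in> I" "k \<in> I"
  shows "(\<Sum>j\<in>I. \<xi> (Transposition.transpose i k j) \<omega> *\<^sub>R v j) = S v \<omega> + (\<xi> k \<omega> - \<xi> i \<omega>) *\<^sub>R (v i - v k)"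
proof (cases "i = k")
  case True then show ?thesis by (simp add: S_def)
next
  case False
  have "(\<Sum>j\<in>I. \<xi> (Transposition.transpose i k j) \<omega> *\<^sub>R v j) - S v \<omega>
      = (\<Sum>j\<in>I. (\<xi> (Transposition.transpose i k j) \<omega> - \<xi> j \<omega>) *\<^sub>R v j)"
    unfolding S_def by (simp add: sum_subtractf scaleR_diff_left)
  also have "\<dots> = (\<Sum>j\<in>{i, k}. (\<xi> (Transposition.transpose i k j) \<omega> - \<xi> j \<omega>) *\<^sub>R v j)"
    by (rule sum.mono_neutral_right) (use assms finite_I in \<open>auto simp: Transposition.transpose_def\<close>)
  also have "\<dots> = (\<xi> k \<omega> - \<xi> i \<omega>) *\<^sub>R (v i - v k)"
    using False by (simp add: algebra_simps)
  finally show ?thesis by (simp add: algebra_simps)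
qed

text \<open>A swap changes \<open>S\<close> by (\<xi> k - \<xi> i) times (v i - v k). In the sum
  over k, the part of \<open>v i\<close> carried by the \<xi> k disappears because the weights sum
  to 0.\<close>

lemma n_T_average:
  assumes i: "i \<in> I" and z: "(\<Sum>i\<in>I. \<xi> i \<omega>) = 0"
  shows "real (card I) *\<^sub>R T i v \<omega> = (\<Sum>k\<in>I. \<Sum>j\<in>I. \<xi> (Transposition.transpose i k j) \<omega> *\<^sub>R v j)"
proof -
  let ?n = "real (card I)"
  have "(\<Sum>k\<in>I. \<Sum>j\<in>I. \<xi> (Transposition.transpose i k j) \<omega> *\<^sub>R v j)
      = (\<Sum>k\<in>I. S v \<omega> + (\<xi> k \<omega> *\<^sub>R v i - \<xi> k \<omega> *\<^sub>R v k - \<xi> i \<omega> *\<^sub>R v i + \<xi> i \<omega> *\<^sub>R v k))"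
    by (intro sum.cong refl) (simp add: swapped_sum[OF i] algebra_simps)
  also have "\<dots> = ?n *\<^sub>R S v \<omega> + ((\<Sum>k\<in>I. \<xi> k \<omega>) *\<^sub>R v i - S v \<omega> - ?n *\<^sub>R (\<xi> i \<omega> *\<^sub>R v i) + \<xi> i \<omega> *\<^sub>R (\<Sum>k\<in>I. v k))"
    unfolding S_def by (simp add: sum.distrib sum_subtractf scaleR_left.sum scaleR_right.sum sum_constant_scaleR)
  finally show ?thesis unfolding n_T[OF i] z by (simp add: algebra_simps)
qed

text \<open>Triangle inequality for the average over swaps: by exchangeability each swapped sum has
  the same mean norm as \<open>S\<close>.\<close>

lemma fT_le_f:
  assumes i: "i \<in> I"
  shows "fT i v \<le> f v"
proof -
  let ?n = "real (card I)" and ?S = "\<lambda>k \<omega>. \<Sum>j\<in>I. \<xi> (Transposition.transpose i k j) \<omega> *\<^sub>R v j"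
  have int: "integrable P (\<lambda>\<omega>. norm (?S k \<omega>))" if "k \<in> I" for k
    by (rule combination_integrable[OF finite_I \<xi>_integrable])
       (use i that in \<open>auto simp: Transposition.transpose_def\<close>)
  have "?n * fT i v = (\<integral>\<omega>. ?n * norm (T i v \<omega>) \<partial>P)" unfolding fT_def by simp
  also have "\<dots> \<le> (\<integral>\<omega>. (\<Sum>k\<in>I. norm (?S k \<omega>)) \<partial>P)"
  proof (rule integral_mono_AE)
    show "AE \<omega> in P. ?n * norm (T i v \<omega>) \<le> (\<Sum>k\<in>I. norm (?S k \<omega>))"
      using \<xi>_sum
    proof eventually_elim
      case (elim \<omega>)
      have "?n * norm (T i v \<omega>) = norm (?n *\<^sub>R T i v \<omega>)" by simp
      also have "\<dots> \<le> (\<Sum>k\<in>I. norm (?S k \<omega>))" unfolding n_T_average[OF i elim] by (rule norm_sum)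
      finally show ?case .
    qed
  qed (use T_integrable[OF i] int in auto)
  also have "\<dots> = (\<Sum>k\<in>I. f v)"
    using int \<xi>_swap[OF i] unfolding f_def S_def by simp
  finally show ?thesis using n_pos by simp
qed

text \<open>Summed over i, the vectors \<open>T i\<close> give n - 2 copies of \<open>S\<close>: one
  copy is lost because \<open>T i\<close> omits \<open>v i\<close>, another because averaging
  shrinks each weight by 1 - 1/n. Hence the factor 2, where \<open>Z\<close> has 1.\<close>

lemma sum_f_diff: "(\<Sum>i\<in>I. f v - fT i v) \<le> 2 * f v"
proof -
  let ?n = "real (card I)"
  have "(?n - 2) * f v = (\<integral>\<omega>. (?n - 2) * norm (S v \<omega>) \<partial>P)" unfolding f_def by simp
  also have "\<dots> \<le> (\<integral>\<omega>. (\<Sum>i\<in>I. norm (T i v \<omega>)) \<partial>P)"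
  proof (rule integral_mono_AE)
    show "AE \<omega> in P. (?n - 2) * norm (S v \<omega>) \<le> (\<Sum>i\<in>I. norm (T i v \<omega>))"
      using \<xi>_sum
    proof eventually_elim
      case (elim \<omega>)
      have "?n *\<^sub>R (\<Sum>i\<in>I. T i v \<omega>) = (\<Sum>i\<in>I. ?n *\<^sub>R T i v \<omega>)" by (simp add: scaleR_right.sum)
      also have "\<dots> = (\<Sum>i\<in>I. (?n - 1) *\<^sub>R S v \<omega> + \<xi> i \<omega> *\<^sub>R (\<Sum>j\<in>I. v j) - ?n *\<^sub>R (\<xi> i \<omega> *\<^sub>R v i))"
        by (intro sum.cong refl) (simp add: n_T)
      also have "\<dots> = ?n *\<^sub>R ((?n - 1) *\<^sub>R S v \<omega>) + (\<Sum>i\<in>I. \<xi> i \<omega>) *\<^sub>R (\<Sum>j\<in>I. v j) - ?n *\<^sub>R S v \<omega>"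
        unfolding S_def
        by (simp only: sum.distrib sum_subtractf scaleR_left.sum[symmetric] scaleR_right.sum[symmetric] sum_constant_scaleR)
          (simp add: algebra_simps)
      also have "\<dots> = ?n *\<^sub>R ((?n - 2) *\<^sub>R S v \<omega>)" 
      proof -
        have "a *\<^sub>R (b *\<^sub>R w) - a *\<^sub>R w = (a * b - a) *\<^sub>R w" for a b :: real and w :: 'a
          by (simp add: scaleR_diff_left)
        from this[of ?n "?n - 1" "S v \<omega>"]
        have "?n *\<^sub>R ((?n - 1) *\<^sub>R S v \<omega>) - ?n *\<^sub>R S v \<omega> = (?n * (?n - 1) - ?n) *\<^sub>R S v \<omega>" .
        also have "?n * (?n - 1) - ?n = ?n * (?n - 2)" by (simp add: algebra_simps)
        finally show ?thesis unfolding elim by simp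
      qed
      finally have eq: "?n *\<^sub>R (\<Sum>i\<in>I. T i v \<omega>) = ?n *\<^sub>R ((?n - 2) *\<^sub>R S v \<omega>)" .
      have "(\<Sum>i\<in>I. T i v \<omega>) = (?n - 2) *\<^sub>R S v \<omega>"
        by (rule scaleR_left_imp_eq[OF _ eq]) (use n_pos in simp)
      \<comment> \<open>The absolute value covers n = 1, where n - 2 is negative.\<close>
      then have "\<bar>?n - 2\<bar> * norm (S v \<omega>) = norm (\<Sum>i\<in>I. T i v \<omega>)" by simp
      also have "\<dots> \<le> (\<Sum>i\<in>I. norm (T i v \<omega>))" by (rule norm_sum)
      finally show ?case
        using mult_right_mono[OF abs_ge_self norm_ge_zero, of "?n - 2" "S v \<omega>"] by linarith
    qed
  qed (use T_integrable S_integrable in auto)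
  also have "\<dots> = (\<Sum>i\<in>I. fT i v)" using T_integrable unfolding fT_def by simp
  finally show ?thesis by (simp add: sum_subtractf algebra_simps)
qed

lemma fT_nonneg: "0 \<le> fT i v" unfolding fT_def by simp

lemma f_nonneg: "0 \<le> f v" unfolding f_def by simp

lemma f_bound:
  assumes "\<And>j. j \<in> I \<Longrightarrow> norm (v j) \<le> 1"
  shows "f v \<le> real (card I) * \<kappa>"
proof -
  have "f v \<le> (\<integral>\<omega>. (\<Sum>j\<in>I. \<bar>\<xi> j \<omega>\<bar>) \<partial>P)" unfolding f_def
  proof (rule integral_mono[OF S_integrable])
    fix \<omega>
    have "norm (S v \<omega>) \<le> (\<Sum>j\<in>I. \<bar>\<xi> j \<omega>\<bar> * norm (v j))" unfolding S_def by (rule combination_bound)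
    also have "\<dots> \<le> (\<Sum>j\<in>I. \<bar>\<xi> j \<omega>\<bar> * 1)" using assms by (intro sum_mono mult_left_mono) auto
    finally show "norm (S v \<omega>) \<le> (\<Sum>j\<in>I. \<bar>\<xi> j \<omega>\<bar>)" by simp
  qed (use \<xi>_integrable in auto)
  also have "\<dots> = real (card I) * \<kappa>" using \<xi>_integrable \<xi>_abs by simp
  finally show ?thesis .
qed

text \<open>n (S - T i) equals S - \<xi> i sum v + n \<xi> i v i, three terms of mean norm at most n
  \<kappa> each.\<close>

lemma f_fT_diff_le:
  assumes i: "i \<in> I" and v: "\<And>j. j \<in> I \<Longrightarrow> norm (v j) \<le> 1"
  shows "f v - fT i v \<le> 3 * \<kappa>"
proof -
  let ?n = "real (card I)"
  have "?n * (f v - fT i v) = (\<integral>\<omega>. ?n * (norm (S v \<omega>) - norm (T i v \<omega>)) \<partial>P)"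
    unfolding f_def fT_def using S_integrable T_integrable[OF i] by simp
  also have "\<dots> \<le> (\<integral>\<omega>. (\<Sum>j\<in>I. \<bar>\<xi> j \<omega>\<bar>) + 2 * ?n * \<bar>\<xi> i \<omega>\<bar> \<partial>P)"
  proof (rule integral_mono)
    fix \<omega>
    have "?n * (norm (S v \<omega>) - norm (T i v \<omega>)) \<le> ?n * norm (S v \<omega> - T i v \<omega>)"
      using norm_triangle_ineq2 n_pos by (intro mult_left_mono) auto
    also have "\<dots> = norm (?n *\<^sub>R S v \<omega> - ?n *\<^sub>R T i v \<omega>)"
      by (simp add: scaleR_diff_right[symmetric])
    also have "?n *\<^sub>R S v \<omega> - ?n *\<^sub>R T i v \<omega> = S v \<omega> - \<xi> i \<omega> *\<^sub>R (\<Sum>j\<in>I. v j) + (?n * \<xi> i \<omega>) *\<^sub>R v i"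
      unfolding n_T[OF i] by (simp add: algebra_simps)
    also have "norm \<dots> \<le> norm (S v \<omega>) + norm (\<xi> i \<omega> *\<^sub>R (\<Sum>j\<in>I. v j)) + norm ((?n * \<xi> i \<omega>) *\<^sub>R v i)"
      using norm_triangle_ineq4[of "S v \<omega>" "\<xi> i \<omega> *\<^sub>R (\<Sum>j\<in>I. v j)"]
      by (intro order_trans[OF norm_triangle_ineq] add_right_mono)
    also have "norm (S v \<omega>) \<le> (\<Sum>j\<in>I. \<bar>\<xi> j \<omega>\<bar>)"
    proof -
      have "norm (S v \<omega>) \<le> (\<Sum>j\<in>I. \<bar>\<xi> j \<omega>\<bar> * norm (v j))" unfolding S_def by (rule combination_bound)
      also have "\<dots> \<le> (\<Sum>j\<in>I. \<bar>\<xi> j \<omega>\<bar> * 1)" using v by (intro sum_mono mult_left_mono) auto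
      finally show ?thesis by simp
    qed
    also have "norm (\<xi> i \<omega> *\<^sub>R (\<Sum>j\<in>I. v j)) \<le> \<bar>\<xi> i \<omega>\<bar> * ?n"
      using sum_norm_bound[of I v 1] v by (auto intro!: mult_left_mono)
    also have "norm ((?n * \<xi> i \<omega>) *\<^sub>R v i) \<le> ?n * \<bar>\<xi> i \<omega>\<bar> * 1"
      using mult_left_mono[OF v[OF i], of "?n * \<bar>\<xi> i \<omega>\<bar>"] by (simp add: abs_mult)
    finally show "?n * (norm (S v \<omega>) - norm (T i v \<omega>)) \<le> (\<Sum>j\<in>I. \<bar>\<xi> j \<omega>\<bar>) + 2 * ?n * \<bar>\<xi> i \<omega>\<bar>"
      by simp
  qed (use S_integrable T_integrable[OF i] \<xi>_integrable i in auto)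
  also have "\<dots> = ?n * (3 * \<kappa>)" using \<xi>_integrable \<xi>_abs i by (simp add: algebra_simps)
  finally show ?thesis using n_pos by simp
qed

section \<open>Effect of removing or resampling a single vector\<close>

lemma S_upd:
  assumes i: "i \<in> I"
  shows "S (v(i := w)) \<omega> = S (v(i := 0)) \<omega> + \<xi> i \<omega> *\<^sub>R w"
proof -
  have e: "S (v(i := w)) \<omega> = \<xi> i \<omega> *\<^sub>R w + (\<Sum>j\<in>I - {i}. \<xi> j \<omega> *\<^sub>R v j)" for w
    unfolding S_def using finite_I i by (subst sum.remove[of _ i]) (auto intro!: sum.cong)
  show ?thesis unfolding e[of w] e[of 0] by simp
qed

lemma T_upd: "T i (v(i := w)) \<omega> = T i v \<omega>"
  unfolding T_def by (intro sum.cong) auto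

lemma fT_upd: "fT i (v(i := w)) = fT i v"
  unfolding fT_def T_upd ..

lemma f_upd_diff:
  assumes i: "i \<in> I" and w: "norm w \<le> 1"
  shows "\<bar>f (v(i := w)) - f (v(i := 0))\<bar> \<le> \<kappa>"
proof -
  have "f (v(i := w)) - f (v(i := 0)) = (\<integral>\<omega>. norm (S (v(i := w)) \<omega>) - norm (S (v(i := 0)) \<omega>) \<partial>P)"
    unfolding f_def using S_integrable by simp
  then have "\<bar>f (v(i := w)) - f (v(i := 0))\<bar>
      \<le> (\<integral>\<omega>. \<bar>norm (S (v(i := w)) \<omega>) - norm (S (v(i := 0)) \<omega>)\<bar> \<partial>P)"
    by (simp only: integral_abs_bound)
  also have "\<dots> \<le> (\<integral>\<omega>. \<bar>\<xi> i \<omega>\<bar> \<partial>P)"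
  proof (rule integral_mono)
    fix \<omega>
    have "\<bar>norm (S (v(i := w)) \<omega>) - norm (S (v(i := 0)) \<omega>)\<bar> \<le> norm (\<xi> i \<omega> *\<^sub>R w)"
      using norm_triangle_ineq3[of "S (v(i := w)) \<omega>" "S (v(i := 0)) \<omega>"] unfolding S_upd[OF i, of v w] by simp
    also have "\<dots> \<le> \<bar>\<xi> i \<omega>\<bar> * 1" unfolding norm_scaleR using w by (intro mult_left_mono) auto
    finally show "\<bar>norm (S (v(i := w)) \<omega>) - norm (S (v(i := 0)) \<omega>)\<bar> \<le> \<bar>\<xi> i \<omega>\<bar>" by simp
  qed (use S_integrable \<xi>_integrable[OF i] in auto)
  finally show ?thesis using \<xi>_abs[OF i] by simp
qed

lemma f_measurable_param:
  assumes "\<And>j. j \<in> J \<Longrightarrow> a j \<in> borel_measurable P" "\<And>j. j \<in> J \<Longrightarrow> weakly_measurable K (\<lambda>y. g y j)"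
  shows "(\<lambda>y. \<integral>\<omega>. norm (\<Sum>j\<in>J. a j \<omega> *\<^sub>R (g y j :: 'a)) \<partial>P) \<in> borel_measurable K"
    "(\<lambda>(y, \<omega>). norm (\<Sum>j\<in>J. a j \<omega> *\<^sub>R g y j)) \<in> borel_measurable (K \<Otimes>\<^sub>M P)"
proof -
  show *: "(\<lambda>(y, \<omega>). norm (\<Sum>j\<in>J. a j \<omega> *\<^sub>R g y j)) \<in> borel_measurable (K \<Otimes>\<^sub>M P)"
    unfolding case_prod_unfold
    by (intro weakly_measurable_norm[OF sep] weakly_measurable_sum weakly_measurable_scaleR
        measurable_compose[OF measurable_snd assms(1)]
        weakly_measurable_compose[OF assms(2) measurable_fst])
  then show "(\<lambda>y. \<integral>\<omega>. norm (\<Sum>j\<in>J. a j \<omega> *\<^sub>R g y j) \<partial>P) \<in> borel_measurable K"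
    by (rule P.borel_measurable_lebesgue_integral)
qed

lemma f_resampled_measurable: "(\<lambda>z. f (v(i := h z))) \<in> borel_measurable N"
  unfolding f_def S_def
proof (rule f_measurable_param(1))
  show "weakly_measurable N (\<lambda>z. (v(i := h z)) j)" for j
    by (cases "j = i") (simp_all add: h_measurable weakly_measurable_const)
qed (use \<xi>_integrable in auto)

text \<open>For fixed multipliers this is Jensen's inequality in the resampled vector; Fubini's
  theorem then exchanges the two averages.\<close>

lemma f_le_resampled:
  assumes i: "i \<in> I"
  shows "f (v(i := 0)) \<le> (\<integral>z. f (v(i := h z)) \<partial>N)"
proof -
  interpret NP: pair_sigma_finite N P by standard
  have meas: "(\<lambda>(z, \<omega>). norm (S (v(i := h z)) \<omega>)) \<in> borel_measurable (N \<Otimes>\<^sub>M P)"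
    unfolding S_def
  proof (rule f_measurable_param(2))
    show "weakly_measurable N (\<lambda>z. (v(i := h z)) j)" for j
      by (cases "j = i") (simp_all add: h_measurable weakly_measurable_const)
  qed (use \<xi>_integrable in auto)
  have fb: "\<bar>f (v(i := h z))\<bar> \<le> f (v(i := 0)) + \<kappa>" for z
    using f_upd_diff[OF i h_bound, of v z] f_nonneg[of "v(i := h z)"] by linarith
  have fint: "integrable N (\<lambda>z. f (v(i := h z)))"
    by (rule N.bounded_integrable[OF f_resampled_measurable fb])
  have int: "integrable (N \<Otimes>\<^sub>M P) (\<lambda>(z, \<omega>). norm (S (v(i := h z)) \<omega>))"
    by (rule NP.Fubini_integrable[OF meas]) (use fint S_integrable in \<open>auto simp: f_def[symmetric]\<close>)
  have "(\<integral>z. f (v(i := h z)) \<partial>N) = (\<integral>\<omega>. (\<integral>z. norm (S (v(i := h z)) \<omega>) \<partial>N) \<partial>P)"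
    unfolding f_def using NP.Fubini_integral[OF int] by simp
  moreover have "f (v(i := 0)) \<le> (\<integral>\<omega>. (\<integral>z. norm (S (v(i := h z)) \<omega>) \<partial>N) \<partial>P)"
    unfolding f_def
  proof (rule integral_mono[OF S_integrable])
    show "integrable P (\<lambda>\<omega>. \<integral>z. norm (S (v(i := h z)) \<omega>) \<partial>N)"
      using NP.integrable_snd[OF int] by simp
    show "norm (S (v(i := 0)) \<omega>) \<le> (\<integral>z. norm (S (v(i := h z)) \<omega>) \<partial>N)" for \<omega>
      unfolding S_upd[OF i, of v "h _"] by (rule norm_le_resampled_scaled)
  qed
  ultimately show ?thesis by simp
qed

text \<open>Centring at \<open>max (f (v(i := 0))) (fT i v)\<close>: the first value gives increments of size \<open>\<kappa>\<close> with
  nonnegative tilted mean, the second one nonnegative increments summing to at most \<open>2 f\<close>.\<close>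

lemma tilted_second_moment:
  fixes v :: "'i \<Rightarrow> 'a"
  assumes i: "i \<in> I" and t: "0 \<le> t"
  defines "c \<equiv> max (f (v(i := 0))) (fT i v)"
  shows "(\<integral>z. exp (t * f (v(i := h z))) * ((f (v(i := h z)) - c)\<^sup>2 - \<kappa> * (f (v(i := h z)) - fT i v)) \<partial>N) \<le> 0"
proof -
  define f0 where "f0 = f (v(i := 0))"
  define g where "g z = f (v(i := h z))" for z
  define q where "q = f0 - fT i v"
  \<comment> \<open>Since g - f0 is at least -q (from g \<ge> fT) and at least -\<kappa>, it lies in
    [-q', \<kappa>] whenever q \<ge> 0.\<close>
  define q' where "q' = max 0 (min q \<kappa>)"
  have [measurable]: "g \<in> borel_measurable N" unfolding g_def by (rule f_resampled_measurable)
  have w: "\<bar>g z - f0\<bar> \<le> \<kappa>" for z unfolding g_def f0_def using f_upd_diff[OF i h_bound] by blast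
  have u: "0 \<le> g z - fT i v" for z
    using fT_le_f[OF i, of "v(i := h z)"] unfolding g_def fT_upd by simp
  have gb: "\<bar>g z\<bar> \<le> f0 + \<kappa>" for z
    using w[of z] f_nonneg[of "v(i := h z)"] unfolding g_def by linarith
  have eb: "exp (t * g z) \<le> exp (t * (f0 + \<kappa>))" for z
    using gb[of z] t by (auto simp: abs_le_iff intro!: mult_left_mono)
  have int_g: "integrable N g" by (rule N.bounded_integrable[where B="f0 + \<kappa>"]) (use gb in auto)
  have int: "integrable N (\<lambda>z. exp (t * g z) * (g z - f0))"
  proof (rule N.bounded_integrable[where B="exp (t * (f0 + \<kappa>)) * \<kappa>"])
    show "\<bar>exp (t * g z) * (g z - f0)\<bar> \<le> exp (t * (f0 + \<kappa>)) * \<kappa>" for z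
      unfolding abs_mult using eb[of z] w[of z] by (intro mult_mono) auto
  qed measurable
  \<comment> \<open>For q \<ge> 0 this expands the nonnegative product of the distances of g - f0 to
    the endpoints -q' and \<kappa>. For q < 0 the centre is \<open>fT i v\<close>, and the increment
    lies in [0, \<kappa>].\<close>
  have pt: "(g z - c)\<^sup>2 - \<kappa> * (g z - fT i v) \<le> - q' * (g z - f0)" for z
  proof (cases "0 \<le> q")
    case True
    then have c: "c = f0" unfolding c_def q_def f0_def by simp
    have q': "q' = min q \<kappa>" "0 \<le> q'" unfolding q'_def using True \<kappa>_nonneg by auto
    have "- q' \<le> g z - f0" unfolding q' q_def using u[of z] w[of z] by (auto simp: abs_le_iff min_def)
    then have "0 \<le> (g z - f0 + q') * (\<kappa> - (g z - f0))" using w[of z] by (intro mult_nonneg_nonneg) auto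
    then have "(g z - f0)\<^sup>2 \<le> \<kappa> * (g z - f0 + q') - q' * (g z - f0)"
      by (simp add: algebra_simps power2_eq_square)
    also have "\<kappa> * (g z - f0 + q') \<le> \<kappa> * (g z - fT i v)"
      unfolding q' q_def using \<kappa>_nonneg by (intro mult_left_mono) auto
    finally show ?thesis unfolding c by simp
  next
    case False
    then have c: "c = fT i v" and q': "q' = 0" unfolding c_def q_def f0_def q'_def by auto
    have "g z - fT i v \<le> \<kappa>" using w[of z] False unfolding q_def by (auto simp: abs_le_iff)
    then have "(g z - fT i v) * (g z - fT i v) \<le> \<kappa> * (g z - fT i v)" using u[of z] by (intro mult_right_mono)
    then show ?thesis unfolding c q' by (simp add: power2_eq_square)
  qed
  have "0 \<le> exp (t * f0) * ((\<integral>z. g z \<partial>N) - f0)"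
    using f_le_resampled[OF i, of v] unfolding g_def f0_def by simp
  also have "\<dots> = (\<integral>z. exp (t * f0) * (g z - f0) \<partial>N)" using int_g by (simp add: N.prob_space)
  \<comment> \<open>Tilting by an increasing function of g favours the values above f0, so it cannot
    make the nonnegative mean of g - f0 negative.\<close>
  also have "\<dots> \<le> (\<integral>z. exp (t * g z) * (g z - f0) \<partial>N)"
  proof (rule integral_mono[OF _ int])
    show "integrable N (\<lambda>z. exp (t * f0) * (g z - f0))" using int_g by simp
    fix z
    show "exp (t * f0) * (g z - f0) \<le> exp (t * g z) * (g z - f0)"
    proof (cases "f0 \<le> g z")
      case True
      then show ?thesis using t by (intro mult_right_mono) (auto intro: mult_left_mono)
    next
      case False
      then show ?thesis using t by (intro mult_right_mono_neg) (auto intro: mult_left_mono)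
    qed
  qed
  finally have nonneg: "0 \<le> (\<integral>z. exp (t * g z) * (g z - f0) \<partial>N)" .
  have "(\<integral>z. exp (t * g z) * ((g z - c)\<^sup>2 - \<kappa> * (g z - fT i v)) \<partial>N)
      \<le> (\<integral>z. - q' * (exp (t * g z) * (g z - f0)) \<partial>N)"
  proof (rule integral_mono)
    show "exp (t * g z) * ((g z - c)\<^sup>2 - \<kappa> * (g z - fT i v)) \<le> - q' * (exp (t * g z) * (g z - f0))" for z
      using mult_left_mono[OF pt[of z], of "exp (t * g z)"] by (simp add: ac_simps)
    show "integrable N (\<lambda>z. exp (t * g z) * ((g z - c)\<^sup>2 - \<kappa> * (g z - fT i v)))"
    proof (rule N.bounded_integrable[where B="exp (t * (f0 + \<kappa>)) * ((f0 + \<kappa> + \<bar>c\<bar>)\<^sup>2 + \<kappa> * (f0 + \<kappa> + \<bar>fT i v\<bar>))"])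
      fix z
      have 1: "(g z - c)\<^sup>2 \<le> (f0 + \<kappa> + \<bar>c\<bar>)\<^sup>2" using gb[of z] by (intro abs_le_square_iff[THEN iffD1]) linarith
      have 2: "\<kappa> * \<bar>g z - fT i v\<bar> \<le> \<kappa> * (f0 + \<kappa> + \<bar>fT i v\<bar>)" using gb[of z] \<kappa>_nonneg by (intro mult_left_mono) linarith+
      have 3: "\<bar>\<kappa> * (g z - fT i v)\<bar> = \<kappa> * \<bar>g z - fT i v\<bar>" using \<kappa>_nonneg by (simp add: abs_mult)
      have "0 \<le> (g z - c)\<^sup>2" by simp
      then have "\<bar>(g z - c)\<^sup>2 - \<kappa> * (g z - fT i v)\<bar> \<le> (f0 + \<kappa> + \<bar>c\<bar>)\<^sup>2 + \<kappa> * (f0 + \<kappa> + \<bar>fT i v\<bar>)"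
        using 1 2 3 by linarith
      then show "\<bar>exp (t * g z) * ((g z - c)\<^sup>2 - \<kappa> * (g z - fT i v))\<bar>
          \<le> exp (t * (f0 + \<kappa>)) * ((f0 + \<kappa> + \<bar>c\<bar>)\<^sup>2 + \<kappa> * (f0 + \<kappa> + \<bar>fT i v\<bar>))"
        unfolding abs_mult[of "exp (t * g z)"] using eb[of z] by (intro mult_mono) auto
    qed measurable
    show "integrable N (\<lambda>z. - q' * (exp (t * g z) * (g z - f0)))" using int by simp
  qed
  also have "\<dots> \<le> 0" using nonneg by (simp add: q'_def)
  finally show ?thesis unfolding g_def .
qed

section \<open>Entropy and tails of the conditional mean norm\<close>

definition H :: "('i \<Rightarrow> 'b) \<Rightarrow> real" where "H y = f (\<lambda>i. h (y i))"

lemma H_measurable: "H \<in> borel_measurable Q"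
  unfolding H_def f_def S_def
  by (rule f_measurable_param(1)) (use \<xi>_integrable h_coord_measurable in auto)

lemma H_upd: "H (y(i := z)) = f ((\<lambda>j. h (y j))(i := h z))"
  unfolding H_def by (rule arg_cong[where f=f]) auto

sublocale H: bounded_variable Q H "real (card I) * \<kappa>"
  by standard (use H_measurable f_nonneg f_bound h_bound in \<open>auto simp: H_def\<close>)

lemma fTh_measurable:
  assumes "i \<in> I"
  shows "(\<lambda>y. fT i (\<lambda>j. h (y j))) \<in> borel_measurable Q"
  unfolding fT_def T_def
proof (rule f_measurable_param(1))
  have m: "\<xi> j \<in> borel_measurable P" if "j \<in> I" for j using \<xi>_integrable[OF that] by (rule borel_measurable_integrable)
  show "(\<lambda>\<omega>. (1 - 1 / real (card I)) * \<xi> j \<omega> + \<xi> i \<omega> / real (card I)) \<in> borel_measurable P"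
    if "j \<in> I - {i}" for j
    using m[OF DiffD1[OF that]] m[OF assms]
    by (intro borel_measurable_add borel_measurable_times borel_measurable_divide borel_measurable_const)
  show "weakly_measurable Q (\<lambda>y. h (y j))" if "j \<in> I - {i}" for j
    using that by (intro h_coord_measurable) auto
qed

lemma f0h_measurable: "(\<lambda>y. f ((\<lambda>j. h (y j))(i := 0))) \<in> borel_measurable Q"
  unfolding f_def S_def
proof (rule f_measurable_param(1))
  show "weakly_measurable Q (\<lambda>y. ((\<lambda>j. h (y j))(i := 0)) j)" if "j \<in> I" for j
    using that by (cases "j = i") (simp_all add: h_coord_measurable weakly_measurable_const)
qed (use \<xi>_integrable in auto)

lemma fTh_upd: "fT i (\<lambda>j. h ((y(i := z)) j)) = fT i (\<lambda>j. h (y j))"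
  unfolding fT_def T_def by (intro Bochner_Integration.integral_cong refl arg_cong[where f=norm] sum.cong) auto

lemma f0h_upd: "f ((\<lambda>j. h ((y(i := z)) j))(i := 0)) = f ((\<lambda>j. h (y j))(i := 0))"
  by (intro arg_cong[where f=f]) auto

lemma fTh_bound:
  assumes "i \<in> I"
  shows "fT i (\<lambda>j. h (y j)) \<le> real (card I) * \<kappa>"
  by (rule order_trans[OF fT_le_f[OF assms] f_bound]) (rule h_bound)

lemma exp_tilt_integrable:
  assumes "D \<in> borel_measurable Q" "\<And>y. y \<in> space Q \<Longrightarrow> \<bar>D y\<bar> \<le> (R::real)"
  shows "integrable Q (\<lambda>y. exp (t * H y) * D y)"
    "\<And>y. y \<in> space Q \<Longrightarrow> \<bar>exp (t * H y) * D y\<bar> \<le> exp (\<bar>t\<bar> * (real (card I) * \<kappa>)) * R"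
proof -
  show b: "\<bar>exp (t * H y) * D y\<bar> \<le> exp (\<bar>t\<bar> * (real (card I) * \<kappa>)) * R" if "y \<in> space Q" for y
    unfolding abs_mult using H.exp_tH_bound[OF that, of t] assms(2)[OF that] by (intro mult_mono) auto
  show "integrable Q (\<lambda>y. exp (t * H y) * D y)"
    by (rule Q.bounded_integrable[OF _ b]) (use assms(1) H_measurable in measurable)
qed

text \<open>The increments \<open>D\<close> are at most \<kappa> \<le> 2/3 in size, so the
  exponential remainder costs 3/4 of their square. \<open>tilted_second_moment\<close> exchanges the
  square for \<kappa> \<open>U\<close>, and the \<open>U i\<close> sum to at most 2
  \<open>H\<close>. The total coefficient 3/4 * 2/3 * 2 is 1.\<close>

lemma entropy_H_upper:
  assumes \<kappa>: "\<kappa> \<le> 2/3" and t: "0 < t" "t < 1"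
  shows "H.entropy_exp t \<le> t\<^sup>2 * H.mgf' t"
proof -
  note [measurable] = H_measurable f0h_measurable
  define c where "c i y = max (f ((\<lambda>j. h (y j))(i := 0))) (fT i (\<lambda>j. h (y j)))" for i y
  define D where "D i y = H y - c i y" for i y
  define U where "U i y = H y - fT i (\<lambda>j. h (y j))" for i y
  have [measurable]: "c i \<in> borel_measurable Q" "D i \<in> borel_measurable Q" "U i \<in> borel_measurable Q"
    if "i \<in> I" for i
    using fTh_measurable[OF that] unfolding c_def D_def U_def by measurable
  have U: "0 \<le> U i y" "U i y \<le> 3 * \<kappa>" if "i \<in> I" for i y
    using fT_le_f[OF that, of "\<lambda>j. h (y j)"] f_fT_diff_le[OF that, of "\<lambda>j. h (y j)"] h_bound
    unfolding U_def H_def by auto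
  \<comment> \<open>If the maximum is attained at the larger value \<open>fT\<close>, the increment
    is nonnegative and only shrinks compared with the centre f0.\<close>
  have Db: "\<bar>D i y\<bar> \<le> \<kappa>" if "i \<in> I" for i y
  proof -
    have e: "(\<lambda>j. h (y j))(i := h (y i)) = (\<lambda>j. h (y j))" by auto
    have "\<bar>H y - f ((\<lambda>j. h (y j))(i := 0))\<bar> \<le> \<kappa>"
      using f_upd_diff[OF that h_bound, of "\<lambda>j. h (y j)" "y i"] unfolding e H_def .
    then show ?thesis using U(1)[OF that, of y] unfolding D_def c_def U_def by (auto simp: abs_le_iff max_def)
  qed
  have intD: "integrable Q (\<lambda>y. exp (t * H y) * (D i y)\<^sup>2)" if "i \<in> I" for i
  proof (rule exp_tilt_integrable(1)[where R="\<kappa>\<^sup>2"])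
    show "\<bar>(D i y)\<^sup>2\<bar> \<le> \<kappa>\<^sup>2" for y using Db[OF that, of y] by (simp add: abs_le_square_iff[symmetric])
  qed (use that in measurable)
  have intU: "integrable Q (\<lambda>y. exp (t * H y) * U i y)" if "i \<in> I" for i
    by (rule exp_tilt_integrable(1)[where R="3 * \<kappa>"]) (use that U[OF that] in \<open>auto simp: abs_le_iff intro: order_trans\<close>)
  have second: "(\<integral>y. exp (t * H y) * (D i y)\<^sup>2 \<partial>Q) \<le> \<kappa> * (\<integral>y. exp (t * H y) * U i y \<partial>Q)" if i: "i \<in> I" for i
  proof -
    have "(\<integral>y. exp (t * H y) * ((D i y)\<^sup>2 - \<kappa> * U i y) \<partial>Q) \<le> 0"
    proof (rule resample_nonpos[OF i _ exp_tilt_integrable(2)])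
      show "(\<lambda>y. exp (t * H y) * ((D i y)\<^sup>2 - \<kappa> * U i y)) \<in> borel_measurable Q" using i by measurable
      show "(\<lambda>y. (D i y)\<^sup>2 - \<kappa> * U i y) \<in> borel_measurable Q" using i by measurable
      show "\<bar>(D i y)\<^sup>2 - \<kappa> * U i y\<bar> \<le> \<kappa>\<^sup>2 + \<kappa> * (3 * \<kappa>)" for y
      proof -
        have "(D i y)\<^sup>2 \<le> \<kappa>\<^sup>2" using Db[OF i, of y] by (simp add: abs_le_square_iff[symmetric])
        moreover have "0 \<le> (D i y)\<^sup>2" by simp
        moreover have "\<kappa> * U i y \<le> \<kappa> * (3 * \<kappa>)" "0 \<le> \<kappa> * U i y"
          using U[OF i, of y] \<kappa>_nonneg by (auto intro: mult_left_mono)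
        ultimately show ?thesis by linarith
      qed
      show "(\<integral>z. exp (t * H (y(i := z))) * ((D i (y(i := z)))\<^sup>2 - \<kappa> * U i (y(i := z))) \<partial>N) \<le> 0" for y
        using tilted_second_moment[OF i, of t "\<lambda>j. h (y j)"] t
        unfolding D_def U_def c_def H_upd fTh_upd f0h_upd by simp
    qed
    also have "(\<integral>y. exp (t * H y) * ((D i y)\<^sup>2 - \<kappa> * U i y) \<partial>Q)
        = (\<integral>y. exp (t * H y) * (D i y)\<^sup>2 - \<kappa> * (exp (t * H y) * U i y) \<partial>Q)"
      by (simp add: algebra_simps)
    finally show ?thesis using intD[OF i] intU[OF i] by simp
  qed
  have "H.entropy_exp t \<le> (\<Sum>i\<in>I. \<integral>y. exp (t * H y) * (t * D i y - 1 + exp (- (t * D i y))) \<partial>Q)"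
    unfolding D_def
  proof (rule entropy_leave_one_out[OF H.bounded_variable_axioms])
    show "c i \<in> borel_measurable Q" if "i \<in> I" for i using that by measurable
    show "0 \<le> c i y \<and> c i y \<le> real (card I) * \<kappa>" if "i \<in> I" for i y
      unfolding c_def using f_nonneg f_bound[of "(\<lambda>j. h (y j))(i := 0)"] h_bound fTh_bound[OF that]
      by (auto simp: le_max_iff_disj)
    show "c i (y(i := z)) = c i y" for i y z unfolding c_def fTh_upd f0h_upd ..
  qed
  also have "\<dots> \<le> (\<Sum>i\<in>I. \<integral>y. 3/4 * t\<^sup>2 * (exp (t * H y) * (D i y)\<^sup>2) \<partial>Q)"
  proof (intro sum_mono integral_mono)
    fix i y assume i: "i \<in> I"
    have tD: "\<bar>t * D i y\<bar> \<le> 2/3"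
    proof -
      have "\<bar>t * D i y\<bar> \<le> 1 * (2/3)" unfolding abs_mult using t Db[OF i, of y] \<kappa> by (intro mult_mono) auto
      then show ?thesis by simp
    qed
    have "t * D i y - 1 + exp (- (t * D i y)) \<le> 3/4 * (t * D i y)\<^sup>2" by (rule exp_two_thirds_quadratic[OF tD])
    then have "exp (t * H y) * (t * D i y - 1 + exp (- (t * D i y))) \<le> exp (t * H y) * (3/4 * (t * D i y)\<^sup>2)"
      by (intro mult_left_mono) auto
    then show "exp (t * H y) * (t * D i y - 1 + exp (- (t * D i y))) \<le> 3/4 * t\<^sup>2 * (exp (t * H y) * (D i y)\<^sup>2)"
      by (simp add: power_mult_distrib ac_simps)
  next
    fix i assume i: "i \<in> I"
    show "integrable Q (\<lambda>y. 3/4 * t\<^sup>2 * (exp (t * H y) * (D i y)\<^sup>2))" using intD[OF i] by simp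
    show "integrable Q (\<lambda>y. exp (t * H y) * (t * D i y - 1 + exp (- (t * D i y))))"
    proof (rule exp_tilt_integrable(1)[where R="t * \<kappa> + 1 + exp (t * \<kappa>)"])
      fix y
      have "\<bar>t * D i y\<bar> \<le> t * \<kappa>" unfolding abs_mult using t Db[OF i, of y] by (intro mult_mono) auto
      moreover from this have "exp (- (t * D i y)) \<le> exp (t * \<kappa>)" by (simp add: abs_le_iff)
      moreover have "0 < exp (- (t * D i y))" by simp
      ultimately show "\<bar>t * D i y - 1 + exp (- (t * D i y))\<bar> \<le> t * \<kappa> + 1 + exp (t * \<kappa>)" by linarith
    qed (use i in measurable)
  qed
  also have "\<dots> = 3/4 * t\<^sup>2 * (\<Sum>i\<in>I. \<integral>y. exp (t * H y) * (D i y)\<^sup>2 \<partial>Q)"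
    by (simp add: sum_distrib_left)
  also have "\<dots> \<le> 3/4 * t\<^sup>2 * (\<Sum>i\<in>I. \<kappa> * (\<integral>y. exp (t * H y) * U i y \<partial>Q))"
    by (intro mult_left_mono sum_mono second) auto
  also have "(\<Sum>i\<in>I. \<kappa> * (\<integral>y. exp (t * H y) * U i y \<partial>Q)) = \<kappa> * (\<integral>y. (\<Sum>i\<in>I. exp (t * H y) * U i y) \<partial>Q)"
    using intU by (simp add: sum_distrib_left)
  also have "3/4 * t\<^sup>2 * (\<kappa> * (\<integral>y. (\<Sum>i\<in>I. exp (t * H y) * U i y) \<partial>Q))
      \<le> 3/4 * t\<^sup>2 * (\<kappa> * (\<integral>y. 2 * (H y * exp (t * H y)) \<partial>Q))"
  proof (intro mult_left_mono[OF _ \<kappa>_nonneg] mult_left_mono integral_mono)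
    fix y
    have "(\<Sum>i\<in>I. U i y) \<le> 2 * H y" unfolding U_def H_def by (rule sum_f_diff)
    then have "exp (t * H y) * (\<Sum>i\<in>I. U i y) \<le> exp (t * H y) * (2 * H y)" by (intro mult_left_mono) auto
    then show "(\<Sum>i\<in>I. exp (t * H y) * U i y) \<le> 2 * (H y * exp (t * H y))"
      unfolding sum_distrib_left[symmetric] by (simp only: mult.commute mult.left_commute)
  qed (use intU H.mgf'_integrable in auto)
  also have "(\<integral>y. 2 * (H y * exp (t * H y)) \<partial>Q) = 2 * H.mgf' t" unfolding H.mgf'_def by simp
  also have "3/4 * t\<^sup>2 * (\<kappa> * (2 * H.mgf' t)) \<le> 3/4 * t\<^sup>2 * (2/3 * (2 * H.mgf' t))"
    using \<kappa> H.mgf'_nonneg by (intro mult_left_mono mult_right_mono) auto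
  finally show ?thesis by simp
qed

text \<open>As 3 \<kappa> \<le> 1, the increments lie in [0, 1], where convexity bounds the
  exponential remainder by a linear function of them. They can then be summed directly, without a
  second moment.\<close>

lemma entropy_H_lower:
  assumes \<kappa>: "\<kappa> \<le> 1/3" and t: "0 < t" "t < 1"
  shows "H.entropy_exp (- t) \<le> t\<^sup>2 / (1 - t) * H.mgf' (- t)"
proof -
  note [measurable] = H_measurable
  define U where "U i y = H y - fT i (\<lambda>j. h (y j))" for i y
  have [measurable]: "U i \<in> borel_measurable Q" if "i \<in> I" for i
    using fTh_measurable[OF that] unfolding U_def by measurable
  have U: "0 \<le> U i y" "U i y \<le> 1" if "i \<in> I" for i y
    using fT_le_f[OF that, of "\<lambda>j. h (y j)"] f_fT_diff_le[OF that, of "\<lambda>j. h (y j)"] h_bound \<kappa>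
    unfolding U_def H_def by auto
  have intU: "integrable Q (\<lambda>y. exp (- t * H y) * U i y)" if "i \<in> I" for i
    by (rule exp_tilt_integrable(1)[where R=1]) (use that U[OF that] in \<open>auto simp: abs_le_iff intro: order_trans\<close>)
  define p where "p = exp t - 1 - t"
  have p: "0 \<le> p" unfolding p_def using exp_ge_add_one_self[of t] by linarith
  have "H.entropy_exp (- t)
      \<le> (\<Sum>i\<in>I. \<integral>y. exp (- t * H y) * (- t * U i y - 1 + exp (- (- t * U i y))) \<partial>Q)"
    unfolding U_def
    by (rule entropy_leave_one_out[OF H.bounded_variable_axioms])
       (use fTh_measurable fT_nonneg fTh_bound fTh_upd in auto)
  also have "\<dots> \<le> (\<Sum>i\<in>I. \<integral>y. p * (exp (- t * H y) * U i y) \<partial>Q)"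
  proof (intro sum_mono integral_mono)
    fix i y assume i: "i \<in> I"
    have "- t * U i y - 1 + exp (- (- t * U i y)) \<le> p * U i y"
      using exp_minus_chord[OF U[OF i], of t y] unfolding p_def by simp
    then have "exp (- t * H y) * (- t * U i y - 1 + exp (- (- t * U i y))) \<le> exp (- t * H y) * (p * U i y)"
      by (intro mult_left_mono) auto
    then show "exp (- t * H y) * (- t * U i y - 1 + exp (- (- t * U i y))) \<le> p * (exp (- t * H y) * U i y)"
      by (simp add: ac_simps)
  next
    fix i assume i: "i \<in> I"
    show "integrable Q (\<lambda>y. p * (exp (- t * H y) * U i y))" using intU[OF i] by simp
    show "integrable Q (\<lambda>y. exp (- t * H y) * (- t * U i y - 1 + exp (- (- t * U i y))))"
    proof (rule exp_tilt_integrable(1)[where R="t + 1 + exp t"])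
      fix y
      have "0 \<le> t * U i y" "t * U i y \<le> t * 1" using U[OF i, of y] t by (auto intro: mult_left_mono)
      moreover from this have "exp (- (- t * U i y)) \<le> exp t" by simp
      moreover have "0 < exp (- (- t * U i y))" by simp
      ultimately show "\<bar>- t * U i y - 1 + exp (- (- t * U i y))\<bar> \<le> t + 1 + exp t" by linarith
    qed (use i in measurable)
  qed
  also have "\<dots> = p * (\<integral>y. (\<Sum>i\<in>I. exp (- t * H y) * U i y) \<partial>Q)"
    using intU by (simp add: sum_distrib_left)
  also have "\<dots> \<le> p * (\<integral>y. 2 * (H y * exp (- t * H y)) \<partial>Q)"
  proof (intro mult_left_mono[OF _ p] integral_mono)
    fix y
    have "(\<Sum>i\<in>I. U i y) \<le> 2 * H y" unfolding U_def H_def by (rule sum_f_diff)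
    then have "exp (- t * H y) * (\<Sum>i\<in>I. U i y) \<le> exp (- t * H y) * (2 * H y)" by (intro mult_left_mono) auto
    then show "(\<Sum>i\<in>I. exp (- t * H y) * U i y) \<le> 2 * (H y * exp (- t * H y))"
      unfolding sum_distrib_left[symmetric] by (simp only: mult.commute mult.left_commute)
  qed (use intU H.mgf'_integrable[of "- t"] in auto)
  also have "\<dots> = 2 * p * H.mgf' (- t)" unfolding H.mgf'_def by simp
  also have "\<dots> \<le> t\<^sup>2 / (1 - t) * H.mgf' (- t)"
    unfolding p_def using exp_remainder_half[of t] t H.mgf'_nonneg by (intro mult_right_mono) auto
  finally show ?thesis .
qed

lemma H_upper_tail:
  assumes \<kappa>: "\<kappa> \<le> 2/3" and x: "0 < x"
  defines "m \<equiv> \<integral>y. H y \<partial>Q"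
  shows "Q.prob {y \<in> space Q. m + 2 * sqrt (m * x) + x < H y} \<le> exp (- x)"
proof -
  have "2 * sqrt (m * x) = sqrt (2 * (0 + 2 * m) * x)"
    using real_sqrt_mult[of 4 "m * x"] by (simp add: ac_simps)
  then show ?thesis
    using H.upper_tail[of 0, OF _ order_refl x] entropy_H_upper[OF \<kappa>] unfolding m_def by simp
qed

lemma H_lower_tail:
  assumes \<kappa>: "\<kappa> \<le> 1/3" and x: "0 < x"
  defines "m \<equiv> \<integral>y. H y \<partial>Q"
  shows "Q.prob {y \<in> space Q. H y < m - 2 * sqrt (m * x)} \<le> exp (- x)"
  unfolding m_def by (rule H.lower_tail_no_variance[OF entropy_H_lower[OF \<kappa>] x]) auto

end

subsection \<open>Symmetrisation by exchangeable multipliers\<close>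

context multipliers
begin

section \<open>Contraction of the coefficients\<close>

lemma shifted_norm_integrable: "integrable N (\<lambda>z. norm (v + a *\<^sub>R h z))"
proof (rule N.bounded_integrable[where B="norm v + \<bar>a\<bar>"])
  show "(\<lambda>z. norm (v + a *\<^sub>R h z)) \<in> borel_measurable N"
    by (intro weakly_measurable_norm[OF sep] weakly_measurable_add weakly_measurable_const
        weakly_measurable_scaleR h_measurable borel_measurable_const)
  show "\<bar>norm (v + a *\<^sub>R h z)\<bar> \<le> norm v + \<bar>a\<bar>" for z
  proof -
    have "norm (v + a *\<^sub>R h z) \<le> norm v + norm (a *\<^sub>R h z)" by (rule norm_triangle_ineq)
    also have "norm (a *\<^sub>R h z) \<le> \<bar>a\<bar> * 1" unfolding norm_scaleR by (intro mult_left_mono h_bound) auto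
    finally show ?thesis by simp
  qed
qed

text \<open>The contraction principle for one resampled vector, as a property of the factor c. A
  centred law admits [0, 1], a symmetric one [-1, 1]; this difference accounts for the factor 2 in
  the leading constants.\<close>

definition contracts :: "real \<Rightarrow> bool" where
  "contracts c \<longleftrightarrow> (\<forall>v a. (\<integral>z. norm (v + (c * a) *\<^sub>R h z) \<partial>N) \<le> (\<integral>z. norm (v + a *\<^sub>R h z) \<partial>N))"

text \<open>v + c a h is the convex combination of v and v + a h, and norm v is itself at most the
  mean of norm (v + a h).\<close>

lemma contracts_unit_interval:
  assumes c: "0 \<le> c" "c \<le> 1"
  shows "contracts c"
  unfolding contracts_def
proof (intro allI)
  fix v a
  have "(\<integral>z. norm (v + (c * a) *\<^sub>R h z) \<partial>N) \<le> (\<integral>z. (1 - c) * norm v + c * norm (v + a *\<^sub>R h z) \<partial>N)"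
  proof (rule integral_mono)
    fix z
    have "v + (c * a) *\<^sub>R h z = (1 - c) *\<^sub>R v + c *\<^sub>R (v + a *\<^sub>R h z)" by (simp add: algebra_simps)
    then show "norm (v + (c * a) *\<^sub>R h z) \<le> (1 - c) * norm v + c * norm (v + a *\<^sub>R h z)"
      using norm_triangle_ineq[of "(1 - c) *\<^sub>R v" "c *\<^sub>R (v + a *\<^sub>R h z)"] c by simp
  qed (use shifted_norm_integrable in auto)
  also have "\<dots> = (1 - c) * norm v + c * (\<integral>z. norm (v + a *\<^sub>R h z) \<partial>N)"
    using shifted_norm_integrable by (simp add: N.prob_space)
  also have "\<dots> \<le> (1 - c) * (\<integral>z. norm (v + a *\<^sub>R h z) \<partial>N) + c * (\<integral>z. norm (v + a *\<^sub>R h z) \<partial>N)"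
    using c by (intro add_right_mono mult_left_mono norm_le_resampled_scaled) auto
  finally show "(\<integral>z. norm (v + (c * a) *\<^sub>R h z) \<partial>N) \<le> (\<integral>z. norm (v + a *\<^sub>R h z) \<partial>N)"
    by (simp add: algebra_simps)
qed

text \<open>Invariance of mean norms under a change of sign, implied by equality of the laws of h
  and -h and sufficient for reflecting a coefficient.\<close>

definition symmetric_law :: bool where
  "symmetric_law \<longleftrightarrow> (\<forall>v a. (\<integral>z. norm (v - a *\<^sub>R h z) \<partial>N) = (\<integral>z. norm (v + a *\<^sub>R h z) \<partial>N))"

lemma contracts_symmetric:
  assumes sym: "symmetric_law" and c: "\<bar>c\<bar> \<le> 1"
  shows "contracts c"
proof (cases "0 \<le> c")
  case True then show ?thesis using c by (intro contracts_unit_interval) auto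
next
  case False
  have "contracts (- c)" using False c by (intro contracts_unit_interval) auto
  moreover have "(\<integral>z. norm (v + (c * a) *\<^sub>R h z) \<partial>N) = (\<integral>z. norm (v + (- c * a) *\<^sub>R h z) \<partial>N)" for v a
    using sym[unfolded symmetric_law_def, rule_format, of v "- c * a"] by simp
  ultimately show ?thesis unfolding contracts_def by simp
qed

definition \<Phi> :: "('i \<Rightarrow> real) \<Rightarrow> real" where "\<Phi> a = (\<integral>y. norm (\<Sum>i\<in>I. a i *\<^sub>R h (y i)) \<partial>Q)"

lemma combination_h_measurable: "(\<lambda>y. norm (\<Sum>i\<in>I. a i *\<^sub>R h (y i))) \<in> borel_measurable Q"
  by (intro weakly_measurable_norm[OF sep] weakly_measurable_sum weakly_measurable_scaleR
      h_coord_measurable borel_measurable_const)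

lemma combination_h_bound: "norm (\<Sum>i\<in>I. a i *\<^sub>R h (y i)) \<le> (\<Sum>i\<in>I. \<bar>a i\<bar>)"
proof -
  have "norm (\<Sum>i\<in>I. a i *\<^sub>R h (y i)) \<le> (\<Sum>i\<in>I. \<bar>a i\<bar> * norm (h (y i)))" by (rule combination_bound)
  also have "\<dots> \<le> (\<Sum>i\<in>I. \<bar>a i\<bar> * 1)" by (intro sum_mono mult_left_mono h_bound) auto
  finally show ?thesis by simp
qed

lemma combination_h_integrable: "integrable Q (\<lambda>y. norm (\<Sum>i\<in>I. a i *\<^sub>R h (y i)))"
  by (rule Q.bounded_integrable[OF combination_h_measurable, where B="\<Sum>i\<in>I. \<bar>a i\<bar>"])
     (use combination_h_bound in simp)

lemma \<Phi>_contract_one: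
  assumes i: "i \<in> I" and c: "contracts c"
  shows "\<Phi> (a(i := c * a i)) \<le> \<Phi> a"
proof -
  define G where "G y = norm (\<Sum>j\<in>I. (a(i := c * a i)) j *\<^sub>R h (y j)) - norm (\<Sum>j\<in>I. a j *\<^sub>R h (y j))" for y
  have "(\<integral>y. G y \<partial>Q) \<le> 0"
  proof (rule resample_nonpos[OF i])
    show "G \<in> borel_measurable Q" unfolding G_def by (intro borel_measurable_diff combination_h_measurable)
    show "\<bar>G y\<bar> \<le> (\<Sum>j\<in>I. \<bar>(a(i := c * a i)) j\<bar>) + (\<Sum>j\<in>I. \<bar>a j\<bar>)" for y
    proof -
      have "\<bar>p - q\<bar> \<le> r + s" if "0 \<le> p" "0 \<le> q" "p \<le> r" "q \<le> s" for p q r s :: real using that by linarith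
      then show ?thesis unfolding G_def using combination_h_bound by (meson norm_ge_zero)
    qed
    fix y
    define v where "v = (\<Sum>j\<in>I - {i}. a j *\<^sub>R h (y j))"
    have e: "(\<Sum>j\<in>I. b j *\<^sub>R h ((y(i := z)) j)) = v + b i *\<^sub>R h z" if "\<And>j. j \<noteq> i \<Longrightarrow> b j = a j" for b z
    proof -
      have "(\<Sum>j\<in>I. b j *\<^sub>R h ((y(i := z)) j)) = b i *\<^sub>R h z + (\<Sum>j\<in>I - {i}. b j *\<^sub>R h ((y(i := z)) j))"
        by (subst sum.remove[OF finite_I i]) simp
      also have "(\<Sum>j\<in>I - {i}. b j *\<^sub>R h ((y(i := z)) j)) = v"
        unfolding v_def using that by (intro sum.cong) auto
      finally show ?thesis by (simp add: add.commute)
    qed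
    have "G (y(i := z)) = norm (v + (c * a i) *\<^sub>R h z) - norm (v + a i *\<^sub>R h z)" for z
      unfolding G_def using e[of "a(i := c * a i)" z] e[of a z] by simp
    then show "(\<integral>z. G (y(i := z)) \<partial>N) \<le> 0"
      using c shifted_norm_integrable unfolding contracts_def by simp
  qed
  then show ?thesis unfolding G_def \<Phi>_def using combination_h_integrable by simp
qed

lemma \<Phi>_contract:
  assumes "\<And>i. i \<in> I \<Longrightarrow> contracts (c i)"
  shows "\<Phi> (\<lambda>i. c i * a i) \<le> \<Phi> a"
proof -
  have "\<Phi> (\<lambda>i. if i \<in> J then c i * a i else a i) \<le> \<Phi> a" if "finite J" "J \<subseteq> I" for J
    using that
  proof (induction J rule: finite_induct)
    case empty then show ?case by simp
  next
    case (insert j J)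
    define a' where "a' i = (if i \<in> J then c i * a i else a i)" for i
    have "(\<lambda>i. if i \<in> insert j J then c i * a i else a i) = a'(j := c j * a' j)"
      unfolding a'_def using insert.hyps by auto
    then have "\<Phi> (\<lambda>i. if i \<in> insert j J then c i * a i else a i) \<le> \<Phi> a'"
      using \<Phi>_contract_one[of j "c j" a'] assms[of j] insert.prems by simp
    also have "\<dots> \<le> \<Phi> a" using insert unfolding a'_def by simp
    finally show ?case .
  qed
  from this[OF finite_I order_refl]
  have "\<Phi> (\<lambda>i. if i \<in> I then c i * a i else a i) \<le> \<Phi> a" .
  moreover have "\<Phi> (\<lambda>i. if i \<in> I then c i * a i else a i) = \<Phi> (\<lambda>i. c i * a i)"
    unfolding \<Phi>_def by (intro Bochner_Integration.integral_cong refl arg_cong[where f=norm] sum.cong) auto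
  ultimately show ?thesis by simp
qed

lemma \<Phi>_const: "\<Phi> (\<lambda>_. b) = \<bar>b\<bar> * (\<integral>y. Z y \<partial>Q)"
  unfolding \<Phi>_def Z_def by (simp add: scaleR_right.sum[symmetric])

lemma \<Phi>_Fubini:
  assumes a: "\<And>i. i \<in> I \<Longrightarrow> integrable P (a i)"
  shows "integrable P (\<lambda>\<omega>. \<Phi> (\<lambda>i. a i \<omega>))"
    "integrable Q (\<lambda>y. \<integral>\<omega>. norm (\<Sum>i\<in>I. a i \<omega> *\<^sub>R h (y i)) \<partial>P)"
    "(\<integral>\<omega>. \<Phi> (\<lambda>i. a i \<omega>) \<partial>P) = (\<integral>y. (\<integral>\<omega>. norm (\<Sum>i\<in>I. a i \<omega> *\<^sub>R h (y i)) \<partial>P) \<partial>Q)"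
proof -
  interpret QP: pair_sigma_finite Q P by standard
  have meas: "(\<lambda>y. \<integral>\<omega>. norm (\<Sum>i\<in>I. a i \<omega> *\<^sub>R h (y i)) \<partial>P) \<in> borel_measurable Q"
    "(\<lambda>(y, \<omega>). norm (\<Sum>i\<in>I. a i \<omega> *\<^sub>R h (y i))) \<in> borel_measurable (Q \<Otimes>\<^sub>M P)"
    by (rule f_measurable_param; use a h_coord_measurable in auto)+
  have i1: "integrable P (\<lambda>\<omega>. norm (\<Sum>i\<in>I. a i \<omega> *\<^sub>R h (y i)))" for y
    by (rule combination_integrable[OF finite_I a])
  have bound: "(\<integral>\<omega>. norm (\<Sum>i\<in>I. a i \<omega> *\<^sub>R h (y i)) \<partial>P) \<le> (\<integral>\<omega>. (\<Sum>i\<in>I. \<bar>a i \<omega>\<bar>) \<partial>P)" for y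
    by (rule integral_mono[OF i1 _ combination_h_bound]) (use a in auto)
  show i2: "integrable Q (\<lambda>y. \<integral>\<omega>. norm (\<Sum>i\<in>I. a i \<omega> *\<^sub>R h (y i)) \<partial>P)"
    by (rule Q.bounded_integrable[OF meas(1)]) (use bound in simp)
  have int: "integrable (Q \<Otimes>\<^sub>M P) (\<lambda>(y, \<omega>). norm (\<Sum>i\<in>I. a i \<omega> *\<^sub>R h (y i)))"
    by (rule QP.Fubini_integrable[OF meas(2)]) (use i1 i2 in auto)
  show "integrable P (\<lambda>\<omega>. \<Phi> (\<lambda>i. a i \<omega>))" using QP.integrable_snd[OF int] unfolding \<Phi>_def by simp
  show "(\<integral>\<omega>. \<Phi> (\<lambda>i. a i \<omega>) \<partial>P) = (\<integral>y. (\<integral>\<omega>. norm (\<Sum>i\<in>I. a i \<omega> *\<^sub>R h (y i)) \<partial>P) \<partial>Q)"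
    using QP.Fubini_integral[OF int] unfolding \<Phi>_def by simp
qed

lemma H_expectation: "(\<integral>y. H y \<partial>Q) = (\<integral>\<omega>. \<Phi> (\<lambda>i. \<xi> i \<omega>) \<partial>P)"
  using \<Phi>_Fubini(3)[of \<xi>] \<xi>_integrable unfolding H_def f_def S_def by simp

text \<open>Jensen's inequality in the multipliers: a functional norming the averaged sum is
  integrated over the multipliers.\<close>

lemma norm_expectation_le:
  assumes p: "\<And>i. i \<in> I \<Longrightarrow> integrable P (p i)"
  shows "norm (\<Sum>i\<in>I. (\<integral>\<omega>. p i \<omega> \<partial>P) *\<^sub>R (v i :: 'a)) \<le> (\<integral>\<omega>. norm (\<Sum>i\<in>I. p i \<omega> *\<^sub>R v i) \<partial>P)"
proof -
  define u where "u = (\<Sum>i\<in>I. (\<integral>\<omega>. p i \<omega> \<partial>P) *\<^sub>R v i)"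
  obtain l where l: "l \<in> dual_ball" "l u = norm u" by (rule norming_functional)
  note lin = dual_ball_linear[OF l(1)]
  have "norm u = (\<Sum>i\<in>I. (\<integral>\<omega>. p i \<omega> \<partial>P) * l (v i))"
    unfolding l(2)[symmetric] unfolding u_def by (simp add: linear_sum[OF lin] linear_cmul[OF lin])
  also have "\<dots> = (\<integral>\<omega>. (\<Sum>i\<in>I. p i \<omega> * l (v i)) \<partial>P)" using p by simp
  also have "\<dots> \<le> (\<integral>\<omega>. norm (\<Sum>i\<in>I. p i \<omega> *\<^sub>R v i) \<partial>P)"
  proof (rule integral_mono)
    fix \<omega>
    have "(\<Sum>i\<in>I. p i \<omega> * l (v i)) = l (\<Sum>i\<in>I. p i \<omega> *\<^sub>R v i)"
      by (simp add: linear_sum[OF lin] linear_cmul[OF lin])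
    also have "\<dots> \<le> norm (\<Sum>i\<in>I. p i \<omega> *\<^sub>R v i)" by (rule dual_ball_le[OF l(1)])
    finally show "(\<Sum>i\<in>I. p i \<omega> * l (v i)) \<le> norm (\<Sum>i\<in>I. p i \<omega> *\<^sub>R v i)" .
  qed (use p combination_integrable[OF finite_I p] in auto)
  finally show ?thesis unfolding u_def .
qed

text \<open>Replacing \<open>\<xi>\<close> by \<open>p = c \<xi>\<close> (its positive part, or its absolute value for a symmetric law)
  decreases \<open>\<Phi>\<close>, and \<open>p\<close> may then be averaged out by convexity.\<close>

lemma symmetrisation_lower:
  assumes p: "\<And>i. i \<in> I \<Longrightarrow> integrable P (p i)" "\<And>i. i \<in> I \<Longrightarrow> (\<integral>\<omega>. p i \<omega> \<partial>P) = \<kappa>'"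
    and \<kappa>': "0 \<le> \<kappa>'"
    and c: "\<And>i \<omega>. contracts (c i \<omega>)" "\<And>i \<omega>. p i \<omega> = c i \<omega> * \<xi> i \<omega>"
  shows "\<kappa>' * (\<integral>y. Z y \<partial>Q) \<le> (\<integral>y. H y \<partial>Q)"
proof -
  have "\<kappa>' * (\<integral>y. Z y \<partial>Q) = (\<integral>y. norm (\<Sum>i\<in>I. (\<integral>\<omega>. p i \<omega> \<partial>P) *\<^sub>R h (y i)) \<partial>Q)"
    unfolding Z_def using p(2) \<kappa>' by (simp add: scaleR_right.sum[symmetric])
  also have "\<dots> \<le> (\<integral>y. (\<integral>\<omega>. norm (\<Sum>i\<in>I. p i \<omega> *\<^sub>R h (y i)) \<partial>P) \<partial>Q)"
    by (intro integral_mono combination_h_integrable \<Phi>_Fubini(2) norm_expectation_le p(1))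
  also have "\<dots> = (\<integral>\<omega>. \<Phi> (\<lambda>i. p i \<omega>) \<partial>P)" by (rule \<Phi>_Fubini(3)[symmetric]) (rule p(1))
  also have "\<dots> \<le> (\<integral>\<omega>. \<Phi> (\<lambda>i. \<xi> i \<omega>) \<partial>P)"
  proof (intro integral_mono \<Phi>_Fubini(1) p(1) \<xi>_integrable)
    fix \<omega>
    show "\<Phi> (\<lambda>i. p i \<omega>) \<le> \<Phi> (\<lambda>i. \<xi> i \<omega>)" unfolding c(2) by (rule \<Phi>_contract) (rule c(1))
  qed
  finally show ?thesis unfolding H_expectation .
qed

text \<open>The positive part (|\<xi>| + \<xi>) / 2 is \<xi> times 0 or 1, and its mean is \<kappa>
  / 2 because \<xi> is centred.\<close>

lemma symmetrisation_lower_centred: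
  assumes "\<And>i. i \<in> I \<Longrightarrow> (\<integral>\<omega>. \<xi> i \<omega> \<partial>P) = 0"
  shows "\<kappa> / 2 * (\<integral>y. Z y \<partial>Q) \<le> (\<integral>y. H y \<partial>Q)"
proof (rule symmetrisation_lower[where p="\<lambda>i \<omega>. (\<bar>\<xi> i \<omega>\<bar> + \<xi> i \<omega>) / 2"
      and c="\<lambda>i \<omega>. if 0 \<le> \<xi> i \<omega> then 1 else 0"])
  show "contracts (if 0 \<le> \<xi> i \<omega> then 1 else 0)" for i \<omega> by (rule contracts_unit_interval) auto
qed (use assms \<xi>_integrable \<xi>_abs \<kappa>_nonneg in auto)

text \<open>Factors -1 are now allowed, so |\<xi>| itself, of mean \<kappa>, replaces its positive
  part.\<close>

lemma symmetrisation_lower_symmetric: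
  assumes "symmetric_law"
  shows "\<kappa> * (\<integral>y. Z y \<partial>Q) \<le> (\<integral>y. H y \<partial>Q)"
proof (rule symmetrisation_lower[where p="\<lambda>i \<omega>. \<bar>\<xi> i \<omega>\<bar>" and c="\<lambda>i \<omega>. if 0 \<le> \<xi> i \<omega> then 1 else - 1"])
  show "contracts (if 0 \<le> \<xi> i \<omega> then 1 else - 1)" for i \<omega> by (rule contracts_symmetric[OF assms]) auto
qed (use \<xi>_integrable \<xi>_abs \<kappa>_nonneg in auto)

lemma \<Phi>_le_const:
  assumes b: "0 < b" and a: "\<And>i. i \<in> I \<Longrightarrow> contracts (a i / b)"
  shows "\<Phi> a \<le> b * (\<integral>y. Z y \<partial>Q)"
proof -
  have "\<Phi> (\<lambda>i. a i / b * b) \<le> \<Phi> (\<lambda>_. b)" using a by (rule \<Phi>_contract)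
  then show ?thesis using b unfolding \<Phi>_const by simp
qed

text \<open>Positive and negative parts of the multipliers have coefficients in [0, b]; each
  contributes b times the mean of \<open>Z\<close>, whence the factor 2. Under symmetry \<xi> / b in
  [-1, 1] contracts without splitting.\<close>

lemma symmetrisation_upper:
  assumes b: "0 < b" and \<xi>: "\<And>i. i \<in> I \<Longrightarrow> AE \<omega> in P. \<bar>\<xi> i \<omega>\<bar> \<le> b"
  shows "(\<integral>y. H y \<partial>Q) \<le> 2 * b * (\<integral>y. Z y \<partial>Q)"
    "symmetric_law \<Longrightarrow> (\<integral>y. H y \<partial>Q) \<le> b * (\<integral>y. Z y \<partial>Q)"
proof -
  have all: "AE \<omega> in P. \<forall>i\<in>I. \<bar>\<xi> i \<omega>\<bar> \<le> b" using \<xi> finite_I by (simp add: AE_ball_countable countable_finite)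
  have int: "integrable P (\<lambda>\<omega>. \<Phi> (\<lambda>i. \<xi> i \<omega>))" by (rule \<Phi>_Fubini(1)) (rule \<xi>_integrable)
  have scaled: "0 \<le> \<bar>r\<bar> / b" "\<bar>r\<bar> / b \<le> 1" if "\<bar>r\<bar> \<le> b" for r :: real using that b by auto
  have "AE \<omega> in P. \<Phi> (\<lambda>i. \<xi> i \<omega>) \<le> 2 * b * (\<integral>y. Z y \<partial>Q)"
    using all
  proof eventually_elim
    case (elim \<omega>)
    define pos where "pos i = max (\<xi> i \<omega>) 0" for i
    define neg where "neg i = max (- \<xi> i \<omega>) 0" for i
    have "\<Phi> (\<lambda>i. \<xi> i \<omega>) \<le> (\<integral>y. norm (\<Sum>i\<in>I. pos i *\<^sub>R h (y i)) + norm (\<Sum>i\<in>I. neg i *\<^sub>R h (y i)) \<partial>Q)"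
      unfolding \<Phi>_def
    proof (intro integral_mono combination_h_integrable Bochner_Integration.integrable_add)
      fix y
      have "(\<Sum>i\<in>I. \<xi> i \<omega> *\<^sub>R h (y i)) = (\<Sum>i\<in>I. pos i *\<^sub>R h (y i)) - (\<Sum>i\<in>I. neg i *\<^sub>R h (y i))"
        unfolding sum_subtractf[symmetric] scaleR_diff_left[symmetric]
        by (intro sum.cong refl) (auto simp: pos_def neg_def max_def)
      then show "norm (\<Sum>i\<in>I. \<xi> i \<omega> *\<^sub>R h (y i)) \<le> norm (\<Sum>i\<in>I. pos i *\<^sub>R h (y i)) + norm (\<Sum>i\<in>I. neg i *\<^sub>R h (y i))"
        by (simp add: norm_triangle_ineq4)
    qed
    also have "\<dots> = \<Phi> pos + \<Phi> neg" unfolding \<Phi>_def using combination_h_integrable by simp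
    also have "\<Phi> pos \<le> b * (\<integral>y. Z y \<partial>Q)"
    proof (rule \<Phi>_le_const[OF b])
      fix i assume "i \<in> I"
      then have "\<bar>\<xi> i \<omega>\<bar> \<le> b" using elim by blast
      then show "contracts (pos i / b)" unfolding pos_def using b by (intro contracts_unit_interval) auto
    qed
    also have "\<Phi> neg \<le> b * (\<integral>y. Z y \<partial>Q)"
    proof (rule \<Phi>_le_const[OF b])
      fix i assume "i \<in> I"
      then have "\<bar>\<xi> i \<omega>\<bar> \<le> b" using elim by blast
      then show "contracts (neg i / b)" unfolding neg_def using b by (intro contracts_unit_interval) auto
    qed
    finally show ?case by simp
  qed
  from P.integral_le_const[OF int this] show "(\<integral>y. H y \<partial>Q) \<le> 2 * b * (\<integral>y. Z y \<partial>Q)"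
    unfolding H_expectation .
  assume sym: "symmetric_law"
  have "AE \<omega> in P. \<Phi> (\<lambda>i. \<xi> i \<omega>) \<le> b * (\<integral>y. Z y \<partial>Q)"
    using all
  proof eventually_elim
    case (elim \<omega>)
    show ?case
    proof (rule \<Phi>_le_const[OF b])
      fix i assume "i \<in> I"
      then have "\<bar>\<xi> i \<omega>\<bar> \<le> b" using elim by blast
      then show "contracts (\<xi> i \<omega> / b)" using b by (intro contracts_symmetric[OF sym]) (simp add: abs_divide)
    qed
  qed
  from P.integral_le_const[OF int this] show "(\<integral>y. H y \<partial>Q) \<le> b * (\<integral>y. Z y \<partial>Q)"
    unfolding H_expectation .
qed

text \<open>The tails of \<open>H\<close> are proved for small \<kappa>; division by r brings any
  positive \<kappa> into that range.\<close>

lemma multipliers_scaled: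
  assumes "0 < r"
  shows "multipliers N I h P (\<lambda>i \<omega>. \<xi> i \<omega> / r) (\<kappa> / r)"
    "multipliers.H I h P (\<lambda>i \<omega>. \<xi> i \<omega> / r) y = H y / r"
proof -
  have sc: "(\<Sum>j\<in>I. (a j / r) *\<^sub>R v j) = (1 / r) *\<^sub>R (\<Sum>j\<in>I. a j *\<^sub>R v j)" for a and v :: "'i \<Rightarrow> 'a"
    by (simp add: scaleR_right.sum)
  interpret S: multipliers N I h P "\<lambda>i \<omega>. \<xi> i \<omega> / r" "\<kappa> / r"
  proof
    show "AE \<omega> in P. (\<Sum>i\<in>I. \<xi> i \<omega> / r) = 0"
      using \<xi>_sum by eventually_elim (simp add: sum_divide_distrib[symmetric])
  qed (use assms \<xi>_integrable \<xi>_abs \<xi>_swap I_nonempty in \<open>auto simp: sc\<close>)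
  show "multipliers N I h P (\<lambda>i \<omega>. \<xi> i \<omega> / r) (\<kappa> / r)" by (rule S.multipliers_axioms)
  show "S.H y = H y / r"
    unfolding S.H_def S.f_def S.S_def H_def f_def S_def sc using assms by simp
qed

lemma H_lower_tail_scaled:
  assumes \<kappa>: "0 < \<kappa>" and x: "0 < x"
  defines "\<phi> \<equiv> \<integral>y. H y \<partial>Q"
  shows "Q.prob {y \<in> space Q. H y < \<phi> - 2 * sqrt (\<phi> * (3 * \<kappa> * x))} \<le> exp (- x)"
proof -
  define r where "r = 3 * \<kappa>"
  have r: "0 < r" unfolding r_def using \<kappa> by simp
  interpret S: multipliers N I h P "\<lambda>i \<omega>. \<xi> i \<omega> / r" "\<kappa> / r" by (rule multipliers_scaled(1)[OF r])
  have H: "S.H y = H y / r" for y by (rule multipliers_scaled(2)[OF r])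
  have "Q.prob {y \<in> space Q. S.H y < (\<integral>y. S.H y \<partial>Q) - 2 * sqrt ((\<integral>y. S.H y \<partial>Q) * x)} \<le> exp (- x)"
    by (rule S.H_lower_tail[OF _ x]) (use \<kappa> in \<open>simp add: r_def\<close>)
  moreover have "(S.H y < (\<integral>y. S.H y \<partial>Q) - 2 * sqrt ((\<integral>y. S.H y \<partial>Q) * x)) \<longleftrightarrow>
      (H y < \<phi> - 2 * sqrt (\<phi> * (3 * \<kappa> * x)))" for y
  proof -
    have "sqrt (\<phi> / r * x) = sqrt (\<phi> * (r * x)) / r"
    proof -
      have "\<phi> / r * x = \<phi> * (r * x) / r\<^sup>2" using r by (simp add: power2_eq_square)
      then show ?thesis using r by (simp add: real_sqrt_divide)
    qed
    then have "\<phi> / r - 2 * sqrt (\<phi> / r * x) = (\<phi> - 2 * sqrt (\<phi> * (r * x))) / r"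
      by (simp add: diff_divide_distrib)
    then show ?thesis unfolding H using r unfolding \<phi>_def[symmetric] r_def[symmetric]
      by (simp add: divide_less_cancel \<phi>_def[symmetric])
  qed
  ultimately show ?thesis by simp
qed

lemma H_upper_tail_scaled:
  assumes \<kappa>: "0 < \<kappa>" and x: "0 < x"
  defines "\<phi> \<equiv> \<integral>y. H y \<partial>Q"
  shows "Q.prob {y \<in> space Q. \<phi> + 2 * sqrt (\<phi> * (3/2 * \<kappa> * x)) + 3/2 * \<kappa> * x < H y} \<le> exp (- x)"
proof -
  define r where "r = 3/2 * \<kappa>"
  have r: "0 < r" unfolding r_def using \<kappa> by simp
  interpret S: multipliers N I h P "\<lambda>i \<omega>. \<xi> i \<omega> / r" "\<kappa> / r" by (rule multipliers_scaled(1)[OF r])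
  have H: "S.H y = H y / r" for y by (rule multipliers_scaled(2)[OF r])
  have "Q.prob {y \<in> space Q. (\<integral>y. S.H y \<partial>Q) + 2 * sqrt ((\<integral>y. S.H y \<partial>Q) * x) + x < S.H y} \<le> exp (- x)"
    by (rule S.H_upper_tail[OF _ x]) (use \<kappa> in \<open>simp add: r_def\<close>)
  moreover have "((\<integral>y. S.H y \<partial>Q) + 2 * sqrt ((\<integral>y. S.H y \<partial>Q) * x) + x < S.H y) \<longleftrightarrow>
      (\<phi> + 2 * sqrt (\<phi> * (3/2 * \<kappa> * x)) + 3/2 * \<kappa> * x < H y)" for y
  proof -
    have "sqrt (\<phi> / r * x) = sqrt (\<phi> * (r * x)) / r"
    proof -
      have "\<phi> / r * x = \<phi> * (r * x) / r\<^sup>2" using r by (simp add: power2_eq_square)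
      then show ?thesis using r by (simp add: real_sqrt_divide)
    qed
    then have "\<phi> / r + 2 * sqrt (\<phi> / r * x) + x = (\<phi> + 2 * sqrt (\<phi> * (r * x)) + r * x) / r"
      using r by (simp add: add_divide_distrib)
    then show ?thesis unfolding H using r unfolding \<phi>_def[symmetric] r_def[symmetric]
      by (simp add: divide_less_cancel \<phi>_def[symmetric])
  qed
  ultimately show ?thesis by simp
qed

end

subsection \<open>Combining the deviations\<close>

lemma two_sqrt_le:
  fixes a b t :: real
  assumes "0 \<le> a" "0 \<le> b" "0 < t"
  shows "2 * sqrt (a * b) \<le> t * a + b / t"
proof -
  have "0 \<le> (sqrt (t * a) - sqrt (b / t))\<^sup>2" by simp
  also have "\<dots> = t * a + b / t - 2 * (sqrt (t * a) * sqrt (b / t))"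
    using assms by (simp add: power2_diff)
  also have "sqrt (t * a) * sqrt (b / t) = sqrt (a * b)"
    using assms by (simp add: real_sqrt_mult[symmetric])
  finally show ?thesis by simp
qed

lemma sqrt_variance_split:
  fixes S m x :: real
  assumes "0 \<le> S" "0 \<le> m" "0 \<le> x"
  shows "sqrt (2 * (S + 2 * m) * x) \<le> sqrt (2 * S * x) + 2 * sqrt (m * x)"
proof -
  have "sqrt (2 * (S + 2 * m) * x) = sqrt (2 * S * x + 4 * (m * x))" by (simp add: algebra_simps)
  also have "\<dots> \<le> sqrt (2 * S * x) + sqrt (4 * (m * x))"
    using assms by (intro sqrt_add_le_add_sqrt) auto
  also have "sqrt (4 * (m * x)) = 2 * sqrt (m * x)" by (simp add: real_sqrt_mult)
  finally show ?thesis .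
qed

text \<open>The square roots are split with weight \<theta> for \<open>Z\<close> and \<theta> / (1 +
  \<theta>) for \<open>H\<close>. The latter leaves 3 \<kappa> (1 + \<theta>)^2 / \<theta>, at most
  6 \<kappa>' (1 + \<theta>)^2 / \<theta>; after multiplication by (1 + \<theta>) / \<kappa>' this
  is 6 / \<theta> + 18 + 18 \<theta> + 6 \<theta>^2, and \<open>Z\<close> adds 1 / \<theta> +
  1.\<close>

lemma combine_upper:
  fixes Z H m \<phi> S x \<kappa> \<kappa>' \<theta> :: real
  assumes Z: "Z \<le> m + sqrt (2 * (S + 2 * m) * x) + x"
    and H: "\<phi> - 2 * sqrt (\<phi> * (3 * \<kappa> * x)) \<le> H"
    and m\<phi>: "\<kappa>' * m \<le> \<phi>" and \<kappa>: "0 < \<kappa>" "\<kappa> / 2 \<le> \<kappa>'"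
    and nonneg: "0 \<le> S" "0 \<le> m" "0 \<le> \<phi>" "0 < x" and \<theta>: "0 < \<theta>"
  shows "Z \<le> (1 + \<theta>)\<^sup>2 * (1 / \<kappa>') * H + sqrt (2 * S * x) + (7 / \<theta> + 19 + 18 * \<theta> + 6 * \<theta>\<^sup>2) * x"
proof -
  have \<kappa>': "0 < \<kappa>'" using \<kappa> by linarith
  have "2 * sqrt (m * x) \<le> \<theta> * m + x / \<theta>" using nonneg \<theta> by (intro two_sqrt_le) auto
  then have 1: "Z \<le> (1 + \<theta>) * m + sqrt (2 * S * x) + (1 / \<theta> + 1) * x"
    using Z sqrt_variance_split[OF nonneg(1,2), of x] nonneg(4) by (simp add: algebra_simps)
  \<comment> \<open>Chosen so that (1 + \<theta>) (1 - \<eta>) = 1.\<close>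
  define \<eta> where "\<eta> = \<theta> / (1 + \<theta>)"
  have \<eta>: "0 < \<eta>" unfolding \<eta>_def using \<theta> by simp
  have "2 * sqrt (\<phi> * (3 * \<kappa> * x)) \<le> \<eta> * \<phi> + 3 * \<kappa> * x / \<eta>"
    using nonneg \<kappa> \<eta> by (intro two_sqrt_le) auto
  then have "(1 - \<eta>) * \<phi> \<le> H + 3 * \<kappa> * x / \<eta>" using H by (simp add: algebra_simps)
  then have "(1 + \<theta>) * ((1 - \<eta>) * \<phi>) \<le> (1 + \<theta>) * (H + 3 * \<kappa> * x / \<eta>)"
    using \<theta> by (intro mult_left_mono) auto
  moreover have "(1 + \<theta>) * ((1 - \<eta>) * \<phi>) = \<phi>" unfolding \<eta>_def using \<theta> by (simp add: field_simps)
  moreover have "(1 + \<theta>) * (3 * \<kappa> * x / \<eta>) = \<kappa> * (3 * x * (1 + \<theta>)\<^sup>2 / \<theta>)"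
    unfolding \<eta>_def using \<theta> by (simp add: field_simps power2_eq_square)
  ultimately have 2: "\<phi> \<le> (1 + \<theta>) * H + \<kappa> * (3 * x * (1 + \<theta>)\<^sup>2 / \<theta>)" by (simp add: distrib_left)
  have "\<kappa> * (3 * x * (1 + \<theta>)\<^sup>2 / \<theta>) \<le> (2 * \<kappa>') * (3 * x * (1 + \<theta>)\<^sup>2 / \<theta>)"
    using \<kappa> nonneg \<theta> by (intro mult_right_mono) auto
  also have "(2 * \<kappa>') * (3 * x * (1 + \<theta>)\<^sup>2 / \<theta>) = \<kappa>' * (6 * x * (1 + \<theta>)\<^sup>2 / \<theta>)" by simp
  finally have "\<kappa>' * m \<le> (1 + \<theta>) * H + \<kappa>' * (6 * x * (1 + \<theta>)\<^sup>2 / \<theta>)" using 2 m\<phi> by linarith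
  then have "m \<le> ((1 + \<theta>) * H + \<kappa>' * (6 * x * (1 + \<theta>)\<^sup>2 / \<theta>)) / \<kappa>'"
    using \<kappa>' by (simp add: pos_le_divide_eq mult.commute)
  also have "\<dots> = (1 + \<theta>) * (1 / \<kappa>') * H + 6 * x * (1 + \<theta>)\<^sup>2 / \<theta>" using \<kappa>' by (simp add: add_divide_distrib algebra_simps)
  finally have "(1 + \<theta>) * m \<le> (1 + \<theta>) * ((1 + \<theta>) * (1 / \<kappa>') * H + 6 * x * (1 + \<theta>)\<^sup>2 / \<theta>)"
    using \<theta> by (intro mult_left_mono) auto
  also have "\<dots> = (1 + \<theta>)\<^sup>2 * (1 / \<kappa>') * H + (6 / \<theta> + 18 + 18 * \<theta> + 6 * \<theta>\<^sup>2) * x"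
    using \<theta> by (simp add: field_simps power2_eq_square)
  finally have "(1 + \<theta>) * m \<le> (1 + \<theta>)\<^sup>2 * (1 / \<kappa>') * H + (6 / \<theta> + 18 + 18 * \<theta> + 6 * \<theta>\<^sup>2) * x" .
  moreover have "(7 / \<theta> + 19 + 18 * \<theta> + 6 * \<theta>\<^sup>2) * x
      = (6 / \<theta> + 18 + 18 * \<theta> + 6 * \<theta>\<^sup>2) * x + (1 / \<theta> + 1) * x"
    by (simp add: algebra_simps)
  ultimately show ?thesis using 1 by linarith
qed

lemma combine_lower:
  fixes Z H m \<phi> S x \<kappa> b b' \<theta> :: real
  assumes Z: "m - sqrt (2 * (S + 2 * m) * x) - 2 * x \<le> Z"
    and H: "H \<le> \<phi> + 2 * sqrt (\<phi> * (3/2 * \<kappa> * x)) + 3/2 * \<kappa> * x"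
    and m\<phi>: "\<phi> \<le> b' * m" and \<kappa>: "0 < \<kappa>" and b: "0 < b" "b \<le> b'"
    and nonneg: "0 \<le> S" "0 \<le> m" "0 \<le> \<phi>" "0 < x" and \<theta>: "0 < \<theta>" "\<theta> \<le> 1"
  shows "(1 - \<theta>)\<^sup>2 * (1 / b') * H - sqrt (2 * S * x) - (3 * \<kappa> / 2 * (1 / b) + 1) * (x / \<theta>)
    - (2 - 2 * \<kappa> * (1 / b) + \<theta>\<^sup>2 * (\<kappa> / 2 * (1 / b))) * x \<le> Z"
proof -
  have b': "0 < b'" using b by linarith
  have "2 * sqrt (m * x) \<le> \<theta> * m + x / \<theta>" using nonneg \<theta> by (intro two_sqrt_le) auto
  then have 1: "(1 - \<theta>) * m - sqrt (2 * S * x) - x / \<theta> - 2 * x \<le> Z"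
    using Z sqrt_variance_split[OF nonneg(1,2), of x] nonneg(4) by (simp add: algebra_simps)
  \<comment> \<open>The weight \<theta> / (1 - \<theta>) satisfies (1 - \<theta>) (1 + \<eta>) = 1.
    It degenerates at \<theta> = 1, where the left side is 0.\<close>
  have 2: "(1 - \<theta>) * H \<le> \<phi> + 3/2 * \<kappa> * x * ((1 - \<theta>) / \<theta>)"
  proof (cases "\<theta> = 1")
    case True then show ?thesis using nonneg by simp
  next
    case False
    define \<eta> where "\<eta> = \<theta> / (1 - \<theta>)"
    have \<theta>1: "\<theta> < 1" using False \<theta> by simp
    have \<eta>: "0 < \<eta>" unfolding \<eta>_def using \<theta> \<theta>1 by simp
    have "2 * sqrt (\<phi> * (3/2 * \<kappa> * x)) \<le> \<eta> * \<phi> + 3/2 * \<kappa> * x / \<eta>"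
      using nonneg \<kappa> \<eta> by (intro two_sqrt_le) auto
    moreover have "(1 + \<eta>) * \<phi> = \<phi> + \<eta> * \<phi>"
      "(3/2 * \<kappa> * x) * (1 / \<eta> + 1) = 3/2 * \<kappa> * x / \<eta> + 3/2 * \<kappa> * x"
      by (simp_all add: algebra_simps)
    ultimately have "H \<le> (1 + \<eta>) * \<phi> + (3/2 * \<kappa> * x) * (1 / \<eta> + 1)" using H by linarith
    then have "(1 - \<theta>) * H \<le> (1 - \<theta>) * ((1 + \<eta>) * \<phi> + (3/2 * \<kappa> * x) * (1 / \<eta> + 1))"
      using \<theta> by (intro mult_left_mono) auto
    also have "\<dots> = ((1 - \<theta>) * (1 + \<eta>)) * \<phi> + (3/2 * \<kappa> * x) * ((1 - \<theta>) * (1 / \<eta> + 1))"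
      by (simp add: algebra_simps)
    also have "(1 - \<theta>) * (1 + \<eta>) = 1" unfolding \<eta>_def using \<theta>1 by (simp add: field_simps)
    also have "1 / \<eta> + 1 = 1 / \<theta>" unfolding \<eta>_def using \<theta> \<theta>1 by (simp add: field_simps)
    finally show ?thesis by simp
  qed
  define d where "d = (1 - \<theta>)\<^sup>2 / \<theta>"
  have d: "0 \<le> d" "(1 - \<theta>) * ((1 - \<theta>) / \<theta>) = d" unfolding d_def using \<theta> by (auto simp: power2_eq_square)
  have "(1 - \<theta>) * ((1 - \<theta>) * H) \<le> (1 - \<theta>) * (\<phi> + 3/2 * \<kappa> * x * ((1 - \<theta>) / \<theta>))"
    using 2 \<theta> by (intro mult_left_mono) auto
  then have "(1 - \<theta>)\<^sup>2 * H \<le> (1 - \<theta>) * \<phi> + 3/2 * \<kappa> * x * d"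
    unfolding d(2)[symmetric] by (simp add: power2_eq_square algebra_simps)
  also have "(1 - \<theta>) * \<phi> \<le> (1 - \<theta>) * (b' * m)" using m\<phi> \<theta> by (intro mult_left_mono) auto
  finally have "(1 - \<theta>)\<^sup>2 * H \<le> b' * ((1 - \<theta>) * m) + 3/2 * \<kappa> * x * d" by (simp add: ac_simps)
  then have "(1 - \<theta>)\<^sup>2 * H / b' \<le> (b' * ((1 - \<theta>) * m) + 3/2 * \<kappa> * x * d) / b'"
    using b' by (intro divide_right_mono) auto
  also have "\<dots> = (1 - \<theta>) * m + 3/2 * \<kappa> * x * d / b'" using b' by (simp add: add_divide_distrib)
  \<comment> \<open>The remainder is measured against b, whichever b' multiplies H.\<close>
  also have "3/2 * \<kappa> * x * d / b' \<le> 3/2 * \<kappa> * x * d / b"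
    using b b' d \<kappa> nonneg by (intro divide_left_mono) auto
  also have "3/2 * \<kappa> * x * d / b = (\<kappa> / b) * x * (3/2 * d)" by simp
  also have "\<dots> \<le> (\<kappa> / b) * x * (3/2 / \<theta> - 2 + \<theta>\<^sup>2 / 2)"
  proof (intro mult_left_mono)
    \<comment> \<open>Half of this product is the gap between 3/2 d = 3 / (2 \<theta>) - 3 + 3
      \<theta> / 2 and the stated 3 / (2 \<theta>) - 2 + \<theta>^2 / 2.\<close>
    have "0 \<le> (1 - \<theta>) * (2 - \<theta>)" using \<theta> by auto
    moreover have "d = 1 / \<theta> - 2 + \<theta>"
      unfolding d_def using \<theta> by (simp add: field_simps power2_eq_square)
    ultimately show "3/2 * d \<le> 3/2 / \<theta> - 2 + \<theta>\<^sup>2 / 2" by (simp add: field_simps power2_eq_square)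
  qed (use \<kappa> b nonneg in auto)
  finally have "(1 - \<theta>)\<^sup>2 * (1 / b') * H \<le> (1 - \<theta>) * m + (\<kappa> / b) * x * (3/2 / \<theta> - 2 + \<theta>\<^sup>2 / 2)" by simp
  moreover have "(3 * \<kappa> / 2 * (1 / b) + 1) * (x / \<theta>) + (2 - 2 * \<kappa> * (1 / b) + \<theta>\<^sup>2 * (\<kappa> / 2 * (1 / b))) * x
      = (\<kappa> / b) * x * (3/2 / \<theta> - 2 + \<theta>\<^sup>2 / 2) + x / \<theta> + 2 * x"
    by (simp add: algebra_simps)
  ultimately show ?thesis using 1 by linarith
qed

subsection \<open>Conditional expectation given an independent variable\<close>

lemma (in prob_space) joint_law_independent:
  assumes U: "U \<in> measurable M A" and V: "V \<in> measurable M B"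
    and ind: "indep_set (sets (vimage_algebra (space M) U A)) (sets (vimage_algebra (space M) V B))"
  shows "distr M A U \<Otimes>\<^sub>M distr M B V = distr M (A \<Otimes>\<^sub>M B) (\<lambda>\<omega>. (U \<omega>, V \<omega>))"
proof -
  interpret DU: prob_space "distr M A U" by (rule prob_space_distr[OF U])
  interpret DV: prob_space "distr M B V" by (rule prob_space_distr[OF V])
  show ?thesis
  proof (rule pair_measure_eqI)
    show "sets (distr M A U \<Otimes>\<^sub>M distr M B V) = sets (distr M (A \<Otimes>\<^sub>M B) (\<lambda>\<omega>. (U \<omega>, V \<omega>)))"
      unfolding sets_distr by (rule sets_pair_measure_cong) simp_all
    fix a b assume "a \<in> sets (distr M A U)" "b \<in> sets (distr M B V)"
    then have a: "a \<in> sets A" and b: "b \<in> sets B" by auto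
    let ?a = "U -` a \<inter> space M" and ?b = "V -` b \<inter> space M"
    have "prob (?a \<inter> ?b) = prob ?a * prob ?b"
      by (rule indep_setD[OF ind]) (auto intro: in_vimage_algebra a b)
    moreover have "?a \<inter> ?b = (\<lambda>\<omega>. (U \<omega>, V \<omega>)) -` (a \<times> b) \<inter> space M" by auto
    ultimately show "emeasure (distr M A U) a * emeasure (distr M B V) b
        = emeasure (distr M (A \<Otimes>\<^sub>M B) (\<lambda>\<omega>. (U \<omega>, V \<omega>))) (a \<times> b)"
      using U V a b
      by (simp add: emeasure_distr emeasure_eq_measure ennreal_mult'[symmetric] pair_measureI)
  qed (rule DU.sigma_finite_measure_axioms, rule DV.sigma_finite_measure_axioms)
qed

text \<open>Freezing lemma. Sets of the generated sigma-algebra are preimages under V, and against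
  these test sets Fubini's theorem for the product law replaces g(U, V) by its average over
  U.\<close>

lemma (in prob_space) cond_exp_independent:
  fixes g :: "'u \<Rightarrow> 'v \<Rightarrow> real"
  assumes U: "U \<in> measurable M A" and V: "V \<in> measurable M B"
    and ind: "indep_set (sets (vimage_algebra (space M) U A)) (sets (vimage_algebra (space M) V B))"
    and g: "(\<lambda>(u, v). g u v) \<in> borel_measurable (A \<Otimes>\<^sub>M B)"
    and int: "integrable M (\<lambda>\<omega>. g (U \<omega>) (V \<omega>))"
  shows "AE \<omega> in M. real_cond_exp M (vimage_algebra (space M) V B) (\<lambda>\<omega>. g (U \<omega>) (V \<omega>)) \<omega>
    = (\<integral>\<omega>'. g (U \<omega>') (V \<omega>) \<partial>M)"
proof -
  let ?F = "vimage_algebra (space M) V B"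
  let ?DU = "distr M A U" and ?DV = "distr M B V"
  have Vs: "V \<in> space M \<rightarrow> space B" using V by (auto dest: measurable_space)
  interpret DU: prob_space ?DU by (rule prob_space_distr[OF U])
  interpret DV: prob_space ?DV by (rule prob_space_distr[OF V])
  interpret DD: pair_sigma_finite ?DU ?DV by standard
  note joint = joint_law_independent[OF U V ind]
  have UV: "(\<lambda>\<omega>. (U \<omega>, V \<omega>)) \<in> measurable M (A \<Otimes>\<^sub>M B)" using U V by simp
  have subalg: "subalgebra M ?F"
    unfolding subalgebra_def
  proof (intro conjI)
    show "sets ?F \<subseteq> sets M"
      unfolding sets_vimage_algebra2[OF Vs] using measurable_sets[OF V] by auto
  qed simp
  interpret FS: finite_measure_subalgebra M ?F by standard (rule subalg)
  define G where "G v = (\<integral>\<omega>'. g (U \<omega>') v \<partial>M)" for v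
  have G_eq: "G v = (\<integral>u. g u v \<partial>?DU)" if "v \<in> space B" for v
  proof -
    have "(\<lambda>u. g u v) \<in> borel_measurable A" using measurable_compose[OF measurable_Pair2'[OF that] g] by simp
    then show ?thesis unfolding G_def by (rule integral_distr[OF U, symmetric])
  qed
  have mG: "(\<lambda>v. \<integral>u. g u v \<partial>?DU) \<in> borel_measurable B"
  proof (rule DU.borel_measurable_lebesgue_integral)
    have "(\<lambda>(v, u). g u v) \<in> borel_measurable (B \<Otimes>\<^sub>M A)"
      using measurable_compose[OF measurable_pair_swap' g] by (simp add: case_prod_unfold)
    then show "(\<lambda>(v, u). g u v) \<in> borel_measurable (B \<Otimes>\<^sub>M ?DU)" by (simp cong: measurable_cong_sets)
  qed
  have GV: "G (V \<omega>) = (\<integral>u. g u (V \<omega>) \<partial>?DU)" if "\<omega> \<in> space M" for \<omega>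
    by (rule G_eq) (use Vs that in auto)
  have intD: "integrable (?DU \<Otimes>\<^sub>M ?DV) (\<lambda>(u, v). g u v)"
    unfolding joint using integrable_distr_eq[OF UV g] int by simp
  have part: "(\<integral>\<omega>. indicator b (V \<omega>) * g (U \<omega>) (V \<omega>) \<partial>M) = (\<integral>\<omega>. indicator b (V \<omega>) * (\<integral>u. g u (V \<omega>) \<partial>?DU) \<partial>M)"
    if b: "b \<in> sets B" for b
  proof -
    define k where "k u v = indicator b v * g u v" for u v
    have k: "(\<lambda>(u, v). k u v) \<in> borel_measurable (A \<Otimes>\<^sub>M B)"
    proof -
      have "(\<lambda>p. indicator b (snd p) * (\<lambda>(u, v). g u v) p :: real) \<in> borel_measurable (A \<Otimes>\<^sub>M B)"
        by (intro borel_measurable_times g measurable_compose[OF measurable_snd] borel_measurable_indicator b)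
      then show ?thesis unfolding k_def by (simp add: case_prod_unfold)
    qed
    have "integrable (?DU \<Otimes>\<^sub>M ?DV) (\<lambda>(u, v). k u v)"
    proof (rule Bochner_Integration.integrable_bound[OF intD])
      show "(\<lambda>(u, v). k u v) \<in> borel_measurable (?DU \<Otimes>\<^sub>M ?DV)"
        using k by (simp cong: measurable_cong_sets sets_pair_measure_cong add: joint)
      show "AE x in ?DU \<Otimes>\<^sub>M ?DV. norm (case x of (u, v) \<Rightarrow> k u v) \<le> norm (case x of (u, v) \<Rightarrow> g u v)"
        by (rule AE_I2) (auto simp: k_def indicator_def)
    qed
    then have "(\<integral>v. (\<integral>u. k u v \<partial>?DU) \<partial>?DV) = (\<integral>p. (case p of (u, v) \<Rightarrow> k u v) \<partial>(?DU \<Otimes>\<^sub>M ?DV))"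
      by (rule DD.integral_snd)
    also have "\<dots> = (\<integral>\<omega>. k (U \<omega>) (V \<omega>) \<partial>M)" unfolding joint using integral_distr[OF UV k] by simp
    finally have "(\<integral>\<omega>. k (U \<omega>) (V \<omega>) \<partial>M) = (\<integral>v. indicator b v * (\<integral>u. g u v \<partial>?DU) \<partial>?DV)"
      unfolding k_def by simp
    also have "\<dots> = (\<integral>\<omega>. indicator b (V \<omega>) * (\<integral>u. g u (V \<omega>) \<partial>?DU) \<partial>M)"
      by (rule integral_distr[OF V]) (use mG b in measurable)
    finally show ?thesis unfolding k_def .
  qed
  have "AE \<omega> in M. real_cond_exp M ?F (\<lambda>\<omega>. g (U \<omega>) (V \<omega>)) \<omega> = (\<integral>u. g u (V \<omega>) \<partial>?DU)"
  proof (rule FS.real_cond_exp_charact)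
    fix a assume "a \<in> sets ?F"
    then obtain b where b: "b \<in> sets B" "a = V -` b \<inter> space M" unfolding sets_vimage_algebra2[OF Vs] by auto
    have ind_eq: "indicator a \<omega> = (indicator b (V \<omega>) :: real)" if "\<omega> \<in> space M" for \<omega>
      using that unfolding b(2) by (auto simp: indicator_def)
    have "(\<integral>\<omega>\<in>a. g (U \<omega>) (V \<omega>) \<partial>M) = (\<integral>\<omega>. indicator b (V \<omega>) * g (U \<omega>) (V \<omega>) \<partial>M)"
      unfolding set_lebesgue_integral_def by (rule Bochner_Integration.integral_cong) (simp_all add: ind_eq)
    also have "\<dots> = (\<integral>\<omega>. indicator b (V \<omega>) * (\<integral>u. g u (V \<omega>) \<partial>?DU) \<partial>M)" by (rule part[OF b(1)])
    also have "\<dots> = (\<integral>\<omega>\<in>a. (\<integral>u. g u (V \<omega>) \<partial>?DU) \<partial>M)"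
      unfolding set_lebesgue_integral_def by (rule Bochner_Integration.integral_cong) (simp_all add: ind_eq)
    finally show "(\<integral>\<omega>\<in>a. g (U \<omega>) (V \<omega>) \<partial>M) = (\<integral>\<omega>\<in>a. (\<integral>u. g u (V \<omega>) \<partial>?DU) \<partial>M)" .
  next
    have "integrable ?DV (\<lambda>v. \<integral>u. g u v \<partial>?DU)" by (rule DD.integrable_snd[OF intD])
    then show "integrable M (\<lambda>\<omega>. \<integral>u. g u (V \<omega>) \<partial>?DU)" using integrable_distr_eq[OF V mG] by simp
    show "(\<lambda>\<omega>. \<integral>u. g u (V \<omega>) \<partial>?DU) \<in> borel_measurable ?F"
      by (rule measurable_compose[OF measurable_vimage_algebra1[OF Vs] mG])
  qed (rule int)
  then show ?thesis using AE_space by eventually_elim (simp add: GV[symmetric] G_def)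
qed

subsection \<open>Events quantified over a real parameter\<close>

text \<open>By continuity in \<theta> the rational parameters decide, which makes the event a
  countable intersection. Measurability is essential for the probability bounds, since
  \<open>measure\<close> is 0 outside the sigma-algebra.\<close>

lemma theta_event_measurable:
  fixes \<alpha> \<beta> :: "real \<Rightarrow> real" and A R :: "'w \<Rightarrow> real"
  assumes A: "A \<in> borel_measurable M" and R: "R \<in> borel_measurable M"
    and cont: "continuous_on S \<alpha>" "continuous_on S \<beta>"
    and S: "\<And>\<theta> e. \<theta> \<in> S \<Longrightarrow> 0 < e \<Longrightarrow> \<exists>q\<in>S \<inter> \<rat>. \<bar>q - \<theta>\<bar> < e"
  shows "{\<omega> \<in> space M. \<forall>\<theta>\<in>S. A \<omega> \<le> \<alpha> \<theta> * R \<omega> + \<beta> \<theta>} \<in> sets M"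
proof -
  have "(\<forall>\<theta>\<in>S. a \<le> \<alpha> \<theta> * r + \<beta> \<theta>) \<longleftrightarrow> (\<forall>\<theta>\<in>S \<inter> \<rat>. a \<le> \<alpha> \<theta> * r + \<beta> \<theta>)" for a r
  proof (intro iffI ballI)
    fix \<theta> assume all: "\<forall>\<theta>\<in>S \<inter> \<rat>. a \<le> \<alpha> \<theta> * r + \<beta> \<theta>" and \<theta>: "\<theta> \<in> S"
    have "\<theta> \<in> closure (S \<inter> \<rat>)"
      unfolding closure_approachable using S[OF \<theta>] by (auto simp: dist_real_def)
    then obtain q where q: "\<And>n. q n \<in> S \<inter> \<rat>" "q \<longlonglongrightarrow> \<theta>" unfolding closure_sequential by auto
    have "continuous_on S (\<lambda>\<theta>. \<alpha> \<theta> * r + \<beta> \<theta>)" using cont by (intro continuous_intros)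
    then have "(\<lambda>n. \<alpha> (q n) * r + \<beta> (q n)) \<longlonglongrightarrow> \<alpha> \<theta> * r + \<beta> \<theta>"
      using q \<theta> unfolding continuous_on_sequentially by (auto simp: comp_def)
    then show "a \<le> \<alpha> \<theta> * r + \<beta> \<theta>" by (rule LIMSEQ_le_const) (use q all in auto)
  qed auto
  then have "{\<omega> \<in> space M. \<forall>\<theta>\<in>S. A \<omega> \<le> \<alpha> \<theta> * R \<omega> + \<beta> \<theta>}
      = {\<omega> \<in> space M. \<forall>\<theta>\<in>S \<inter> \<rat>. A \<omega> \<le> \<alpha> \<theta> * R \<omega> + \<beta> \<theta>}" by simp
  also have "\<dots> \<in> sets M"
  proof (rule sets.sets_Collect_countable_All')
    show "countable (S \<inter> \<rat>)" by (intro countable_Int2 countable_rat)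
    show "{\<omega> \<in> space M. A \<omega> \<le> \<alpha> \<theta> * R \<omega> + \<beta> \<theta>} \<in> sets M" for \<theta>
      using A R by measurable
  qed
  finally show ?thesis .
qed

text \<open>Approximation from below also reaches the endpoint 1 of the parameter range in the lower
  bound.\<close>

lemma rational_near_below:
  fixes \<theta> e :: real
  assumes "0 < \<theta>" "0 < e"
  shows "\<exists>q. q \<in> \<rat> \<and> 0 < q \<and> q < \<theta> \<and> \<bar>q - \<theta>\<bar> < e"
proof -
  obtain q where "q \<in> \<rat>" "max 0 (\<theta> - e) < q" "q < \<theta>"
    using Rats_dense_in_real[of "max 0 (\<theta> - e)" \<theta>] assms by auto
  then show ?thesis by (intro exI[of _ q]) auto
qed

text \<open>The inclusion is asked for only almost surely, because the deviation and the conditional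
  expectation are identified with functions of the sample only almost surely.\<close>

lemma (in prob_space) two_event_bound:
  assumes "A \<in> events" "B \<in> events" "E \<in> events" "prob A \<le> p" "prob B \<le> p"
    and cover: "AE x in M. x \<notin> A \<and> x \<notin> B \<longrightarrow> x \<in> E"
  shows "1 - 2 * p \<le> prob E"
proof -
  have "AE x in M. x \<in> A \<union> B \<union> E" using cover by eventually_elim auto
  then have "prob (A \<union> B \<union> E) = 1" using assms by (intro prob_eq_1[THEN iffD2]) auto
  moreover have "prob (A \<union> B \<union> E) \<le> prob (A \<union> B) + prob E" using assms by (intro measure_Un_le) auto
  moreover have "prob (A \<union> B) \<le> prob A + prob B" using assms by (intro measure_Un_le)
  ultimately show ?thesis using assms(4,5) by linarith
qed

subsection \<open>The weighted bootstrap of a bounded sample\<close>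

locale weighted_sample = P: prob_space P for P :: "'w measure" +
  fixes X :: "nat \<Rightarrow> 'w \<Rightarrow> 'a::banach" and \<xi> :: "nat \<Rightarrow> 'w \<Rightarrow> real" and n :: nat
    and \<mu> :: 'a and M x \<kappa> :: real
  assumes sep: "dual_ball_separable TYPE('a)"
    and n: "n \<ge> 1"
    and indep: "P.indep_vars (\<lambda>_. borel) X {1..n}"
    and ident: "\<forall>i\<in>{1..n}. distr P borel (X i) = distr P borel (X 1)"
    and expect: "has_expectation P (X 1) \<mu>"
    and \<xi>_meas: "\<forall>i\<in>{1..n}. \<xi> i \<in> borel_measurable P"
    and exch: "exchangeable P n \<xi>"
    and indep_\<xi>X: "P.indep_set (sets (sample_algebra P n \<xi>)) (sets (sample_algebra P n X))"
    and \<xi>_zero: "AE \<omega> in P. (\<Sum>i=1..n. \<xi> i \<omega>) = 0"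
    and \<xi>_int: "integrable P (\<lambda>\<omega>. \<bar>\<xi> 1 \<omega>\<bar>)"
    and \<kappa>_def: "\<kappa> = (\<integral>\<omega>. \<bar>\<xi> 1 \<omega>\<bar> \<partial>P)"
    and \<kappa>_pos: "\<kappa> > 0"
    and M_bound: "AE \<omega> in P. norm (X 1 \<omega> - \<mu>) \<le> M"
    and x: "x > 0"
begin

abbreviation "I \<equiv> {1..n}"
definition N :: "'a measure" where "N = distr P borel (X 1)"

text \<open>Centred, truncated and rescaled; the truncation is vacuous almost surely. If \<open>M = 0\<close> then
  \<open>1 / M = 0\<close>, and \<open>h\<close> vanishes together with \<open>X 1 - \<mu>\<close>.\<close>

definition h :: "'a \<Rightarrow> 'a" where
  "h v = (1 / M) *\<^sub>R (if norm (v - \<mu>) \<le> M then v - \<mu> else 0)"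

lemma I_one: "1 \<in> I" using n by simp

lemma X_meas: "i \<in> I \<Longrightarrow> X i \<in> borel_measurable P"
  using indep unfolding P.indep_vars_def by auto

lemma X_weakly_measurable: "i \<in> I \<Longrightarrow> weakly_measurable P (X i)"
  unfolding weakly_measurable_def using dual_ball_bounded_linear
  by (auto intro!: measurable_compose[OF X_meas] borel_measurable_continuous_onI linear_continuous_on)

lemma M_nonneg: "0 \<le> M"
proof -
  have "AE \<omega> in P. 0 \<le> M" using M_bound by eventually_elim (use norm_ge_zero order_trans in blast)
  then show ?thesis by simp
qed

lemma truncated_measurable:
  assumes l: "bounded_linear l"
  shows "(\<lambda>v. l (if norm (v - \<mu>) \<le> M then v - \<mu> else 0) :: real) \<in> borel_measurable borel"
proof -
  have "(\<lambda>v. l (v - \<mu>)) \<in> borel_measurable borel"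
    by (intro borel_measurable_continuous_onI continuous_intros bounded_linear.continuous_on[OF l])
  moreover have "{v \<in> space borel. norm (v - \<mu>) \<le> M} \<in> sets borel"
  proof -
    have "closed {v. norm (v - \<mu>) \<le> M}" by (intro closed_Collect_le continuous_intros)
    then show ?thesis by simp
  qed
  ultimately have "(\<lambda>v. if norm (v - \<mu>) \<le> M then l (v - \<mu>) else 0) \<in> borel_measurable borel"
    by (intro measurable_If) auto
  then show ?thesis by (simp add: if_distrib[of l] linear_0[OF bounded_linear.linear[OF l]] cong: if_cong)
qed

lemma N_prob: "prob_space N"
  unfolding N_def by (rule P.prob_space_distr[OF X_meas[OF I_one]])

lemma h_weakly_measurable: "weakly_measurable borel h"
  unfolding weakly_measurable_def
proof
  fix l :: "'a \<Rightarrow> real" assume l: "l \<in> dual_ball"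
  have "(\<lambda>v. (1 / M) * l (if norm (v - \<mu>) \<le> M then v - \<mu> else 0)) \<in> borel_measurable borel"
    by (rule borel_measurable_times[OF borel_measurable_const
          truncated_measurable[OF dual_ball_bounded_linear[OF l]]])
  then show "(\<lambda>v. l (h v)) \<in> borel_measurable borel"
    unfolding h_def by (simp add: linear_cmul[OF dual_ball_linear[OF l]])
qed

lemma norm_h: "norm (h v) \<le> 1"
  unfolding h_def using M_nonneg by (auto simp: divide_le_eq_1)

lemma h_rescaled: "norm (v - \<mu>) \<le> M \<Longrightarrow> M *\<^sub>R h v = v - \<mu>"
  unfolding h_def by (cases "M = 0") auto

lemma l_h_X1:
  assumes l: "l \<in> dual_ball"
  shows "AE \<omega> in P. l (h (X 1 \<omega>)) = (1 / M) * (l (X 1 \<omega>) - l \<mu>)"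
  using M_bound
  by eventually_elim
    (simp add: h_def linear_cmul[OF dual_ball_linear[OF l]] linear_diff[OF dual_ball_linear[OF l]])

lemma l_X1:
  assumes l: "l \<in> dual_ball"
  shows "integrable P (\<lambda>\<omega>. l (X 1 \<omega>))" "(\<integral>\<omega>. l (X 1 \<omega>) \<partial>P) = l \<mu>"
  using expect dual_ball_bounded_linear[OF l] unfolding has_expectation_def by blast+

lemma l_h_measurable:
  assumes "l \<in> dual_ball"
  shows "(\<lambda>v. l (h v)) \<in> borel_measurable borel"
  using h_weakly_measurable assms unfolding weakly_measurable_def by blast

lemma l_h_centred:
  assumes l: "l \<in> dual_ball"
  shows "(\<integral>v. l (h v) \<partial>N) = 0"
proof -
  have "(\<integral>v. l (h v) \<partial>N) = (\<integral>\<omega>. l (h (X 1 \<omega>)) \<partial>P)"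
    unfolding N_def by (rule integral_distr[OF X_meas[OF I_one] l_h_measurable[OF l]])
  also have "\<dots> = (\<integral>\<omega>. (1 / M) * (l (X 1 \<omega>) - l \<mu>) \<partial>P)"
  proof (rule integral_cong_AE[OF _ _ l_h_X1[OF l]])
    show "(\<lambda>\<omega>. l (h (X 1 \<omega>))) \<in> borel_measurable P"
      by (rule measurable_compose[OF X_meas[OF I_one] l_h_measurable[OF l]])
    show "(\<lambda>\<omega>. (1 / M) * (l (X 1 \<omega>) - l \<mu>)) \<in> borel_measurable P" using l_X1(1)[OF l] by measurable
  qed
  also have "\<dots> = 0" using l_X1[OF l] by (simp add: P.prob_space)
  finally show ?thesis .
qed

definition \<Xi> :: "'w \<Rightarrow> nat \<Rightarrow> real" where "\<Xi> \<omega> = (\<lambda>i\<in>I. \<xi> i \<omega>)"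
definition Y :: "'w \<Rightarrow> nat \<Rightarrow> 'a" where "Y \<omega> = (\<lambda>i\<in>I. X i \<omega>)"

lemma \<Xi>_meas: "\<Xi> \<in> measurable P (Pi\<^sub>M I (\<lambda>_. borel))"
  unfolding \<Xi>_def using \<xi>_meas by (intro measurable_restrict) auto

lemma Y_meas: "Y \<in> measurable P (Pi\<^sub>M I (\<lambda>_. borel))"
  unfolding Y_def using X_meas by (intro measurable_restrict) auto

lemma exchangeable_integral:
  fixes \<phi> :: "(nat \<Rightarrow> real) \<Rightarrow> real"
  assumes \<pi>: "\<pi> permutes I" and \<phi>: "\<phi> \<in> borel_measurable (Pi\<^sub>M I (\<lambda>_. borel))"
  shows "(\<integral>\<omega>. \<phi> (\<lambda>i\<in>I. \<xi> (\<pi> i) \<omega>) \<partial>P) = (\<integral>\<omega>. \<phi> (\<Xi> \<omega>) \<partial>P)"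
    "integrable P (\<lambda>\<omega>. \<phi> (\<lambda>i\<in>I. \<xi> (\<pi> i) \<omega>)) \<longleftrightarrow> integrable P (\<lambda>\<omega>. \<phi> (\<Xi> \<omega>))"
    "{c \<in> space (Pi\<^sub>M I (\<lambda>_. borel)). Pr c} \<in> sets (Pi\<^sub>M I (\<lambda>_. borel)) \<Longrightarrow>
      (AE \<omega> in P. Pr (\<lambda>i\<in>I. \<xi> (\<pi> i) \<omega>)) \<longleftrightarrow> (AE \<omega> in P. Pr (\<Xi> \<omega>))"
proof -
  let ?PM = "Pi\<^sub>M I (\<lambda>_. borel) :: (nat \<Rightarrow> real) measure"
  have m: "(\<lambda>\<omega>. \<lambda>i\<in>I. \<xi> (\<pi> i) \<omega>) \<in> measurable P ?PM"
    using \<xi>_meas permutes_in_image[OF \<pi>] by (intro measurable_restrict) auto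
  have eq: "distr P ?PM (\<lambda>\<omega>. \<lambda>i\<in>I. \<xi> (\<pi> i) \<omega>) = distr P ?PM \<Xi>"
    using exch \<pi> unfolding exchangeable_def \<Xi>_def by blast
  show "(\<integral>\<omega>. \<phi> (\<lambda>i\<in>I. \<xi> (\<pi> i) \<omega>) \<partial>P) = (\<integral>\<omega>. \<phi> (\<Xi> \<omega>) \<partial>P)"
    using integral_distr[OF m \<phi>] integral_distr[OF \<Xi>_meas \<phi>] eq by simp
  show "integrable P (\<lambda>\<omega>. \<phi> (\<lambda>i\<in>I. \<xi> (\<pi> i) \<omega>)) \<longleftrightarrow> integrable P (\<lambda>\<omega>. \<phi> (\<Xi> \<omega>))"
    using integrable_distr_eq[OF m \<phi>] integrable_distr_eq[OF \<Xi>_meas \<phi>] eq by simp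
  assume S: "{c \<in> space ?PM. Pr c} \<in> sets ?PM"
  show "(AE \<omega> in P. Pr (\<lambda>i\<in>I. \<xi> (\<pi> i) \<omega>)) \<longleftrightarrow> (AE \<omega> in P. Pr (\<Xi> \<omega>))"
    using AE_distr_iff[OF m S] AE_distr_iff[OF \<Xi>_meas S] unfolding eq by blast
qed

lemma swap_permutes: "i \<in> I \<Longrightarrow> k \<in> I \<Longrightarrow> Transposition.transpose i k permutes I"
  by (rule permutes_swap_id)

lemma coordinate_measurable: "(\<lambda>c. c (1::nat)) \<in> borel_measurable (Pi\<^sub>M I (\<lambda>_. borel :: real measure))"
  by (rule measurable_component_singleton[OF I_one])

text \<open>The transposition of 1 and i carries every property of the law of \<open>\<xi> 1\<close>
  over to \<open>\<xi> i\<close>.\<close>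

lemma integrable_\<xi>: "i \<in> I \<Longrightarrow> integrable P (\<xi> i)"
  and integral_abs_\<xi>: "i \<in> I \<Longrightarrow> (\<integral>\<omega>. \<bar>\<xi> i \<omega>\<bar> \<partial>P) = \<kappa>"
  and integral_\<xi>_eq: "i \<in> I \<Longrightarrow> (\<integral>\<omega>. \<xi> i \<omega> \<partial>P) = (\<integral>\<omega>. \<xi> 1 \<omega> \<partial>P)"
proof -
  assume i: "i \<in> I"
  note ex = exchangeable_integral[OF swap_permutes[OF I_one i]]
  have i1: "integrable P (\<xi> 1)"
    by (rule integrable_abs_iff[THEN iffD1, OF bspec[OF \<xi>_meas I_one] \<xi>_int])
  show "integrable P (\<xi> i)" using ex(2)[OF coordinate_measurable] i1 I_one unfolding \<Xi>_def by simp
  show "(\<integral>\<omega>. \<xi> i \<omega> \<partial>P) = (\<integral>\<omega>. \<xi> 1 \<omega> \<partial>P)"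
    using ex(1)[OF coordinate_measurable] I_one unfolding \<Xi>_def by simp
  show "(\<integral>\<omega>. \<bar>\<xi> i \<omega>\<bar> \<partial>P) = \<kappa>"
    using ex(1)[OF borel_measurable_abs[OF coordinate_measurable]] I_one unfolding \<Xi>_def \<kappa>_def by simp
qed

text \<open>Exchangeability makes the means equal, and they sum to 0.\<close>

lemma \<xi>_centred: "i \<in> I \<Longrightarrow> (\<integral>\<omega>. \<xi> i \<omega> \<partial>P) = 0"
proof -
  assume i: "i \<in> I"
  have "real n * (\<integral>\<omega>. \<xi> 1 \<omega> \<partial>P) = (\<Sum>i\<in>I. (\<integral>\<omega>. \<xi> 1 \<omega> \<partial>P))" by simp
  also have "\<dots> = (\<Sum>i\<in>I. (\<integral>\<omega>. \<xi> i \<omega> \<partial>P))" by (intro sum.cong refl integral_\<xi>_eq[symmetric])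
  also have "\<dots> = (\<integral>\<omega>. (\<Sum>i\<in>I. \<xi> i \<omega>) \<partial>P)" using integrable_\<xi> by simp
  also have "\<dots> = (\<integral>\<omega>. 0 \<partial>P)"
    by (rule integral_cong_AE, intro borel_measurable_sum bspec[OF \<xi>_meas], assumption, simp, rule \<xi>_zero)
  finally show "(\<integral>\<omega>. \<xi> i \<omega> \<partial>P) = 0" unfolding integral_\<xi>_eq[OF i] using n by simp
qed

lemma \<xi>_AE_bound:
  assumes "AE \<omega> in P. \<bar>\<xi> 1 \<omega>\<bar> \<le> b" "i \<in> I"
  shows "AE \<omega> in P. \<bar>\<xi> i \<omega>\<bar> \<le> b"
proof -
  have "{c \<in> space (Pi\<^sub>M I (\<lambda>_. borel)). \<bar>c 1\<bar> \<le> b} \<in> sets (Pi\<^sub>M I (\<lambda>_. borel :: real measure))"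
    using borel_measurable_le[OF borel_measurable_abs[OF coordinate_measurable] borel_measurable_const] by simp
  from exchangeable_integral(3)[OF swap_permutes[OF I_one assms(2)] coordinate_measurable this]
  show ?thesis using assms(1) I_one unfolding \<Xi>_def by simp
qed

sublocale multipliers N I h P \<xi> \<kappa>
proof -
  interpret N: prob_space N by (rule N_prob)
  show "multipliers N I h P \<xi> \<kappa>"
  proof
    show "weakly_measurable N h" using h_weakly_measurable unfolding weakly_measurable_def N_def by simp
    show "(\<integral>\<omega>. norm (\<Sum>j\<in>I. \<xi> (Transposition.transpose i k j) \<omega> *\<^sub>R v j) \<partial>P)
        = (\<integral>\<omega>. norm (\<Sum>j\<in>I. \<xi> j \<omega> *\<^sub>R v j) \<partial>P)" if "i \<in> I" "k \<in> I" for i k and v :: "nat \<Rightarrow> 'a"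
    proof -
      define \<phi> where "\<phi> c = norm (\<Sum>j\<in>I. c j *\<^sub>R v j)" for c :: "nat \<Rightarrow> real"
      have "\<phi> \<in> borel_measurable (Pi\<^sub>M I (\<lambda>_. borel))"
        unfolding \<phi>_def
        by (intro weakly_measurable_norm[OF sep] weakly_measurable_sum weakly_measurable_scaleR
            weakly_measurable_const measurable_component_singleton)
      from exchangeable_integral(1)[OF swap_permutes[OF that] this]
      show ?thesis unfolding \<phi>_def \<Xi>_def by simp
    qed
  qed (use sep norm_h l_h_centred integrable_\<xi> integral_abs_\<xi> \<xi>_zero n in auto)
qed

lemma sets_Q: "sets Q = sets (Pi\<^sub>M I (\<lambda>_. borel :: 'a measure))"
  unfolding Q_def unfolding N_def by (rule sets_PiM_cong) auto

text \<open>The sample is viewed in the product of the Borel sigma-algebras, which may be smaller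
  than the Borel sigma-algebra of the product space; measurability of norms of sums on it comes from
  scalar measurability.\<close>

lemma law_of_Y: "distr P Q Y = Q"
proof -
  have ne: "I \<noteq> {}" using n by simp
  have "distr P (Pi\<^sub>M I (\<lambda>_. borel)) Y = Pi\<^sub>M I (\<lambda>i. distr P borel (X i))"
    using P.indep_vars_iff_distr_eq_PiM'[where M'="\<lambda>_. borel" and X=X, OF ne X_meas] indep
    unfolding Y_def by blast
  also have "\<dots> = Q" unfolding Q_def unfolding N_def by (rule PiM_cong[OF refl bspec[OF ident]])
  finally have "distr P (Pi\<^sub>M I (\<lambda>_. borel)) Y = Q" .
  moreover have "distr P Q Y = distr P (Pi\<^sub>M I (\<lambda>_. borel)) Y"
    by (rule distr_cong[OF refl sets_Q refl])
  ultimately show ?thesis by simp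
qed

lemma Y_meas_Q: "Y \<in> measurable P Q"
  using Y_meas measurable_cong_sets[OF refl sets_Q] by blast

lemma prob_Y:
  assumes "{y \<in> space Q. Pr y} \<in> sets Q"
  shows "P.prob {\<omega> \<in> space P. Pr (Y \<omega>)} = Q.prob {y \<in> space Q. Pr y}"
    "{\<omega> \<in> space P. Pr (Y \<omega>)} \<in> P.events"
proof -
  have e: "Y -` {y \<in> space Q. Pr y} \<inter> space P = {\<omega> \<in> space P. Pr (Y \<omega>)}"
    using measurable_space[OF Y_meas_Q] by auto
  show "{\<omega> \<in> space P. Pr (Y \<omega>)} \<in> P.events" using measurable_sets[OF Y_meas_Q assms] unfolding e .
  show "P.prob {\<omega> \<in> space P. Pr (Y \<omega>)} = Q.prob {y \<in> space Q. Pr y}"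
    using measure_distr[OF Y_meas_Q assms] unfolding law_of_Y e by simp
qed

lemma X_bound: "AE \<omega> in P. \<forall>i\<in>I. norm (X i \<omega> - \<mu>) \<le> M"
proof -
  have "AE \<omega> in P. norm (X i \<omega> - \<mu>) \<le> M" if i: "i \<in> I" for i
  proof -
    have cl: "{v \<in> space borel. norm (v - \<mu>) \<le> M} \<in> sets borel"
    proof -
      have "closed {v. norm (v - \<mu>) \<le> M}" by (intro closed_Collect_le continuous_intros)
      then show ?thesis by simp
    qed
    have "AE v in distr P borel (X 1). norm (v - \<mu>) \<le> M"
      using AE_distr_iff[OF X_meas[OF I_one] cl] M_bound by blast
    then have "AE v in distr P borel (X i). norm (v - \<mu>) \<le> M" unfolding bspec[OF ident i] .
    then show ?thesis using AE_distr_iff[OF X_meas[OF i] cl] by blast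
  qed
  then show ?thesis by (simp add: AE_ball_countable)
qed

lemma deviation_eq: "AE \<omega> in P. norm (sample_mean n X \<omega> - \<mu>) = M / real n * Z (Y \<omega>)"
  using X_bound
proof eventually_elim
  case (elim \<omega>)
  have "sample_mean n X \<omega> - \<mu> = (1 / real n) *\<^sub>R (\<Sum>i\<in>I. X i \<omega> - \<mu>)"
    using n unfolding sample_mean_def by (simp add: sum_subtractf scaleR_diff_right sum_constant_scaleR)
  also have "(\<Sum>i\<in>I. X i \<omega> - \<mu>) = (\<Sum>i\<in>I. M *\<^sub>R h (X i \<omega>))"
    using elim by (intro sum.cong refl) (simp add: h_rescaled)
  also have "\<dots> = M *\<^sub>R (\<Sum>i\<in>I. h (Y \<omega> i))" unfolding Y_def by (simp add: scaleR_right.sum)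
  finally show ?case unfolding Z_def using M_nonneg by simp
qed

text \<open>The weights sum to 0, so \<mu> may be subtracted from every \<open>X i\<close> at no
  cost.\<close>

lemma multiplier_sum_eq:
  "AE \<omega> in P. norm (\<Sum>i\<in>I. \<xi> i \<omega> *\<^sub>R X i \<omega>) = M * norm (\<Sum>i\<in>I. \<Xi> \<omega> i *\<^sub>R h (Y \<omega> i))"
  using X_bound \<xi>_zero
proof eventually_elim
  case (elim \<omega>)
  have "(\<Sum>i\<in>I. \<xi> i \<omega> *\<^sub>R X i \<omega>) = (\<Sum>i\<in>I. \<xi> i \<omega> *\<^sub>R (X i \<omega> - \<mu>)) + (\<Sum>i\<in>I. \<xi> i \<omega>) *\<^sub>R \<mu>"
    by (simp add: scaleR_diff_right sum_subtractf scaleR_left.sum)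
  also have "(\<Sum>i\<in>I. \<xi> i \<omega> *\<^sub>R (X i \<omega> - \<mu>)) = (\<Sum>i\<in>I. \<xi> i \<omega> *\<^sub>R (M *\<^sub>R h (X i \<omega>)))"
    using elim by (intro sum.cong refl) (simp add: h_rescaled)
  also have "\<dots> = M *\<^sub>R (\<Sum>i\<in>I. \<Xi> \<omega> i *\<^sub>R h (Y \<omega> i))"
    unfolding scaleR_right.sum \<Xi>_def Y_def by (intro sum.cong refl) simp
  finally show ?case using elim M_nonneg by simp
qed

abbreviation R :: "'w \<Rightarrow> real" where "R \<equiv> weighted_complexity P n \<xi> X"

lemma R_measurable: "R \<in> borel_measurable P"
  unfolding weighted_complexity_def by simp

text \<open>The integrand is first replaced by its truncated version g, almost surely equal and
  jointly measurable in multipliers and sample; \<open>cond_exp_independent\<close> then freezes the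
  sample.\<close>

lemma R_eq: "AE \<omega> in P. R \<omega> = M / real n * H (Y \<omega>)"
proof -
  define g where "g c y = M / real n * norm (\<Sum>i\<in>I. c i *\<^sub>R h (y i))" for c :: "nat \<Rightarrow> real" and y :: "nat \<Rightarrow> 'a"
  have g: "(\<lambda>(c, y). g c y) \<in> borel_measurable (Pi\<^sub>M I (\<lambda>_. borel) \<Otimes>\<^sub>M Pi\<^sub>M I (\<lambda>_. borel))"
    unfolding g_def case_prod_unfold
    by (intro borel_measurable_times borel_measurable_const weakly_measurable_norm[OF sep] weakly_measurable_sum
        weakly_measurable_scaleR measurable_compose[OF measurable_fst measurable_component_singleton]
        weakly_measurable_compose[OF h_weakly_measurable]
        measurable_compose[OF measurable_snd measurable_component_singleton])
  have g_meas: "(\<lambda>\<omega>. g (\<Xi> \<omega>) (Y \<omega>)) \<in> borel_measurable P"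
    using measurable_compose[OF measurable_Pair[OF \<Xi>_meas Y_meas] g] by simp
  have g_int: "integrable P (\<lambda>\<omega>. g (\<Xi> \<omega>) (Y \<omega>))"
  proof (rule Bochner_Integration.integrable_bound)
    show "integrable P (\<lambda>\<omega>. M / real n * (\<Sum>i\<in>I. \<bar>\<xi> i \<omega>\<bar>))"
      by (intro integrable_mult_right Bochner_Integration.integrable_sum integrable_abs integrable_\<xi>)
    show "AE \<omega> in P. norm (g (\<Xi> \<omega>) (Y \<omega>)) \<le> norm (M / real n * (\<Sum>i\<in>I. \<bar>\<xi> i \<omega>\<bar>))"
    proof (rule AE_I2)
      fix \<omega>
      have "norm (\<Sum>i\<in>I. \<Xi> \<omega> i *\<^sub>R h (Y \<omega> i)) \<le> (\<Sum>i\<in>I. \<bar>\<Xi> \<omega> i\<bar>)" by (rule combination_h_bound)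
      also have "\<dots> = (\<Sum>i\<in>I. \<bar>\<xi> i \<omega>\<bar>)" unfolding \<Xi>_def by simp
      finally have "M / real n * norm (\<Sum>i\<in>I. \<Xi> \<omega> i *\<^sub>R h (Y \<omega> i)) \<le> M / real n * (\<Sum>i\<in>I. \<bar>\<xi> i \<omega>\<bar>)"
        using M_nonneg by (intro mult_left_mono) auto
      moreover have "0 \<le> M / real n * norm (\<Sum>i\<in>I. \<Xi> \<omega> i *\<^sub>R h (Y \<omega> i))" using M_nonneg by simp
      ultimately show "norm (g (\<Xi> \<omega>) (Y \<omega>)) \<le> norm (M / real n * (\<Sum>i\<in>I. \<bar>\<xi> i \<omega>\<bar>))"
        unfolding g_def real_norm_def by linarith
    qed
  qed (rule g_meas)
  have alg: "sample_algebra P n X = vimage_algebra (space P) Y (Pi\<^sub>M I (\<lambda>_. borel))"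
    "sample_algebra P n \<xi> = vimage_algebra (space P) \<Xi> (Pi\<^sub>M I (\<lambda>_. borel))"
    unfolding sample_algebra_def Y_def \<Xi>_def by auto
  have "AE \<omega> in P. real_cond_exp P (sample_algebra P n X) (\<lambda>\<omega>. g (\<Xi> \<omega>) (Y \<omega>)) \<omega> = (\<integral>\<omega>'. g (\<Xi> \<omega>') (Y \<omega>) \<partial>P)"
    unfolding alg
    by (rule P.cond_exp_independent[where g=g, OF \<Xi>_meas Y_meas _ g g_int])
       (use indep_\<xi>X in \<open>simp only: alg\<close>)
  moreover have "(\<integral>\<omega>'. g (\<Xi> \<omega>') (Y \<omega>) \<partial>P) = M / real n * H (Y \<omega>)" for \<omega>
    unfolding g_def H_def f_def S_def \<Xi>_def by simp
  moreover have "AE \<omega> in P. R \<omega> = real_cond_exp P (sample_algebra P n X) (\<lambda>\<omega>. g (\<Xi> \<omega>) (Y \<omega>)) \<omega>"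
  proof -
    have Vs: "Y \<in> space P \<rightarrow> space (Pi\<^sub>M I (\<lambda>_. borel))" using Y_meas by (auto dest: measurable_space)
    have sub: "subalgebra P (sample_algebra P n X)"
      unfolding subalgebra_def alg sets_vimage_algebra2[OF Vs] using measurable_sets[OF Y_meas] by auto
    interpret FS: finite_measure_subalgebra P "sample_algebra P n X" by standard (rule sub)
    have eq: "AE \<omega> in P. 1 / real n * norm (\<Sum>i=1..n. \<xi> i \<omega> *\<^sub>R X i \<omega>) = g (\<Xi> \<omega>) (Y \<omega>)"
      using multiplier_sum_eq by eventually_elim (simp add: g_def)
    show ?thesis unfolding weighted_complexity_def
    proof (rule FS.real_cond_exp_cong[OF eq])
      show "(\<lambda>\<omega>. 1 / real n * norm (\<Sum>i=1..n. \<xi> i \<omega> *\<^sub>R X i \<omega>)) \<in> borel_measurable P"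
      proof (intro borel_measurable_times borel_measurable_const weakly_measurable_norm[OF sep]
          weakly_measurable_sum weakly_measurable_scaleR)
        show "weakly_measurable P (X i)" if "i \<in> I" for i using that by (rule X_weakly_measurable)
      qed (use \<xi>_meas in auto)
    qed (rule g_meas)
  qed
  ultimately show ?thesis by auto
qed

lemma deviation_measurable: "(\<lambda>\<omega>. norm (sample_mean n X \<omega> - \<mu>)) \<in> borel_measurable P"
proof -
  have "(\<lambda>\<omega>. norm ((1 / real n) *\<^sub>R (\<Sum>i=1..n. X i \<omega>) + - \<mu>)) \<in> borel_measurable P"
    by (intro weakly_measurable_norm[OF sep] weakly_measurable_add weakly_measurable_scaleR
        weakly_measurable_sum weakly_measurable_const borel_measurable_const X_weakly_measurable)
  then show ?thesis unfolding sample_mean_def by simp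
qed

abbreviation \<sigma> :: real where "\<sigma> \<equiv> weak_sd P (X 1)"

text \<open>A supremum of reals dominates its members only if it is bounded; here M bounds every
  standard deviation.\<close>

lemma variance_le:
  assumes l: "l \<in> dual_ball"
  shows "P.variance (\<lambda>\<omega>. l (X 1 \<omega>)) \<le> \<sigma>\<^sup>2" "0 \<le> \<sigma>"
proof -
  have nonneg: "0 \<le> P.variance (\<lambda>\<omega>. k (X 1 \<omega>))" for k :: "'a \<Rightarrow> real" by simp
  have bdd: "bdd_above ((\<lambda>l. sqrt (P.variance (\<lambda>\<omega>. l (X 1 \<omega>)))) ` (dual_ball :: ('a \<Rightarrow> real) set))"
  proof (rule bdd_aboveI2[where M=M])
    fix k :: "'a \<Rightarrow> real" assume k: "k \<in> dual_ball"
    have "P.variance (\<lambda>\<omega>. k (X 1 \<omega>)) \<le> M\<^sup>2"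
    proof -
      have b: "AE \<omega> in P. (k (X 1 \<omega>) - k \<mu>)\<^sup>2 \<le> M\<^sup>2"
        using M_bound
      proof eventually_elim
        case (elim \<omega>)
        have "\<bar>k (X 1 \<omega>) - k \<mu>\<bar> \<le> \<bar>M\<bar>"
          using dual_ball_abs[OF k, of "X 1 \<omega> - \<mu>"] linear_diff[OF dual_ball_linear[OF k], of "X 1 \<omega>" \<mu>] elim by simp
        then show ?case by (rule abs_le_square_iff[THEN iffD1])
      qed
      have "integrable P (\<lambda>\<omega>. (k (X 1 \<omega>) - k \<mu>)\<^sup>2)"
        by (rule P.integrable_const_bound[where B="M\<^sup>2"]) (use b l_X1(1)[OF k] in \<open>auto intro!: borel_measurable_power borel_measurable_diff\<close>)
      then show ?thesis unfolding l_X1(2)[OF k] by (rule P.integral_le_const[OF _ b])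
    qed
    then have "sqrt (P.variance (\<lambda>\<omega>. k (X 1 \<omega>))) \<le> sqrt (M\<^sup>2)" by (rule real_sqrt_le_mono)
    then show "sqrt (P.variance (\<lambda>\<omega>. k (X 1 \<omega>))) \<le> M" using M_nonneg by simp
  qed
  have le: "sqrt (P.variance (\<lambda>\<omega>. l (X 1 \<omega>))) \<le> \<sigma>"
    unfolding weak_sd_def by (rule cSUP_upper[OF l bdd])
  then show "0 \<le> \<sigma>" using real_sqrt_ge_zero[OF nonneg[of l]] by linarith
  show "P.variance (\<lambda>\<omega>. l (X 1 \<omega>)) \<le> \<sigma>\<^sup>2"
    using power_mono[OF le real_sqrt_ge_zero[OF nonneg[of l]], of 2] nonneg[of l] by simp
qed

lemma \<sigma>_nonneg: "0 \<le> \<sigma>"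
proof -
  have "(\<lambda>_. 0) \<in> (dual_ball :: ('a \<Rightarrow> real) set)" unfolding dual_ball_def by (auto intro: linearI)
  then show ?thesis by (rule variance_le(2))
qed

lemma h_variance:
  assumes l: "l \<in> dual_ball"
  shows "(\<integral>v. (l (h v))\<^sup>2 \<partial>N) \<le> (\<sigma> / M)\<^sup>2"
proof -
  have "(\<integral>v. (l (h v))\<^sup>2 \<partial>N) = (\<integral>\<omega>. (l (h (X 1 \<omega>)))\<^sup>2 \<partial>P)"
    unfolding N_def by (rule integral_distr[OF X_meas[OF I_one]]) (intro borel_measurable_power l_h_measurable[OF l])
  also have "\<dots> = (\<integral>\<omega>. (1 / M)\<^sup>2 * (l (X 1 \<omega>) - l \<mu>)\<^sup>2 \<partial>P)"
  proof (rule integral_cong_AE)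
    show "(\<lambda>\<omega>. (l (h (X 1 \<omega>)))\<^sup>2) \<in> borel_measurable P"
      by (intro borel_measurable_power measurable_compose[OF X_meas[OF I_one] l_h_measurable[OF l]])
    show "(\<lambda>\<omega>. (1 / M)\<^sup>2 * (l (X 1 \<omega>) - l \<mu>)\<^sup>2) \<in> borel_measurable P"
      using borel_measurable_integrable[OF l_X1(1)[OF l]] by measurable
    show "AE \<omega> in P. (l (h (X 1 \<omega>)))\<^sup>2 = (1 / M)\<^sup>2 * (l (X 1 \<omega>) - l \<mu>)\<^sup>2"
      using l_h_X1[OF l] by eventually_elim (simp only: power_mult_distrib)
  qed
  also have "\<dots> = (1 / M)\<^sup>2 * P.variance (\<lambda>\<omega>. l (X 1 \<omega>))" unfolding l_X1(2)[OF l] by simp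
  also have "\<dots> \<le> (1 / M)\<^sup>2 * \<sigma>\<^sup>2" using variance_le(1)[OF l] by (intro mult_left_mono) auto
  finally show ?thesis by (simp add: power_divide)
qed

abbreviation V :: real where "V \<equiv> real (card I) * (\<sigma> / M)\<^sup>2"

text \<open>Returns from the normalised variance factor n (\<sigma> / M)^2 to the original scale; if
  M = 0 the left side is 0.\<close>

lemma V_rescaled: "M / real n * sqrt (2 * V * x) \<le> \<sigma> * sqrt (2 * x / n)"
proof (cases "M = 0")
  case True then show ?thesis using \<sigma>_nonneg x by simp
next
  case False
  have sq: "sqrt (a\<^sup>2 * b\<^sup>2 * c) = a * b * sqrt c" if "0 \<le> a" "0 \<le> b" for a b c :: real
    using that by (simp add: real_sqrt_mult)
  have "2 * V * x = (\<sigma> / M)\<^sup>2 * (real n)\<^sup>2 * (2 * x / n)"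
    using n by (simp add: power2_eq_square)
  then have "sqrt (2 * V * x) = \<sigma> / M * real n * sqrt (2 * x / n)"
    using sq[of "\<sigma> / M" "real n" "2 * x / n"] \<sigma>_nonneg M_nonneg by (simp only: divide_nonneg_nonneg of_nat_0_le_iff)
  then show ?thesis using False n by simp
qed

lemma expectations_nonneg: "0 \<le> (\<integral>y. Z y \<partial>Q)" "0 \<le> (\<integral>y. H y \<partial>Q)"
  using Z_bound f_nonneg unfolding H_def by (auto intro!: integral_nonneg_AE AE_I2)

section \<open>From tail bounds to the two families of inequalities\<close>

lemma upper_event:
  assumes \<kappa>': "\<kappa> / 2 \<le> \<kappa>'" and m: "\<kappa>' * (\<integral>y. Z y \<partial>Q) \<le> (\<integral>y. H y \<partial>Q)"
  shows "1 - 2 * exp (- x) \<le> P.prob {\<omega> \<in> space P. \<forall>\<theta>>0. norm (sample_mean n X \<omega> - \<mu>)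
    \<le> (1 + \<theta>)\<^sup>2 * (1 / \<kappa>') * R \<omega> + \<sigma> * sqrt (2 * x / n) + (7 / \<theta> + 19 + 18 * \<theta> + 6 * \<theta>\<^sup>2) * (x * M / n)}"
proof -
  define mZ where "mZ = (\<integral>y. Z y \<partial>Q)"
  define mH where "mH = (\<integral>y. H y \<partial>Q)"
  \<comment> \<open>The two exceptional events do not mention \<theta>; outside them
    \<open>combine_upper\<close> holds for every \<theta> simultaneously.\<close>
  define A where "A y \<longleftrightarrow> mZ + sqrt (2 * (V + 2 * mZ) * x) + x < Z y" for y
  define B where "B y \<longleftrightarrow> H y < mH - 2 * sqrt (mH * (3 * \<kappa> * x))" for y
  have [measurable]: "Z \<in> borel_measurable Q" "H \<in> borel_measurable Q" by (rule Z_measurable, rule H_measurable)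
  have sA: "{y \<in> space Q. A y} \<in> sets Q" and sB: "{y \<in> space Q. B y} \<in> sets Q"
    unfolding A_def B_def by measurable
  have pA: "P.prob {\<omega> \<in> space P. A (Y \<omega>)} \<le> exp (- x)"
    unfolding prob_Y(1)[OF sA] unfolding A_def mZ_def by (rule Z_upper_tail[OF h_variance x])
  have pB: "P.prob {\<omega> \<in> space P. B (Y \<omega>)} \<le> exp (- x)"
    unfolding prob_Y(1)[OF sB] unfolding B_def mH_def by (rule H_lower_tail_scaled[OF \<kappa>_pos x])
  let ?E = "{\<omega> \<in> space P. \<forall>\<theta>\<in>{0<..}. norm (sample_mean n X \<omega> - \<mu>)
    \<le> (1 + \<theta>)\<^sup>2 * (1 / \<kappa>') * R \<omega> + (\<sigma> * sqrt (2 * x / n) + (7 / \<theta> + 19 + 18 * \<theta> + 6 * \<theta>\<^sup>2) * (x * M / n))}"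
  have "1 - 2 * exp (- x) \<le> P.prob ?E"
  proof (rule P.two_event_bound[OF prob_Y(2)[OF sA] prob_Y(2)[OF sB] _ pA pB])
    show "?E \<in> P.events"
    proof (rule theta_event_measurable[OF deviation_measurable R_measurable])
      show "\<exists>q\<in>{0<..} \<inter> \<rat>. \<bar>q - \<theta>\<bar> < e" if "\<theta> \<in> {0<..}" "0 < e" for \<theta> e :: real
        using rational_near_below[of \<theta> e] that by auto
    qed (use \<kappa>_pos \<kappa>' n in \<open>auto intro!: continuous_intros\<close>)
    show "AE \<omega> in P. \<omega> \<notin> {\<omega> \<in> space P. A (Y \<omega>)} \<and> \<omega> \<notin> {\<omega> \<in> space P. B (Y \<omega>)} \<longrightarrow> \<omega> \<in> ?E"
      using deviation_eq R_eq AE_space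
    proof eventually_elim
      case (elim \<omega>)
      show ?case
      proof (intro impI CollectI conjI ballI elim(3))
        fix \<theta> :: real assume good: "\<omega> \<notin> {\<omega> \<in> space P. A (Y \<omega>)} \<and> \<omega> \<notin> {\<omega> \<in> space P. B (Y \<omega>)}" and \<theta>: "\<theta> \<in> {0<..}"
        then have "\<not> A (Y \<omega>)" "\<not> B (Y \<omega>)" using elim(3) by auto
        then have "Z (Y \<omega>) \<le> (1 + \<theta>)\<^sup>2 * (1 / \<kappa>') * H (Y \<omega>) + sqrt (2 * V * x)
            + (7 / \<theta> + 19 + 18 * \<theta> + 6 * \<theta>\<^sup>2) * x"
          using \<kappa>' m expectations_nonneg \<kappa>_pos x \<theta> unfolding A_def B_def mZ_def mH_def
          by (intro combine_upper[where \<kappa>=\<kappa> and m="\<integral>y. Z y \<partial>Q" and \<phi>="\<integral>y. H y \<partial>Q"]) auto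
        then have "M / n * Z (Y \<omega>) \<le> M / n * ((1 + \<theta>)\<^sup>2 * (1 / \<kappa>') * H (Y \<omega>) + sqrt (2 * V * x)
            + (7 / \<theta> + 19 + 18 * \<theta> + 6 * \<theta>\<^sup>2) * x)"
          using M_nonneg by (intro mult_left_mono) auto
        also have "\<dots> = (1 + \<theta>)\<^sup>2 * (1 / \<kappa>') * (M / n * H (Y \<omega>)) + M / n * sqrt (2 * V * x)
            + (7 / \<theta> + 19 + 18 * \<theta> + 6 * \<theta>\<^sup>2) * (x * M / n)"
        proof -
          have "M / n * (a * H (Y \<omega>) + s + c * x) = a * (M / n * H (Y \<omega>)) + M / n * s + c * (x * M / n)"
            for a s c by (simp add: distrib_left mult_ac)
          then show ?thesis .
        qed
        finally show "norm (sample_mean n X \<omega> - \<mu>) \<le> (1 + \<theta>)\<^sup>2 * (1 / \<kappa>') * R \<omega>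
            + (\<sigma> * sqrt (2 * x / n) + (7 / \<theta> + 19 + 18 * \<theta> + 6 * \<theta>\<^sup>2) * (x * M / n))"
          unfolding elim(1,2) using V_rescaled by linarith
      qed
    qed
  qed
  also have "?E = {\<omega> \<in> space P. \<forall>\<theta>>0. norm (sample_mean n X \<omega> - \<mu>)
    \<le> (1 + \<theta>)\<^sup>2 * (1 / \<kappa>') * R \<omega> + \<sigma> * sqrt (2 * x / n) + (7 / \<theta> + 19 + 18 * \<theta> + 6 * \<theta>\<^sup>2) * (x * M / n)}"
    by (simp add: add.assoc Ball_def)
  finally show ?thesis .
qed

text \<open>Two parameters, since b' (2 b, or b under symmetry) governs only the leading term while
  the remainder is in b throughout.\<close>

lemma lower_event:
  assumes b: "0 < b" "b \<le> b'" and m: "(\<integral>y. H y \<partial>Q) \<le> b' * (\<integral>y. Z y \<partial>Q)"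
  shows "1 - 2 * exp (- x) \<le> P.prob {\<omega> \<in> space P. \<forall>\<theta>\<in>{0<..1::real}. norm (sample_mean n X \<omega> - \<mu>)
    \<ge> (1 - \<theta>)\<^sup>2 * (1 / b') * R \<omega> - \<sigma> * sqrt (2 * x / n)
      - (3 * \<kappa> / 2 * (1 / b) + 1) * (x * M / (\<theta> * n))
      - (2 - 2 * \<kappa> * (1 / b) + \<theta>\<^sup>2 * (\<kappa> / 2 * (1 / b))) * (x * M / n)}"
proof -
  define mZ where "mZ = (\<integral>y. Z y \<partial>Q)"
  define mH where "mH = (\<integral>y. H y \<partial>Q)"
  define A where "A y \<longleftrightarrow> Z y < mZ - sqrt (2 * (V + 2 * mZ) * x) - 2 * x" for y
  define B where "B y \<longleftrightarrow> mH + 2 * sqrt (mH * (3/2 * \<kappa> * x)) + 3/2 * \<kappa> * x < H y" for y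
  have [measurable]: "Z \<in> borel_measurable Q" "H \<in> borel_measurable Q" by (rule Z_measurable, rule H_measurable)
  have sA: "{y \<in> space Q. A y} \<in> sets Q" and sB: "{y \<in> space Q. B y} \<in> sets Q"
    unfolding A_def B_def by measurable
  have pA: "P.prob {\<omega> \<in> space P. A (Y \<omega>)} \<le> exp (- x)"
    unfolding prob_Y(1)[OF sA] unfolding A_def mZ_def by (rule Z_lower_tail[OF h_variance x])
  have pB: "P.prob {\<omega> \<in> space P. B (Y \<omega>)} \<le> exp (- x)"
    unfolding prob_Y(1)[OF sB] unfolding B_def mH_def by (rule H_upper_tail_scaled[OF \<kappa>_pos x])
  define \<gamma> where "\<gamma> \<theta> = \<sigma> * sqrt (2 * x / n) + (3 * \<kappa> / 2 * (1 / b) + 1) * (x * M / (\<theta> * n))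
      + (2 - 2 * \<kappa> * (1 / b) + \<theta>\<^sup>2 * (\<kappa> / 2 * (1 / b))) * (x * M / n)" for \<theta> :: real
  \<comment> \<open>Negated on both sides to fit the affine form required by
    \<open>theta_event_measurable\<close>.\<close>
  let ?E = "{\<omega> \<in> space P. \<forall>\<theta>\<in>{0<..1::real}. - norm (sample_mean n X \<omega> - \<mu>)
    \<le> - ((1 - \<theta>)\<^sup>2 * (1 / b')) * R \<omega> + \<gamma> \<theta>}"
  have "1 - 2 * exp (- x) \<le> P.prob ?E"
  proof (rule P.two_event_bound[OF prob_Y(2)[OF sA] prob_Y(2)[OF sB] _ pA pB])
    show "?E \<in> P.events"
    proof (rule theta_event_measurable[OF _ R_measurable])
      show "(\<lambda>\<omega>. - norm (sample_mean n X \<omega> - \<mu>)) \<in> borel_measurable P"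
        by (intro borel_measurable_uminus deviation_measurable)
      show "\<exists>q\<in>{0<..1} \<inter> \<rat>. \<bar>q - \<theta>\<bar> < e" if "\<theta> \<in> {0<..1}" "0 < e" for \<theta> e :: real
        using rational_near_below[of \<theta> e] that by force
    qed (use n b in \<open>auto simp: \<gamma>_def intro!: continuous_intros\<close>)
    show "AE \<omega> in P. \<omega> \<notin> {\<omega> \<in> space P. A (Y \<omega>)} \<and> \<omega> \<notin> {\<omega> \<in> space P. B (Y \<omega>)} \<longrightarrow> \<omega> \<in> ?E"
      using deviation_eq R_eq AE_space
    proof eventually_elim
      case (elim \<omega>)
      show ?case
      proof (intro impI CollectI conjI ballI elim(3))
        fix \<theta> :: real assume good: "\<omega> \<notin> {\<omega> \<in> space P. A (Y \<omega>)} \<and> \<omega> \<notin> {\<omega> \<in> space P. B (Y \<omega>)}" and \<theta>: "\<theta> \<in> {0<..1}"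
        then have "\<not> A (Y \<omega>)" "\<not> B (Y \<omega>)" using elim(3) by auto
        then have "(1 - \<theta>)\<^sup>2 * (1 / b') * H (Y \<omega>) - sqrt (2 * V * x) - (3 * \<kappa> / 2 * (1 / b) + 1) * (x / \<theta>)
            - (2 - 2 * \<kappa> * (1 / b) + \<theta>\<^sup>2 * (\<kappa> / 2 * (1 / b))) * x \<le> Z (Y \<omega>)"
          using b m expectations_nonneg \<kappa>_pos x \<theta> unfolding A_def B_def mZ_def mH_def
          by (intro combine_lower[where m="\<integral>y. Z y \<partial>Q" and \<phi>="\<integral>y. H y \<partial>Q"]) auto
        then have scaled: "M / n * ((1 - \<theta>)\<^sup>2 * (1 / b') * H (Y \<omega>) - sqrt (2 * V * x) - (3 * \<kappa> / 2 * (1 / b) + 1) * (x / \<theta>)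
            - (2 - 2 * \<kappa> * (1 / b) + \<theta>\<^sup>2 * (\<kappa> / 2 * (1 / b))) * x) \<le> M / n * Z (Y \<omega>)"
          using M_nonneg by (intro mult_left_mono) auto
        have e: "M / n * (a * H (Y \<omega>) - s - c * (x / \<theta>) - d * x)
            = a * (M / n * H (Y \<omega>)) - M / n * s - c * (x * M / (\<theta> * n)) - d * (x * M / n)" for a s c d
          by (simp add: right_diff_distrib mult_ac)
        note scaled[unfolded e]
        then have "(1 - \<theta>)\<^sup>2 * (1 / b') * (M / n * H (Y \<omega>)) - M / n * sqrt (2 * V * x)
            - (3 * \<kappa> / 2 * (1 / b) + 1) * (x * M / (\<theta> * n))
            - (2 - 2 * \<kappa> * (1 / b) + \<theta>\<^sup>2 * (\<kappa> / 2 * (1 / b))) * (x * M / n) \<le> M / n * Z (Y \<omega>)" .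
        then show "- norm (sample_mean n X \<omega> - \<mu>) \<le> - ((1 - \<theta>)\<^sup>2 * (1 / b')) * R \<omega> + \<gamma> \<theta>"
          unfolding elim(1,2) \<gamma>_def mult_minus_left using V_rescaled by linarith
      qed
    qed
  qed
  also have "?E = {\<omega> \<in> space P. \<forall>\<theta>\<in>{0<..1::real}. norm (sample_mean n X \<omega> - \<mu>)
    \<ge> (1 - \<theta>)\<^sup>2 * (1 / b') * R \<omega> - \<sigma> * sqrt (2 * x / n)
      - (3 * \<kappa> / 2 * (1 / b) + 1) * (x * M / (\<theta> * n))
      - (2 - 2 * \<kappa> * (1 / b) + \<theta>\<^sup>2 * (\<kappa> / 2 * (1 / b))) * (x * M / n)}"
  proof (intro Collect_cong conj_cong refl ball_cong)
    fix \<omega> \<theta>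
    show "(- norm (sample_mean n X \<omega> - \<mu>) \<le> - ((1 - \<theta>)\<^sup>2 * (1 / b')) * R \<omega> + \<gamma> \<theta>) \<longleftrightarrow>
      (norm (sample_mean n X \<omega> - \<mu>) \<ge> (1 - \<theta>)\<^sup>2 * (1 / b') * R \<omega> - \<sigma> * sqrt (2 * x / n)
      - (3 * \<kappa> / 2 * (1 / b) + 1) * (x * M / (\<theta> * n))
      - (2 - 2 * \<kappa> * (1 / b) + \<theta>\<^sup>2 * (\<kappa> / 2 * (1 / b))) * (x * M / n))"
      unfolding \<gamma>_def mult_minus_left by linarith
  qed
  finally show ?thesis .
qed

lemma symmetric_law_if:
  assumes sym: "distr P borel (\<lambda>\<omega>. X 1 \<omega> - \<mu>) = distr P borel (\<lambda>\<omega>. \<mu> - X 1 \<omega>)"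
  shows symmetric_law
  unfolding symmetric_law_def
proof (intro allI)
  fix v :: 'a and a :: real
  define \<psi> where "\<psi> u = norm (v + a *\<^sub>R h (u + \<mu>))" for u
  have shift: "(\<lambda>u. u + \<mu>) \<in> measurable borel borel"
    by (intro borel_measurable_continuous_onI continuous_intros)
  have \<psi>: "\<psi> \<in> borel_measurable borel"
    unfolding \<psi>_def
    by (intro weakly_measurable_norm[OF sep] weakly_measurable_add weakly_measurable_const weakly_measurable_scaleR
        borel_measurable_const weakly_measurable_compose[OF h_weakly_measurable shift])
  have m1: "(\<lambda>\<omega>. X 1 \<omega> - \<mu>) \<in> measurable P borel"
    by (rule measurable_compose[OF X_meas[OF I_one]]) (intro borel_measurable_continuous_onI continuous_intros)
  have m2: "(\<lambda>\<omega>. \<mu> - X 1 \<omega>) \<in> measurable P borel"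
    by (rule measurable_compose[OF X_meas[OF I_one]]) (intro borel_measurable_continuous_onI continuous_intros)
  \<comment> \<open>The truncation region is a ball around \<mu>, so reflection at \<mu> preserves
    it.\<close>
  have odd: "h (\<mu> - X 1 \<omega> + \<mu>) = - h (X 1 \<omega>)" for \<omega>
    unfolding h_def by (simp add: norm_minus_commute) (metis minus_diff_eq scaleR_minus_right)
  have hN: "(\<integral>z. norm (v + c *\<^sub>R h z) \<partial>N) = (\<integral>\<omega>. norm (v + c *\<^sub>R h (X 1 \<omega>)) \<partial>P)" for c
    unfolding N_def
    by (intro integral_distr X_meas[OF I_one] weakly_measurable_norm[OF sep] weakly_measurable_add
        weakly_measurable_const weakly_measurable_scaleR borel_measurable_const h_weakly_measurable)
  have "(\<integral>z. norm (v - a *\<^sub>R h z) \<partial>N) = (\<integral>\<omega>. \<psi> (\<mu> - X 1 \<omega>) \<partial>P)"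
    using hN[of "- a"] unfolding \<psi>_def odd by simp
  also have "\<dots> = (\<integral>\<omega>. \<psi> (X 1 \<omega> - \<mu>) \<partial>P)"
    using integral_distr[OF m1 \<psi>] integral_distr[OF m2 \<psi>] sym by simp
  also have "\<dots> = (\<integral>z. norm (v + a *\<^sub>R h z) \<partial>N)" using hN[of a] unfolding \<psi>_def by simp
  finally show "(\<integral>z. norm (v - a *\<^sub>R h z) \<partial>N) = (\<integral>z. norm (v + a *\<^sub>R h z) \<partial>N)" .
qed

text \<open>The case 1 / b = 0: the bound loses its \<open>R\<close> term and is
  nonpositive.\<close>

lemma trivial_lower_event:
  "1 - 2 * exp (- x) \<le> P.prob {\<omega> \<in> space P. \<forall>\<theta>\<in>{0<..1::real}. norm (sample_mean n X \<omega> - \<mu>)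
    \<ge> - (\<sigma> * sqrt (2 * x / n)) - x * M / (\<theta> * n) - 2 * (x * M / n)}"
proof -
  have "- (\<sigma> * sqrt (2 * x / n)) - x * M / (\<theta> * n) - 2 * (x * M / n) \<le> r" if "\<theta> \<in> {0<..1}" "0 \<le> r" for r \<theta> :: real
  proof -
    have "0 \<le> \<sigma> * sqrt (2 * x / n)" "0 \<le> x * M / (\<theta> * n)" "0 \<le> x * M / n"
      using \<sigma>_nonneg x M_nonneg that by auto
    then show ?thesis using that(2) by linarith
  qed
  then have "{\<omega> \<in> space P. \<forall>\<theta>\<in>{0<..1::real}. norm (sample_mean n X \<omega> - \<mu>)
    \<ge> - (\<sigma> * sqrt (2 * x / n)) - x * M / (\<theta> * n) - 2 * (x * M / n)} = space P" by auto
  then show ?thesis by (simp add: P.prob_space)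
qed

end

theorem theorem22:
  fixes P :: "'w measure"
    and X :: "nat \<Rightarrow> 'w \<Rightarrow> 'a::banach"
    and \<xi> :: "nat \<Rightarrow> 'w \<Rightarrow> real"
    and n :: nat
    and \<mu> :: 'a
    and M x \<kappa> \<sigma> b_inv :: real
    and b :: ereal
    and R :: "'w \<Rightarrow> real"
  assumes "prob_space P"
    and "dual_ball_separable TYPE('a)"
    and "n \<ge> 1"
    and "prob_space.indep_vars P (\<lambda>_. borel) X {1..n}"
    and "\<forall>i\<in>{1..n}. distr P borel (X i) = distr P borel (X 1)"
    and "has_expectation P (X 1) \<mu>"
    and "\<forall>i\<in>{1..n}. \<xi> i \<in> borel_measurable P"
    and "exchangeable P n \<xi>"
    and "prob_space.indep_set P (sets (sample_algebra P n \<xi>)) (sets (sample_algebra P n X))"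
    and "AE \<omega> in P. (\<Sum>i=1..n. \<xi> i \<omega>) = 0"
    and "integrable P (\<lambda>\<omega>. \<bar>\<xi> 1 \<omega>\<bar>)"
    and "\<kappa> = (\<integral>\<omega>. \<bar>\<xi> 1 \<omega>\<bar> \<partial>P)"
    and "\<kappa> > 0"
    and "b = esssup P (\<lambda>\<omega>. ereal \<bar>\<xi> 1 \<omega>\<bar>)"
    and "b_inv = real_of_ereal (1 / b)"  (* 0 if b is infinite *)
    and "R = weighted_complexity P n \<xi> X"
    and "\<sigma> = weak_sd P (X 1)"
    and "AE \<omega> in P. norm (X 1 \<omega> - \<mu>) \<le> M"
    and "x > 0"
  shows
    "measure P {\<omega> \<in> space P. \<forall>\<theta>>0.
        norm (sample_mean n X \<omega> - \<mu>) \<le>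
          (1 + \<theta>)\<^sup>2 * (2 / \<kappa>) * R \<omega> + \<sigma> * sqrt (2 * x / n)
          + (7 / \<theta> + 19 + 18 * \<theta> + 6 * \<theta>\<^sup>2) * (x * M / n)} \<ge> 1 - 2 * exp (- x) \<and>
     measure P {\<omega> \<in> space P. \<forall>\<theta>\<in>{0<..1}.
        norm (sample_mean n X \<omega> - \<mu>) \<ge>
          (1 - \<theta>)\<^sup>2 * (b_inv / 2) * R \<omega> - \<sigma> * sqrt (2 * x / n)
          - (3 * \<kappa> / 2 * b_inv + 1) * (x * M / (\<theta> * n))
          - (2 - 2 * \<kappa> * b_inv + \<theta>\<^sup>2 * (\<kappa> / 2 * b_inv)) * (x * M / n)} \<ge> 1 - 2 * exp (- x) \<and>
     (distr P borel (\<lambda>\<omega>. X 1 \<omega> - \<mu>) = distr P borel (\<lambda>\<omega>. \<mu> - X 1 \<omega>) \<longrightarrow>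
       measure P {\<omega> \<in> space P. \<forall>\<theta>>0.
          norm (sample_mean n X \<omega> - \<mu>) \<le>
            (1 + \<theta>)\<^sup>2 * (1 / \<kappa>) * R \<omega> + \<sigma> * sqrt (2 * x / n)
            + (7 / \<theta> + 19 + 18 * \<theta> + 6 * \<theta>\<^sup>2) * (x * M / n)} \<ge> 1 - 2 * exp (- x) \<and>
       measure P {\<omega> \<in> space P. \<forall>\<theta>\<in>{0<..1}.
          norm (sample_mean n X \<omega> - \<mu>) \<ge>
            (1 - \<theta>)\<^sup>2 * b_inv * R \<omega> - \<sigma> * sqrt (2 * x / n)
            - (3 * \<kappa> / 2 * b_inv + 1) * (x * M / (\<theta> * n))
            - (2 - 2 * \<kappa> * b_inv + \<theta>\<^sup>2 * (\<kappa> / 2 * b_inv)) * (x * M / n)} \<ge> 1 - 2 * exp (- x))"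
proof -
  interpret weighted_sample P X \<xi> n \<mu> M x \<kappa>
    by (rule weighted_sample.intro, fact, rule weighted_sample_axioms.intro) fact+
  have R: "R = weighted_complexity P n \<xi> X" and \<sigma>: "\<sigma> = weak_sd P (X 1)" by fact+
  have b1: "AE \<omega> in P. ereal \<bar>\<xi> 1 \<omega>\<bar> \<le> b" unfolding \<open>b = _\<close> by (rule esssup_AE)
  have upper: "symmetric_law \<Longrightarrow> \<kappa> / 2 \<le> \<kappa>" using \<kappa>_pos by simp
  have lower: "measure P {\<omega> \<in> space P. \<forall>\<theta>\<in>{0<..1}. norm (sample_mean n X \<omega> - \<mu>) \<ge>
          (1 - \<theta>)\<^sup>2 * (b_inv / 2) * R \<omega> - \<sigma> * sqrt (2 * x / n)
          - (3 * \<kappa> / 2 * b_inv + 1) * (x * M / (\<theta> * n))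
          - (2 - 2 * \<kappa> * b_inv + \<theta>\<^sup>2 * (\<kappa> / 2 * b_inv)) * (x * M / n)} \<ge> 1 - 2 * exp (- x) \<and>
    (symmetric_law \<longrightarrow> measure P {\<omega> \<in> space P. \<forall>\<theta>\<in>{0<..1}. norm (sample_mean n X \<omega> - \<mu>) \<ge>
          (1 - \<theta>)\<^sup>2 * b_inv * R \<omega> - \<sigma> * sqrt (2 * x / n)
          - (3 * \<kappa> / 2 * b_inv + 1) * (x * M / (\<theta> * n))
          - (2 - 2 * \<kappa> * b_inv + \<theta>\<^sup>2 * (\<kappa> / 2 * b_inv)) * (x * M / n)} \<ge> 1 - 2 * exp (- x))"
  proof (cases "b = \<infinity>")
    case True
    then have b0: "b_inv = 0" unfolding \<open>b_inv = _\<close> by simp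
    have e: "a * (0 / 2) * r - c - (3 * \<kappa> / 2 * 0 + 1) * u - (2 - 2 * \<kappa> * 0 + d * (\<kappa> / 2 * 0)) * w = - c - u - 2 * w"
      "a * 0 * r - c - (3 * \<kappa> / 2 * 0 + 1) * u - (2 - 2 * \<kappa> * 0 + d * (\<kappa> / 2 * 0)) * w = - c - u - 2 * w"
      for a r c u w d :: real by simp_all
    show ?thesis using trivial_lower_event unfolding b0 e \<sigma> by blast
  next
    case False
    have "b \<noteq> - \<infinity>"
    proof
      assume "b = - \<infinity>"
      then have "AE \<omega> in P. False" using b1 by simp
      then show False by simp
    qed
    with False obtain r where r: "b = ereal r" by (cases b) auto
    have \<xi>1: "AE \<omega> in P. \<bar>\<xi> 1 \<omega>\<bar> \<le> r" using b1 unfolding r by simp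
    \<comment> \<open>The mean of |\<xi> 1| is at most its essential supremum; positivity of the
      latter thus comes from \<kappa> > 0.\<close>
    have "\<kappa> \<le> r" unfolding \<kappa>_def by (rule P.integral_le_const[OF \<xi>_int \<xi>1])
    then have rpos: "0 < r" using \<kappa>_pos by simp
    have binv: "b_inv = 1 / r" unfolding \<open>b_inv = _\<close> r using rpos by (simp add: one_ereal_def)
    note sym_up = symmetrisation_upper[OF rpos \<xi>_AE_bound[OF \<xi>1]]
    have half: "1 / r / 2 = 1 / (2 * r)" by simp
    \<comment> \<open>The general case takes b' = 2 r in \<open>lower_event\<close>, the symmetric
      case b' = r.\<close>
    have "r \<le> 2 * r" using rpos by simp
    then show ?thesis unfolding binv half R \<sigma>
      by (intro conjI impI lower_event[OF rpos] sym_up order_refl)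
  qed
  have up1: "2 / \<kappa> = 1 / (\<kappa> / 2)" by simp
  show ?thesis
  proof (intro conjI impI)
    show "measure P {\<omega> \<in> space P. \<forall>\<theta>>0. norm (sample_mean n X \<omega> - \<mu>) \<le>
          (1 + \<theta>)\<^sup>2 * (2 / \<kappa>) * R \<omega> + \<sigma> * sqrt (2 * x / n)
          + (7 / \<theta> + 19 + 18 * \<theta> + 6 * \<theta>\<^sup>2) * (x * M / n)} \<ge> 1 - 2 * exp (- x)"
      unfolding up1 R \<sigma>
      by (rule upper_event[OF order_refl symmetrisation_lower_centred[OF \<xi>_centred]])
  next
    assume "distr P borel (\<lambda>\<omega>. X 1 \<omega> - \<mu>) = distr P borel (\<lambda>\<omega>. \<mu> - X 1 \<omega>)"
    then have sym: symmetric_law by (rule symmetric_law_if)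
    show "measure P {\<omega> \<in> space P. \<forall>\<theta>>0. norm (sample_mean n X \<omega> - \<mu>) \<le>
          (1 + \<theta>)\<^sup>2 * (1 / \<kappa>) * R \<omega> + \<sigma> * sqrt (2 * x / n)
          + (7 / \<theta> + 19 + 18 * \<theta> + 6 * \<theta>\<^sup>2) * (x * M / n)} \<ge> 1 - 2 * exp (- x)"
      unfolding R \<sigma> by (rule upper_event[OF upper[OF sym] symmetrisation_lower_symmetric[OF sym]])
    show "measure P {\<omega> \<in> space P. \<forall>\<theta>\<in>{0<..1}. norm (sample_mean n X \<omega> - \<mu>) \<ge>
          (1 - \<theta>)\<^sup>2 * b_inv * R \<omega> - \<sigma> * sqrt (2 * x / n)
          - (3 * \<kappa> / 2 * b_inv + 1) * (x * M / (\<theta> * n))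
          - (2 - 2 * \<kappa> * b_inv + \<theta>\<^sup>2 * (\<kappa> / 2 * b_inv)) * (x * M / n)} \<ge> 1 - 2 * exp (- x)"
      by (rule lower[THEN conjunct2, THEN mp, OF sym])
  qed (rule lower[THEN conjunct1])
qed

end
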